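(* Let $\mathbb{G}$ be a compact quantum group and let $U$ be a finite-dimensional unitary representation of $\mathbb{G}$. For $n\in\mathbb{N}$ let $P_U(n)$ denote the maximal dimension of an irreducible subrepresentation of the $n$-th tensor power of $U$. Assume that $$\forall\, c>1\qquad \lim_{n\to\infty}\frac{P_U(n)}{c^n}=0 .$$ Then the eigenvalues of $\rho_U$ are symmetric, i.e. the list of eigenvalues of $\rho_U$ (with multiplicities, in descending order) coincides with the list of eigenvalues of $\rho_U^{-1}$ (with multiplicities, in descending order).
   Context: A compact quantum group $\mathbb{G}$ is given by a unital C*-algebra $C(\mathbb{G})$ with a unital coassociative $*$-homomorphism $\Delta:C(\mathbb{G})\to C(\mathbb{G})\otimes C(\mathbb{G})$ satisfying the cancellation (density) conditions. A finite-dimensional representation on a nonzero finite-dimensional Hilbert space $H$ is an invertible $U\in B(H)\otimes C(\mathbb{G})$ with $(\iota\otimes\Delta)(U)=U_{12}U_{13}$; it is unitary if $U$ is unitary. $\mathrm{Mor}(U,V)$ is the space of operators $T:H_U\to H_V$ with $(T\otimes 1)U=V(T\otimes 1)$, and $\mathrm{End}(U)=\mathrm{Mor}(U,U)$. The tensor product of $U$ and $V$ is $U_{13}V_{23}$ on $H_U\otimes H_V$; every finite-dimensional unitary representation is equivalent to a direct sum of irreducible ones. The contragredient of $U$ is the representation $U^{c}=(j\otimes\iota)(U^{-1})$ on the conjugate Hilbert space $\overline{H}$, where $j(T)\overline{\xi}=\overline{T^*\xi}$; $U^{cc}=(U^{c})^{c}$ is regarded as a representation on $H$ via $\overline{\overline{H}}=H$.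 For a finite-dimensional unitary representation $U$, $\rho_U$ denotes the unique positive invertible operator in $\mathrm{Mor}(U,U^{cc})$ such that $\mathrm{Tr}(T\rho_U)=\mathrm{Tr}(T\rho_U^{-1})$ for all $T\in\mathrm{End}(U)$. Definition of $P_U$: if the $n$-fold tensor power of $U$ is equivalent to $\bigoplus_{k=1}^N U^{\alpha_k}$ with each $U^{\alpha_k}$ an irreducible unitary representation, then $P_U(n)=\max\{\dim U^{\alpha_1},\dots,\dim U^{\alpha_N}\}$. *)

theory Defs
  imports "HOL-Analysis.Elementary_Topology"
    "HOL-Computational_Algebra.Polynomial"
    "Jordan_Normal_Form.Schur_Decomposition"
begin

section \<open>Unital C*-algebras\<close>

class cstar_algebra = real_normed_algebra_1 + banach +
  fixes scaleC :: "complex \<Rightarrow> 'a \<Rightarrow> 'a"  (infixr \<open>*\<^sub>C\<close> 75)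
    and star :: "'a \<Rightarrow> 'a"
  assumes scaleC_add_right: "c *\<^sub>C (x + y) = c *\<^sub>C x + c *\<^sub>C y"
    and scaleC_add_left: "(c + d) *\<^sub>C x = c *\<^sub>C x + d *\<^sub>C x"
    and scaleC_scaleC: "c *\<^sub>C d *\<^sub>C x = (c * d) *\<^sub>C x"
    and scaleC_of_real: "complex_of_real r *\<^sub>C x = r *\<^sub>R x"
    and mult_scaleC_left: "(c *\<^sub>C x) * y = c *\<^sub>C (x * y)"
    and mult_scaleC_right: "x * (c *\<^sub>C y) = c *\<^sub>C (x * y)"
    and norm_scaleC: "norm (c *\<^sub>C x) = cmod c * norm x"
    and star_star: "star (star x) = x"
    and star_add: "star (x + y) = star x + star y"
    and star_mult: "star (x * y) = star y * star x"
    and star_scaleC: "star (c *\<^sub>C x) = cnj c *\<^sub>C star x"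
    and cstar_identity: "norm (star x * x) = (norm x)\<^sup>2"

definition unital_star_hom :: "('a::cstar_algebra \<Rightarrow> 'b::cstar_algebra) \<Rightarrow> bool" where
  "unital_star_hom f \<longleftrightarrow>
     (\<forall>x y. f (x + y) = f x + f y) \<and> (\<forall>c x. f (c *\<^sub>C x) = c *\<^sub>C f x) \<and>
     (\<forall>x y. f (x * y) = f x * f y) \<and> (\<forall>x. f (star x) = star (f x)) \<and> f 1 = 1"

definition state :: "('a::cstar_algebra \<Rightarrow> complex) \<Rightarrow> bool" where
  "state \<phi> \<longleftrightarrow>
     (\<forall>x y. \<phi> (x + y) = \<phi> x + \<phi> y) \<and> (\<forall>c x. \<phi> (c *\<^sub>C x) = c * \<phi> x) \<and>
     (\<forall>x. 0 \<le> \<phi> (star x * x)) \<and> \<phi> 1 = 1"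


section \<open>The minimal tensor product\<close>

text \<open>
  An element of the algebraic tensor product is given by a list of pairs, \<open>[(a\<^sub>1, b\<^sub>1), \<dots>]\<close>
  standing for the sum of the \<open>a\<^sub>i \<otimes> b\<^sub>i\<close>. For such a list \<open>zs\<close>, with sum \<open>z\<close>,
  \<open>product_state_square \<phi> \<psi> zs\<close> is \<open>(\<phi> \<otimes> \<psi>)(z\<^sup>* z)\<close>, the squared norm of the vector
  \<open>z (\<xi>\<^sub>\<phi> \<otimes> \<xi>\<^sub>\<psi>)\<close> in the tensor product of the GNS spaces of \<open>\<phi>\<close> and \<open>\<psi>\<close>.
\<close>

definition product_state_square ::
    "('a::cstar_algebra \<Rightarrow> complex) \<Rightarrow> ('b::cstar_algebra \<Rightarrow> complex) \<Rightarrow> ('a \<times> 'b) list \<Rightarrow> real" where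
  "product_state_square \<phi> \<psi> zs =
     Re (\<Sum>(a, b)\<leftarrow>zs. \<Sum>(c, d)\<leftarrow>zs. \<phi> (star a * c) * \<psi> (star b * d))"

definition tensor_mult ::
    "('a::cstar_algebra \<times> 'b::cstar_algebra) list \<Rightarrow> ('a \<times> 'b) list \<Rightarrow> ('a \<times> 'b) list" where
  "tensor_mult xs ys = [(a * c, b * d). (a, b) \<leftarrow> xs, (c, d) \<leftarrow> ys]"

text \<open>
  The minimal (spatial) norm: the supremum of the operator norms of the sum of the
  \<open>\<pi>\<^sub>\<phi>(a\<^sub>i) \<otimes> \<pi>\<^sub>\<psi>(b\<^sub>i)\<close> over all pairs of GNS representations. The operator norm is computed on the
  dense subspace of vectors \<open>y (\<xi>\<^sub>\<phi> \<otimes> \<xi>\<^sub>\<psi>)\<close> with \<open>y\<close> in the algebraic tensor product.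
\<close>

definition spatial_norm :: "('a::cstar_algebra \<times> 'b::cstar_algebra) list \<Rightarrow> real" where
  "spatial_norm xs =
     Sup {sqrt (product_state_square \<phi> \<psi> (tensor_mult xs ys)) | \<phi> \<psi> ys.
            state \<phi> \<and> state \<psi> \<and> product_state_square \<phi> \<psi> ys = 1}"

text \<open>
  \<open>min_tensor_product \<tau>\<close> says that the type \<open>'c\<close> together with \<open>\<tau> a b = a \<otimes> b\<close> is the minimal tensor
  product of \<open>'a\<close> and \<open>'b\<close>, that is, the completion of the algebraic tensor product in the
  spatial norm. This determines \<open>('c, \<tau>)\<close> up to a unique isomorphism. The range of \<open>\<tau>\<close> is closed under
  complex scalars, so its real span is its complex span.
\<close>

definition min_tensor_product ::
    "('a::cstar_algebra \<Rightarrow> 'b::cstar_algebra \<Rightarrow> 'c::cstar_algebra) \<Rightarrow> bool" where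
  "min_tensor_product \<tau> \<longleftrightarrow>
     (\<forall>a a' b. \<tau> (a + a') b = \<tau> a b + \<tau> a' b) \<and>
     (\<forall>a b b'. \<tau> a (b + b') = \<tau> a b + \<tau> a b') \<and>
     (\<forall>c a b. \<tau> (c *\<^sub>C a) b = c *\<^sub>C \<tau> a b) \<and>
     (\<forall>c a b. \<tau> a (c *\<^sub>C b) = c *\<^sub>C \<tau> a b) \<and>
     (\<forall>a a' b b'. \<tau> a b * \<tau> a' b' = \<tau> (a * a') (b * b')) \<and>
     (\<forall>a b. star (\<tau> a b) = \<tau> (star a) (star b)) \<and>
     \<tau> 1 1 = 1 \<and>
     (\<forall>xs. norm (\<Sum>(a, b)\<leftarrow>xs. \<tau> a b) = spatial_norm xs) \<and>
     closure (span {\<tau> a b | a b. True}) = UNIV"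

text \<open>
  \<open>is_tensor_map \<tau> \<tau>' f g h\<close>: \<open>h\<close> is the homomorphism \<open>f \<otimes> g\<close>, where \<open>\<tau>\<close> and \<open>\<tau>'\<close> are the tensor
  products at the source and at the target. Homomorphisms of C*-algebras are continuous, so
  there is at most one such \<open>h\<close>.
\<close>

definition is_tensor_map ::
    "('a::cstar_algebra \<Rightarrow> 'b::cstar_algebra \<Rightarrow> 'c::cstar_algebra) \<Rightarrow>
     ('d::cstar_algebra \<Rightarrow> 'e::cstar_algebra \<Rightarrow> 'f::cstar_algebra) \<Rightarrow>
     ('a \<Rightarrow> 'd) \<Rightarrow> ('b \<Rightarrow> 'e) \<Rightarrow> ('c \<Rightarrow> 'f) \<Rightarrow> bool" where
  "is_tensor_map \<tau> \<tau>' f g h \<longleftrightarrow>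
     unital_star_hom h \<and> (\<forall>a b. h (\<tau> a b) = \<tau>' (f a) (g b))"


section \<open>Compact quantum groups\<close>

text \<open>
  The algebra \<open>C(G)\<close> is the type \<open>'a\<close>, its tensor square is \<open>'b\<close> with elementary tensors \<open>\<tau> a b\<close>, and
  its tensor cube is \<open>'c\<close>, with \<open>\<tau>l\<close> and \<open>\<tau>r\<close> presenting it as \<open>(C(G) \<otimes> C(G)) \<otimes> C(G)\<close> and
  as \<open>C(G) \<otimes> (C(G) \<otimes> C(G))\<close>. Since \<open>\<Delta>\<close> is linear, the sets in the density conditions are closed
  under complex scalars, so that the real spans are complex spans.
\<close>

locale compact_quantum_group =
  fixes \<Delta> :: "'a::cstar_algebra \<Rightarrow> 'b::cstar_algebra"
    and \<tau> :: "'a \<Rightarrow> 'a \<Rightarrow> 'b"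
    and \<tau>l :: "'b \<Rightarrow> 'a \<Rightarrow> 'c::cstar_algebra"
    and \<tau>r :: "'a \<Rightarrow> 'b \<Rightarrow> 'c"
  assumes tensor_square: "min_tensor_product \<tau>"
    and tensor_cube_left: "min_tensor_product \<tau>l"
    and tensor_cube_right: "min_tensor_product \<tau>r"
    and tensor_cube_assoc: "\<tau>l (\<tau> a b) c = \<tau>r a (\<tau> b c)"
    and comult_hom: "unital_star_hom \<Delta>"
    and coassociative:
      "\<exists>L R. is_tensor_map \<tau> \<tau>l \<Delta> id L \<and> is_tensor_map \<tau> \<tau>r id \<Delta> R \<and> (\<forall>a. L (\<Delta> a) = R (\<Delta> a))"
    and cancellation_left: "closure (span {\<tau> a 1 * \<Delta> b | a b. True}) = UNIV"
    and cancellation_right: "closure (span {\<tau> 1 a * \<Delta> b | a b. True}) = UNIV"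


section \<open>Finite-dimensional representations\<close>

text \<open>
  A finite-dimensional Hilbert space \<open>H\<close> is given by an orthonormal basis, hence as
  \<open>\<complex>\<^sup>d\<close> with \<open>d = dim H\<close>; then \<open>B(H)\<close> is the algebra of \<open>d \<times> d\<close> matrices and an element
  \<open>U\<close> of \<open>B(H) \<otimes> C(G)\<close> is a \<open>d \<times> d\<close> matrix over \<open>C(G)\<close>.
\<close>

definition ampliate :: "complex mat \<Rightarrow> 'a::cstar_algebra mat" where
  "ampliate T = map_mat (\<lambda>c. c *\<^sub>C 1) T"

definition the_inverse_mat :: "'r::semiring_1 mat \<Rightarrow> 'r mat" where
  "the_inverse_mat A = (THE B. inverts_mat A B \<and> inverts_mat B A)"

text \<open>The two factors on the right-hand side of the last line are \<open>U\<^sub>1\<^sub>2\<close> and \<open>U\<^sub>1\<^sub>3\<close>.\<close>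

definition representation ::
    "('a::cstar_algebra \<Rightarrow> 'b::cstar_algebra) \<Rightarrow> ('a \<Rightarrow> 'a \<Rightarrow> 'b) \<Rightarrow> 'a mat \<Rightarrow> bool" where
  "representation \<Delta> \<tau> U \<longleftrightarrow>
     0 < dim_row U \<and> invertible_mat U \<and>
     map_mat \<Delta> U = map_mat (\<lambda>a. \<tau> a 1) U * map_mat (\<lambda>a. \<tau> 1 a) U"

definition star_mat :: "'a::cstar_algebra mat \<Rightarrow> 'a mat" where
  "star_mat U = map_mat star (transpose_mat U)"

definition unitary_representation ::
    "('a::cstar_algebra \<Rightarrow> 'b::cstar_algebra) \<Rightarrow> ('a \<Rightarrow> 'a \<Rightarrow> 'b) \<Rightarrow> 'a mat \<Rightarrow> bool" where
  "unitary_representation \<Delta> \<tau> U \<longleftrightarrow>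
     representation \<Delta> \<tau> U \<and> inverts_mat U (star_mat U) \<and> inverts_mat (star_mat U) U"

definition Mor :: "'a::cstar_algebra mat \<Rightarrow> 'a mat \<Rightarrow> complex mat set" where
  "Mor U V = {T \<in> carrier_mat (dim_row V) (dim_row U). ampliate T * U = V * ampliate T}"

abbreviation End :: "'a::cstar_algebra mat \<Rightarrow> complex mat set" where
  "End U \<equiv> Mor U U"

definition equivalent :: "'a::cstar_algebra mat \<Rightarrow> 'a mat \<Rightarrow> bool" where
  "equivalent U V \<longleftrightarrow> (\<exists>T \<in> Mor U V. invertible_mat T)"

text \<open>An invariant subspace is represented by its orthogonal projection.\<close>

definition irreducible_rep :: "'a::cstar_algebra mat \<Rightarrow> bool" where
  "irreducible_rep U \<longleftrightarrow>
     (\<forall>e \<in> carrier_mat (dim_row U) (dim_row U).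
        mat_adjoint e = e \<and> e * e = e \<and> ampliate e * U * ampliate e = U * ampliate e \<longrightarrow>
        e = 0\<^sub>m (dim_row U) (dim_row U) \<or> e = 1\<^sub>m (dim_row U))"

text \<open>
  \<open>U\<^sub>1\<^sub>3V\<^sub>2\<^sub>3\<close>, with respect to the product basis in lexicographic order.
\<close>

definition tensor_rep :: "'a::cstar_algebra mat \<Rightarrow> 'a mat \<Rightarrow> 'a mat" where
  "tensor_rep U V =
     mat (dim_row U * dim_row V) (dim_col U * dim_col V)
       (\<lambda>(r, s). U $$ (r div dim_row V, s div dim_col V) * V $$ (r mod dim_row V, s mod dim_col V))"

fun tensor_power :: "'a::cstar_algebra mat \<Rightarrow> nat \<Rightarrow> 'a mat" where
  "tensor_power U 0 = 1\<^sub>m 1"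
| "tensor_power U (Suc n) = tensor_rep (tensor_power U n) U"

definition decomposition ::
    "('a::cstar_algebra \<Rightarrow> 'b::cstar_algebra) \<Rightarrow> ('a \<Rightarrow> 'a \<Rightarrow> 'b) \<Rightarrow> 'a mat \<Rightarrow> 'a mat list \<Rightarrow> bool" where
  "decomposition \<Delta> \<tau> U Vs \<longleftrightarrow>
     (\<forall>V \<in> set Vs. unitary_representation \<Delta> \<tau> V \<and> irreducible_rep V) \<and>
     equivalent U (diag_block_mat Vs)"

text \<open>The number \<open>P\<^sub>U(n)\<close>; it does not depend on the chosen decomposition.\<close>

definition max_irrep_dim ::
    "('a::cstar_algebra \<Rightarrow> 'b::cstar_algebra) \<Rightarrow> ('a \<Rightarrow> 'a \<Rightarrow> 'b) \<Rightarrow> 'a mat \<Rightarrow> nat \<Rightarrow> nat" where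
  "max_irrep_dim \<Delta> \<tau> U n =
     (THE m. \<exists>Vs. decomposition \<Delta> \<tau> (tensor_power U n) Vs \<and> m = Max (dim_row ` set Vs))"


section \<open>The contragredient representation and the operator \<open>\<rho>\<^sub>U\<close>\<close>

text \<open>
  In the basis of the conjugate Hilbert space formed by the conjugates of the basis vectors of
  \<open>H\<close>, the map \<open>j\<close> is the transposition of matrices, and the identification of the second conjugate of
  \<open>H\<close> with \<open>H\<close> is the identity of \<open>\<complex>\<^sup>d\<close>. Being the contragredient is stated as a relation
  between representations because \<open>U\<^sup>c\<^sup>c\<close> involves the inverse of \<open>U\<^sup>c\<close>.
\<close>

definition contragredient ::
    "('a::cstar_algebra \<Rightarrow> 'b::cstar_algebra) \<Rightarrow> ('a \<Rightarrow> 'a \<Rightarrow> 'b) \<Rightarrow> 'a mat \<Rightarrow> 'a mat \<Rightarrow> bool" where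
  "contragredient \<Delta> \<tau> U V \<longleftrightarrow>
     representation \<Delta> \<tau> U \<and> representation \<Delta> \<tau> V \<and> V = transpose_mat (the_inverse_mat U)"

definition positive_mat :: "complex mat \<Rightarrow> bool" where
  "positive_mat A \<longleftrightarrow>
     square_mat A \<and> (\<forall>v \<in> carrier_vec (dim_row A). 0 \<le> (A *\<^sub>v v) \<bullet>c v)"

definition trace_mat :: "complex mat \<Rightarrow> complex" where
  "trace_mat A = sum_list (diag_mat A)"

text \<open>\<open>\<rho>\<close> is the operator \<open>\<rho>\<^sub>U\<close>; for a unitary representation there is exactly one such \<open>\<rho>\<close>.\<close>

definition is_rho ::
    "('a::cstar_algebra \<Rightarrow> 'b::cstar_algebra) \<Rightarrow> ('a \<Rightarrow> 'a \<Rightarrow> 'b) \<Rightarrow> 'a mat \<Rightarrow> complex mat \<Rightarrow> bool" where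
  "is_rho \<Delta> \<tau> U \<rho> \<longleftrightarrow>
     (\<exists>Uc Ucc. contragredient \<Delta> \<tau> U Uc \<and> contragredient \<Delta> \<tau> Uc Ucc \<and> \<rho> \<in> Mor U Ucc) \<and>
     positive_mat \<rho> \<and> invertible_mat \<rho> \<and>
     (\<forall>T \<in> End U. trace_mat (T * \<rho>) = trace_mat (T * the_inverse_mat \<rho>))"

text \<open>
  The eigenvalues in descending order, repeated according to multiplicity, of a matrix all of whose
  eigenvalues are real.
\<close>

definition eigenvalue_list :: "complex mat \<Rightarrow> real list" where
  "eigenvalue_list A = rev (sorted_list_of_multiset (image_mset Re (proots (char_poly A))))"

end

theory Submission
  imports Defs "HOL-Analysis.Norm_Arith" "HOL-Computational_Algebra.Formal_Power_Series"
begin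

text \<open>
  Fix an exponent \<open>s\<close>. Put \<open>A = U\<^sup>\<otimes>\<^sup>n\<close> and \<open>R = \<rho>\<^sup>\<otimes>\<^sup>n\<close>, where \<open>\<rho> = \<rho>\<^sub>U\<close>. The operator \<open>R\<close> commutes
  with \<open>End A\<close>, and \<open>Tr (T R) = Tr (T R\<^sup>-\<^sup>1)\<close> for every \<open>T\<close> in \<open>End A\<close>. So \<open>R\<close> restricts to every
  irreducible summand of \<open>A\<close>, and the restriction \<open>Q\<close> to a summand of dimension \<open>d\<close> satisfies
  \<open>Tr Q = Tr Q\<^sup>-\<^sup>1\<close>. The largest eigenvalue of \<open>Q\<close> is at most \<open>Tr Q = Tr Q\<^sup>-\<^sup>1\<close>, hence at most \<open>d\<close>
  times the largest eigenvalue of \<open>Q\<^sup>-\<^sup>1\<close>, and therefore \<open>Tr Q\<^sup>s \<le> d\<^sup>s\<^sup>+\<^sup>1 Tr Q\<^sup>-\<^sup>s\<close>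
  (\<open>trace_pow_bound\<close>). Summation over the summands of \<open>A\<close> gives
  \<open>(Tr \<rho>\<^sup>s)\<^sup>n = Tr R\<^sup>s \<le> P(n)\<^sup>s\<^sup>+\<^sup>1 Tr R\<^sup>-\<^sup>s = P(n)\<^sup>s\<^sup>+\<^sup>1 (Tr \<rho>\<^sup>-\<^sup>s)\<^sup>n\<close> with \<open>P = P\<^sub>U\<close>. Since \<open>P\<close>
  grows more slowly than every exponential, taking \<open>n\<close>-th roots shows \<open>Tr \<rho>\<^sup>s \<le> Tr \<rho>\<^sup>-\<^sup>s\<close>
  (\<open>growth_comparison\<close>), and the opposite inequality holds by symmetry. The eigenvalues of \<open>\<rho>\<close> and
  of \<open>\<rho>\<^sup>-\<^sup>1\<close> thus have the same power sums, so they coincide with multiplicities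
  (\<open>power_sums_determine_multiset\<close>).

  The properties of \<open>R\<close> are obtained as follows. That \<open>\<rho>\<close> intertwines \<open>U\<close> with its second
  contragredient passes to tensor products (\<open>modular_pair_kron\<close>). The equality of the two traces
  passes to tensor products because partial traces, weighted by \<open>\<rho>\<close> or by \<open>\<rho>\<^sup>-\<^sup>1\<close>, map
  intertwiners to intertwiners (\<open>traces_agree_kron\<close>). For an intertwiner \<open>S\<close> of \<open>A\<close>, both
  \<open>R\<^sup>-\<^sup>1 S R\<close> and \<open>R S R\<^sup>-\<^sup>1\<close> are again intertwiners; the equality of the traces shows that they
  coincide, so that \<open>R\<^sup>2\<close>, and with it \<open>R\<close>, commutes with \<open>S\<close> (\<open>modular_commutes\<close>).

  It remains to decompose \<open>A\<close> into irreducible representations. Integration with respect to the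
  Haar state is replaced by the identity \<open>Tr (R\<^sup>-\<^sup>1 A\<^sup>* T A) = Tr (R\<^sup>-\<^sup>1 T) 1\<close> for scalar matrices
  \<open>T\<close> (\<open>modular_trace_invariant\<close>), which is the intertwining property of \<open>R\<close> written in terms of
  matrix entries. If \<open>e\<close> is a projection onto an invariant subspace, the identity for \<open>T = 1 - e\<close>
  says \<open>Tr (R\<^sup>-\<^sup>1 x\<^sup>* x) = 0\<close> for the corner \<open>x = e A (1 - e)\<close>, and this forces \<open>x = 0\<close>
  (\<open>invariant_projection_commutes\<close>). The last step uses that a sum of elements \<open>y\<^sup>* y\<close> of a
  C*-algebra vanishes only if every \<open>y\<close> does. For a C*-algebra that is given by axioms, not by
  operators on a Hilbert space, this is the theorem of Fukamiya and Kaplansky that \<open>y\<^sup>* y\<close> is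
  positive (\<open>star_mult_self_pos\<close>). That the dimensions of the irreducible summands do not depend
  on the decomposition follows from Schur's lemma (\<open>decomposition_dims_subset\<close>).
\<close>

section \<open>Positivity in a C*-algebra\<close>

lemma star_zero [simp]: "star (0::'a::cstar_algebra) = 0"
  using star_add[of 0 "0::'a"] by simp

lemma star_one [simp]: "star (1::'a::cstar_algebra) = 1"
  by (metis mult_1 mult_1_right star_mult star_star)

lemma star_minus: "star (- x) = - star (x::'a::cstar_algebra)"
  by (metis add.right_inverse add_eq_0_iff star_add star_zero)

lemma star_diff: "star (x - y) = star x - star (y::'a::cstar_algebra)"
  using star_add[of x "-y"] by (simp add: star_minus)

lemma star_sum: "star (sum f S) = (\<Sum>i\<in>S. star (f i :: 'a::cstar_algebra))"
  by (induction S rule: infinite_finite_induct) (auto simp: star_add)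

lemma star_scaleR: "star (r *\<^sub>R x) = r *\<^sub>R star (x::'a::cstar_algebra)"
  by (metis complex_cnj_complex_of_real scaleC_of_real star_scaleC)

lemma star_power: "star (x ^ n) = star (x::'a::cstar_algebra) ^ n"
  by (induction n) (auto simp: star_mult power_commutes)

lemma star_of_real [simp]: "star (of_real r) = (of_real r :: 'a::cstar_algebra)"
  by (simp add: of_real_def star_scaleR)

lemma norm_star [simp]: "norm (star x) = norm (x::'a::cstar_algebra)"
proof -
  have le: "norm y \<le> norm (star y)" for y :: 'a
  proof (cases "y = 0")
    case False
    have "norm y * norm y \<le> norm (star y) * norm y"
      using cstar_identity[of y] norm_mult_ineq[of "star y" y] by (simp add: power2_eq_square)
    then show ?thesis using False by simp
  qed simp
  show ?thesis using le[of x] le[of "star x"] by (simp add: star_star)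
qed

lemma bounded_linear_star: "bounded_linear (star :: 'a::cstar_algebra \<Rightarrow> 'a)"
  by (rule bounded_linear_intro[of _ 1]) (auto simp: star_add star_scaleR)

lemma norm_square_selfadjoint:
  fixes k :: "'a::cstar_algebra" assumes "star k = k" shows "norm (k * k) = (norm k)\<^sup>2"
  using cstar_identity[of k] assms by simp

text \<open>
  The square root of \<open>1 - v\<close> is given by the binomial series, which still converges absolutely on
  the closed unit ball: its coefficients of positive index all have the same sign and their
  partial sums are bounded.
\<close>

definition sqrt_coeff :: "nat \<Rightarrow> real" where
  "sqrt_coeff n = (-1) ^ n * ((1/2) gchoose n)"

lemma sqrt_coeff_rec: "sqrt_coeff (Suc n) = sqrt_coeff n * (real n - 1/2) / real (Suc n)"
proof -
  have "((1/2::real) gchoose Suc n) * real (Suc n) = ((1/2) gchoose n) * (1/2 - real n)"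
    using gbinomial_mult_1[of "1/2::real" n] by (simp add: algebra_simps)
  then have "((1/2::real) gchoose Suc n) = ((1/2) gchoose n) * (1/2 - real n) / real (Suc n)"
    by (simp add: field_simps)
  then show ?thesis unfolding sqrt_coeff_def
    by (simp only: power_Suc) (simp add: algebra_simps diff_divide_distrib)
qed

lemma sqrt_coeff_nonpos: "sqrt_coeff (Suc n) \<le> 0"
proof (induction n)
  case 0 then show ?case by (simp add: sqrt_coeff_def)
next
  case (Suc n)
  then show ?case using sqrt_coeff_rec[of "Suc n"]
    by (simp add: mult_nonpos_nonneg divide_nonpos_nonneg)
qed

lemma sqrt_coeff_partial_sum_nonneg: "0 \<le> (\<Sum>k\<le>n. sqrt_coeff k)"
proof -
  have nn: "0 \<le> (-1) ^ n * ((-1/2::real) gchoose n)" for n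
  proof (induction n)
    case (Suc n)
    have "((-1/2::real) gchoose Suc n) * real (Suc n) = ((-1/2) gchoose n) * (-1/2 - real n)"
      using gbinomial_mult_1[of "-1/2::real" n] by (simp add: algebra_simps)
    then have "((-1/2::real) gchoose Suc n) = ((-1/2) gchoose n) * (-1/2 - real n) / real (Suc n)"
      by (simp add: divide_simps) (simp add: algebra_simps)
    then have "(-1) ^ Suc n * ((-1/2::real) gchoose Suc n) =
        ((-1) ^ n * ((-1/2) gchoose n)) * ((1/2 + real n) / real (Suc n))"
      by (simp only: power_Suc) (simp add: divide_simps, simp add: algebra_simps)
    then show ?case using Suc by simp
  qed simp
  have "(\<Sum>k\<le>n. sqrt_coeff k) = (\<Sum>k\<le>n. ((1/2::real) gchoose k) * (-1) ^ k)"
    unfolding sqrt_coeff_def by (simp add: mult.commute)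
  also have "\<dots> = (-1) ^ n * ((1/2 - 1) gchoose n)"
    by (rule gbinomial_sum_lower_neg)
  finally show ?thesis using nn[of n] by simp
qed

lemma summable_abs_sqrt_coeff: "summable (\<lambda>n. \<bar>sqrt_coeff n\<bar>)"
proof (rule summableI_nonneg_bounded)
  fix n :: nat
  show "(\<Sum>k<n. \<bar>sqrt_coeff k\<bar>) \<le> 2"
  proof (cases n)
    case (Suc m)
    have "(\<Sum>k<Suc m. \<bar>sqrt_coeff k\<bar>) = 1 + (\<Sum>k<m. \<bar>sqrt_coeff (Suc k)\<bar>)"
      by (subst sum.lessThan_Suc_shift) (simp add: sqrt_coeff_def)
    also have "\<dots> = 1 - (\<Sum>k<m. sqrt_coeff (Suc k))"
      using sqrt_coeff_nonpos by (simp add: sum_negf[symmetric] abs_of_nonpos del: sum_negf)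
    also have "\<dots> = 2 - (\<Sum>k<Suc m. sqrt_coeff k)"
      by (subst sum.lessThan_Suc_shift) (simp add: sqrt_coeff_def)
    finally show ?thesis
      using sqrt_coeff_partial_sum_nonneg[of m] Suc by (simp add: lessThan_Suc_atMost)
  qed simp
qed simp

lemma sqrt_coeff_convolution:
  "(\<Sum>i\<le>n. sqrt_coeff i * sqrt_coeff (n - i)) = (if n = 0 then 1 else if n = 1 then -1 else 0)"
proof -
  have "(\<Sum>i\<le>n. sqrt_coeff i * sqrt_coeff (n - i)) =
      (-1) ^ n * (\<Sum>i=0..n. ((1/2::real) gchoose i) * ((1/2) gchoose (n - i)))"
    unfolding sum_distrib_left sqrt_coeff_def
    by (intro sum.cong) (auto simp: atMost_atLeast0 power_add[symmetric] mult_ac)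
  also have "\<dots> = (-1) ^ n * ((1/2 + 1/2 :: real) gchoose n)"
    by (simp only: gbinomial_Vandermonde)
  also have "(1/2 + 1/2 :: real) = of_nat 1" by simp
  also have "(of_nat 1 gchoose n) = (real (1 choose n))"
    by (rule binomial_gbinomial[symmetric])
  finally show ?thesis by (cases "n = 0"; cases "n = 1") (auto simp: binomial_eq_0)
qed

lemma sqrt_one_minus:
  fixes v :: "'a::cstar_algebra"
  assumes sa: "star v = v" and nv: "norm v \<le> 1"
  shows "\<exists>w. star w = w \<and> w * w = 1 - v \<and> (\<forall>y. y * v = v * y \<longrightarrow> y * w = w * y)"
proof -
  let ?f = "\<lambda>n. sqrt_coeff n *\<^sub>R v ^ n"
  have "norm (?f n) \<le> \<bar>sqrt_coeff n\<bar>" for n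
  proof -
    have "norm (v ^ n) \<le> 1"
      using norm_power_ineq[of v n] power_le_one[OF norm_ge_zero nv, of n] by linarith
    then show ?thesis by (simp add: mult_left_le)
  qed
  then have sn: "summable (\<lambda>n. norm (?f n))"
    by (intro summable_comparison_test'[OF summable_abs_sqrt_coeff]) auto
  then have s: "summable ?f" by (rule summable_norm_cancel)
  define w where "w = suminf ?f"
  have "star w = (\<Sum>n. star (?f n))"
    unfolding w_def by (rule bounded_linear.suminf[OF bounded_linear_star s])
  then have 1: "star w = w" by (simp add: w_def star_scaleR star_power sa)
  have "(\<lambda>k. \<Sum>i\<le>k. ?f i * ?f (k - i)) sums (w * w)"
    unfolding w_def by (rule Cauchy_product_sums[OF sn sn])
  moreover have "(\<Sum>i\<le>k. ?f i * ?f (k - i)) = (if k = 0 then 1 else if k = 1 then -1 else 0) *\<^sub>R v ^ k" for k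
    unfolding sqrt_coeff_convolution[symmetric] scaleR_sum_left
    by (intro sum.cong) (auto simp: power_add[symmetric])
  moreover have "(\<lambda>k. (if k = 0 then 1 else if k = 1 then -1 else 0) *\<^sub>R v ^ k) sums
      (\<Sum>k\<in>{0,1}. (if k = 0 then 1 else if k = 1 then -1 else 0) *\<^sub>R v ^ k)"
    by (rule sums_finite) auto
  ultimately have 2: "w * w = 1 - v" by (simp add: sums_iff)
  have 3: "y * w = w * y" if "y * v = v * y" for y
  proof -
    have c: "y * v ^ n = v ^ n * y" for n
      by (induction n) (auto simp: that mult.assoc[symmetric], simp add: that mult.assoc)
    have "y * w = (\<Sum>n. y * ?f n)" unfolding w_def by (rule suminf_mult[OF s, symmetric])
    also have "\<dots> = (\<Sum>n. ?f n * y)" by (simp add: c)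
    also have "\<dots> = w * y" unfolding w_def by (rule suminf_mult2[OF s, symmetric])
    finally show ?thesis .
  qed
  show ?thesis using 1 2 3 by blast
qed

lemma commute_mult:
  fixes a b c :: "'a::semigroup_mult"
  assumes "a * b = b * a" "a * c = c * a" shows "a * (b * c) = b * c * a"
  by (metis assms mult.assoc)

text \<open>The element \<open>z + \<i> w\<close> is unitary, and \<open>z\<close> is its real part.\<close>

lemma norm_le_one_of_squares:
  fixes z w :: "'a::cstar_algebra"
  assumes "star z = z" "star w = w" "z * w = w * z" "z * z + w * w = 1"
  shows "norm z \<le> 1"
proof -
  define u where "u = z + \<i> *\<^sub>C w"
  have su: "star u = z - \<i> *\<^sub>C w"
    using scaleC_add_left[of "-\<i>" "\<i>" w] scaleC_of_real[of 0 w]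
    by (simp add: u_def star_add star_scaleC assms eq_neg_iff_add_eq_0)
  have neg: "(-1) *\<^sub>C (w * w) = - (w * w)" using scaleC_of_real[of "-1" "w * w"] by simp
  have dC: "c *\<^sub>C (x - y) = c *\<^sub>C x - c *\<^sub>C y" for c and x y :: 'a
    using scaleC_add_right[of c "x - y" y] by simp
  have "star u * u = z * z + \<i> *\<^sub>C (z * w) - (\<i> *\<^sub>C (w * z) + (-1) *\<^sub>C (w * w))"
    unfolding su unfolding u_def
    by (simp add: distrib_left left_diff_distrib mult_scaleC_left mult_scaleC_right scaleC_scaleC dC)
  also have "\<dots> = z * z + w * w" by (simp add: neg assms(3))
  finally have "star u * u = z * z + w * w" .
  then have "(norm u)\<^sup>2 = 1" using cstar_identity[of u] assms by simp
  then have "norm u = 1" by (simp add: power2_eq_1_iff) (use norm_ge_zero[of u] in linarith)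
  moreover have "2 *\<^sub>R z = u + star u" by (simp add: su) (simp add: u_def scaleR_2)
  then have "2 * norm z = norm (u + star u)" by (metis abs_numeral norm_scaleR)
  moreover have "norm (u + star u) \<le> norm u + norm (star u)" by (rule norm_triangle_ineq)
  ultimately show ?thesis by simp
qed

text \<open>
  For self-adjoint \<open>h\<close> this says that the spectrum is contained in some interval \<open>[0, 2t]\<close>. In
  this form it is evident that sums of positive elements are positive.
\<close>

definition pos :: "'a::cstar_algebra \<Rightarrow> bool" where
  "pos h \<longleftrightarrow> star h = h \<and> (\<exists>t\<ge>0. norm (of_real t - h) \<le> t)"

lemma pos_selfadjoint: "pos h \<Longrightarrow> star h = h"
  by (simp add: pos_def)

lemma pos_add: assumes "pos h" "pos k" shows "pos (h + k)"
proof -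
  obtain s t where st: "s \<ge> 0" "t \<ge> 0" "norm (of_real s - h) \<le> s" "norm (of_real t - k) \<le> t"
    using assms by (auto simp: pos_def)
  have "norm (of_real (s + t) - (h + k)) \<le> s + t"
    using norm_triangle_ineq[of "of_real s - h" "of_real t - k"] st by (simp add: algebra_simps)
  then show ?thesis using assms st by (auto simp: pos_def star_add intro!: exI[of _ "s + t"])
qed

lemma pos_scaleR: assumes "pos h" "c \<ge> 0" shows "pos (c *\<^sub>R h)"
proof -
  obtain t where t: "t \<ge> 0" "norm (of_real t - h) \<le> t" using assms by (auto simp: pos_def)
  have "of_real (c * t) - c *\<^sub>R h = c *\<^sub>R (of_real t - h)"
    by (simp add: of_real_def scaleR_diff_right)
  then have "norm (of_real (c * t) - c *\<^sub>R h) \<le> c * t"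
    using t assms by (simp add: mult_left_mono)
  then show ?thesis using assms t by (auto simp: pos_def star_scaleR intro!: exI[of _ "c * t"])
qed

lemma pos_of_real: "c \<ge> 0 \<Longrightarrow> pos (of_real c)"
  by (auto simp: pos_def intro!: exI[of _ c])

lemma pos_one_minus:
  assumes "star h = h" "norm h \<le> 1" shows "pos (1 - h)"
  using assms by (auto simp: pos_def star_diff intro!: exI[of _ 1])

text \<open>
  After scaling, \<open>t = 1\<close>. Then \<open>1 - k\<^sup>2\<close> is the square of a self-adjoint \<open>w\<close> that commutes with
  \<open>k\<close>, and \<open>w\<^sup>2 + k\<^sup>2 = 1\<close> bounds the norm of \<open>w\<close>.
\<close>

lemma norm_of_real_minus_square:
  fixes k :: "'a::cstar_algebra"
  assumes sa: "star k = k" and t: "(norm k)\<^sup>2 \<le> t"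
  shows "norm (of_real t - k * k) \<le> t"
proof (cases "t = 0")
  case True
  then have "k = 0" using t by auto
  then show ?thesis using True by simp
next
  case False
  then have tp: "t > 0" using t zero_le_power2[of "norm k"] by linarith
  define k' where "k' = (1 / sqrt t) *\<^sub>R k"
  have sa': "star k' = k'" by (simp add: k'_def star_scaleR sa)
  have kk: "k * k = t *\<^sub>R (k' * k')" using tp by (simp add: k'_def)
  have n: "norm (k' * k') \<le> 1"
    using t tp sa norm_square_selfadjoint[OF sa'] by (simp add: k'_def power_divide)
  have sa2: "star (k' * k') = k' * k'" by (simp add: star_mult sa')
  obtain w where w: "star w = w" "w * w = 1 - k' * k'" "\<And>y. y * (k' * k') = k' * k' * y \<Longrightarrow> y * w = w * y"
    using sqrt_one_minus[OF sa2 n] by blast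
  have "norm w \<le> 1"
  proof (rule norm_le_one_of_squares[OF w(1) sa'])
    show "w * k' = k' * w" using w(3)[of k'] by (simp add: mult.assoc)
    show "w * w + k' * k' = 1" by (simp add: w(2))
  qed
  then have "norm (1 - k' * k') \<le> 1"
    using norm_square_selfadjoint[OF w(1)] w(2) by (simp add: power_le_one)
  moreover have "of_real t - k * k = t *\<^sub>R (1 - k' * k')"
    by (simp add: kk scaleR_diff_right of_real_def)
  ultimately show ?thesis using tp by simp
qed

lemma pos_square: "star k = k \<Longrightarrow> pos (k * k)"
  using norm_of_real_minus_square[of k "(norm k)\<^sup>2"] unfolding pos_def star_mult
  by (intro conjI exI[of _ "(norm k)\<^sup>2"]) simp_all

lemma pos_sqrt:
  assumes "pos h"
  shows "\<exists>k. star k = k \<and> k * k = h \<and> (\<forall>y. y * h = h * y \<longrightarrow> y * k = k * y)"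
proof -
  obtain t where t: "t \<ge> 0" "norm (of_real t - h) \<le> t" and sa: "star h = h"
    using assms by (auto simp: pos_def)
  show ?thesis
  proof (cases "t = 0")
    case True
    then show ?thesis using t by (intro exI[of _ 0]) auto
  next
    case False
    then have tp: "t > 0" using t by simp
    define v where "v = 1 - (1/t) *\<^sub>R h"
    have "v = (1/t) *\<^sub>R (of_real t - h)" using tp by (simp add: v_def of_real_def scaleR_diff_right)
    then have nv: "norm v \<le> 1" using t tp by simp
    have sv: "star v = v" by (simp add: v_def star_diff star_scaleR sa)
    obtain w where w: "star w = w" "w * w = 1 - v" "\<And>y. y * v = v * y \<Longrightarrow> y * w = w * y"
      using sqrt_one_minus[OF sv nv] by blast
    show ?thesis
    proof (intro exI[of _ "sqrt t *\<^sub>R w"] conjI allI impI)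
      show "star (sqrt t *\<^sub>R w) = sqrt t *\<^sub>R w" by (simp add: star_scaleR w)
      show "(sqrt t *\<^sub>R w) * (sqrt t *\<^sub>R w) = h" using tp w(2) by (simp add: v_def)
      fix y assume "y * h = h * y"
      then have "y * v = v * y" by (simp add: v_def algebra_simps)
      then show "y * (sqrt t *\<^sub>R w) = sqrt t *\<^sub>R w * y" using w(3) by simp
    qed
  qed
qed

lemma pos_sandwich:
  assumes "pos h" "star g = g" "g * h = h * g" shows "pos (g * h * g)"
proof -
  obtain k where k: "star k = k" "k * k = h" "\<And>y. y * h = h * y \<Longrightarrow> y * k = k * y"
    using pos_sqrt[OF assms(1)] by blast
  have gk: "g * k = k * g" by (rule k(3)[OF assms(3)])
  have "(g * k) * (g * k) = (g * k) * (k * g)" by (simp only: gk)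
  also have "\<dots> = g * h * g" by (simp add: mult.assoc k(2)[symmetric])
  finally have "g * h * g = (g * k) * (g * k)" ..
  then show ?thesis using pos_square[of "g * k"] k(1) gk assms(2) by (simp add: star_mult)
qed

text \<open>
  Commuting square roots \<open>z\<close> of \<open>1 - h\<close> and \<open>w\<close> of \<open>1 + h\<close> satisfy \<open>h\<^sup>2 + (z w)\<^sup>2 = 1\<close>.
\<close>

lemma norm_le_one_of_pos:
  assumes "pos (1 - h)" "pos (1 + h)" shows "norm (h::'a::cstar_algebra) \<le> 1"
proof -
  obtain z where z: "star z = z" "z * z = 1 - h" "\<And>y. y * (1 - h) = (1 - h) * y \<Longrightarrow> y * z = z * y"
    using pos_sqrt[OF assms(1)] by blast
  obtain w where w: "star w = w" "w * w = 1 + h" "\<And>y. y * (1 + h) = (1 + h) * y \<Longrightarrow> y * w = w * y"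
    using pos_sqrt[OF assms(2)] by blast
  have "h * z = z * h" using z(3)[of h] by (simp add: algebra_simps)
  then have zw: "z * w = w * z" using w(3)[of z] by (simp add: algebra_simps)
  define t where "t = z * w"
  have sh: "star h = h" using pos_selfadjoint[OF assms(1)] by (simp add: star_diff)
  have st: "star t = t" by (simp add: t_def star_mult z w zw)
  have zww: "z * (w * w) = w * w * z" by (rule commute_mult[OF zw zw])
  have "t * t = (z * w) * (w * z)" unfolding t_def by (simp only: zw)
  also have "\<dots> = z * (z * (w * w))" by (simp only: zww) (simp only: mult.assoc)
  also have "\<dots> = (z * z) * (w * w)" by (simp only: mult.assoc)
  also have "\<dots> = 1 - h * h" unfolding z w by (simp add: algebra_simps)
  finally have "h * h + t * t = 1" by simp
  moreover have "h * t = t * h"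
    unfolding t_def
    by (rule commute_mult[OF \<open>h * z = z * h\<close>]) (use w(3)[of h] in \<open>simp add: algebra_simps\<close>)
  ultimately show ?thesis using norm_le_one_of_squares[OF sh st] by simp
qed

text \<open>If \<open>x = a + \<i> b\<close> with self-adjoint \<open>a\<close> and \<open>b\<close>, then the sum is \<open>2 (a\<^sup>2 + b\<^sup>2)\<close>.\<close>

lemma star_mult_self_add_pos: "pos (star x * x + x * star (x::'a::cstar_algebra))"
proof -
  define u v where "u = x + star x" and "v = \<i> *\<^sub>C (x - star x)"
  have su: "star u = u" by (simp add: u_def star_add star_star add.commute)
  have m1: "(-1) *\<^sub>C y = - y" for y :: 'a using scaleC_of_real[of "-1" y] by simp
  have mi: "(- \<i>) *\<^sub>C y = - (\<i> *\<^sub>C y)" for y :: 'a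
    using scaleC_scaleC[of "-1" "\<i>" y] m1 by simp
  have "star v = (- \<i>) *\<^sub>C (star x - x)" by (simp add: v_def star_scaleC star_diff star_star)
  also have "\<dots> = \<i> *\<^sub>C ((-1) *\<^sub>C (star x - x))" by (simp add: scaleC_scaleC)
  also have "\<dots> = v" unfolding m1 v_def by simp
  finally have sv: "star v = v" .
  have vv: "v * v = - ((x - star x) * (x - star x))"
    unfolding v_def mult_scaleC_left mult_scaleC_right scaleC_scaleC by (simp add: m1)
  have "u * u + v * v = 2 *\<^sub>R (star x * x + x * star x)"
    unfolding vv u_def by (simp add: algebra_simps scaleR_2)
  then have "star x * x + x * star x = (1/2) *\<^sub>R (u * u + v * v)" by simp
  then show ?thesis
    using pos_scaleR[OF pos_add[OF pos_square[OF su] pos_square[OF sv]], of "1/2"] by simp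
qed

text \<open>
  Negative spectrum is driven out by iteration. Passing from \<open>x\<close> to \<open>y = x (4 x\<^sup>* x - 3)\<close> replaces
  a point \<open>t\<close> of the spectrum of \<open>x\<^sup>* x\<close> by \<open>t (4 t - 3)\<^sup>2\<close>, which is at most \<open>9 t\<close> if \<open>t < 0\<close>.
  The bound \<open>\<parallel>y\<parallel> \<le> 1\<close> persists: the elements \<open>y\<^sup>* y\<close> and \<open>y y\<^sup>*\<close> are at most \<open>1\<close> because \<open>x\<^sup>* x\<close>
  and \<open>x x\<^sup>*\<close> are, and then \<open>y\<^sup>* y \<ge> - y y\<^sup>* \<ge> - 1\<close> because \<open>y\<^sup>* y + y y\<^sup>*\<close> is positive.
\<close>

lemma star_mult_self_pos_upto:
  fixes x :: "'a::cstar_algebra"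
  assumes "norm x \<le> 1"
  shows "pos (star x * x + of_real ((1/9) ^ n))"
  using assms
proof (induction n arbitrary: x)
  case 0
  define h h' where "h = star x * x" and "h' = x * star x"
  have "norm h' \<le> 1" using cstar_identity[of "star x"] 0 by (simp add: h'_def star_star power_le_one)
  then have "pos (1 - h')" by (intro pos_one_minus) (simp_all add: h'_def star_mult star_star)
  then show ?case
    using pos_add[OF star_mult_self_add_pos[of x], of "1 - h'"] by (simp add: h'_def)
next
  case (Suc n)
  define h h' where "h = star x * x" and "h' = x * star x"
  define g g' where "g = 4 *\<^sub>R h - 3 *\<^sub>R 1" and "g' = 4 *\<^sub>R h' - 3 *\<^sub>R 1"
  define y where "y = x * g"
  have sa: "star h = h" "star h' = h'" by (simp_all add: h_def h'_def star_mult star_star)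
  then have sg: "star g = g" "star g' = g'" by (simp_all add: g_def g'_def star_diff star_scaleR)
  have nh: "norm h \<le> 1" "norm h' \<le> 1"
    using cstar_identity[of x] cstar_identity[of "star x"] Suc.prems
    by (simp_all add: h_def h'_def star_star power_le_one)
  have ph: "pos (1 - h)" "pos (1 - h')" by (intro pos_one_minus sa nh)+
  have sy: "star y = g * star x" by (simp add: y_def star_mult sg)
  have yy: "star y * y = g * h * g" unfolding sy unfolding y_def h_def by (simp only: mult.assoc)
  have xh: "x * h = h' * x" by (simp add: h_def h'_def mult.assoc)
  then have yx: "y = g' * x" unfolding y_def g_def g'_def by (simp add: algebra_simps)
  then have "y * star y = g' * (x * star x) * g'" by (simp add: star_mult sg mult.assoc)
  then have yy': "y * star y = g' * h' * g'" by (simp add: h'_def)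
  \<comment> \<open>With \<open>t = cos\<^sup>2 \<theta>\<close> the polynomial \<open>t (4t - 3)\<^sup>2\<close> is \<open>cos\<^sup>2 3\<theta>\<close>, so it maps \<open>[0, 1]\<close> to itself.\<close>
  have cheb: "pos (1 - (4 *\<^sub>R k - 3 *\<^sub>R 1) * k * (4 *\<^sub>R k - 3 *\<^sub>R 1))"
    if "star k = k" "pos (1 - k)" for k :: 'a
  proof -
    have "pos ((1 - 4 *\<^sub>R k) * (1 - k) * (1 - 4 *\<^sub>R k))"
      by (rule pos_sandwich[OF that(2)]) (simp_all add: star_diff star_scaleR that algebra_simps)
    moreover have "(1 - 4 *\<^sub>R k) * (1 - k) * (1 - 4 *\<^sub>R k) =
        1 - (4 *\<^sub>R k - 3 *\<^sub>R 1) * k * (4 *\<^sub>R k - 3 *\<^sub>R 1)"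
      by (simp add: left_diff_distrib right_diff_distrib mult.assoc scaleR_diff_right) norm
    ultimately show ?thesis by simp
  qed
  have p1: "pos (1 - star y * y)" and p2: "pos (1 - y * star y)"
    using cheb[OF sa(1) ph(1)] cheb[OF sa(2) ph(2)] unfolding yy yy' g_def g'_def by simp_all
  have "pos (1 + star y * y)"
    using pos_add[OF star_mult_self_add_pos[of y] p2] by (simp add: algebra_simps)
  then have "norm (star y * y) \<le> 1" by (intro norm_le_one_of_pos p1)
  then have "norm y \<le> 1" using cstar_identity[of y] by (simp add: abs_square_le_1)
  then have IH: "pos (star y * y + of_real ((1/9) ^ n))" by (rule Suc.IH)
  \<comment> \<open>\<open>9 t = t (4 t - 3)\<^sup>2 + t\<^sup>2 (24 - 16 t)\<close>, and the second summand is nonnegative for \<open>t \<le> 1\<close>.\<close>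
  have sq: "pos (h * (16 *\<^sub>R (1 - h) + of_real 8) * h)"
  proof (rule pos_sandwich[OF _ sa(1)])
    show "pos (16 *\<^sub>R (1 - h) + of_real 8)" by (intro pos_add pos_scaleR ph pos_of_real) simp_all
    show "h * (16 *\<^sub>R (1 - h) + of_real 8) = (16 *\<^sub>R (1 - h) + of_real 8) * h"
      unfolding of_real_def by (simp add: algebra_simps)
  qed
  have
    "pos ((1/9) *\<^sub>R (star y * y + of_real ((1/9) ^ n) + h * (16 *\<^sub>R (1 - h) + of_real 8) * h))"
    by (rule pos_scaleR[OF pos_add[OF IH sq]]) simp
  moreover have "(1/9) *\<^sub>R (star y * y + of_real ((1/9) ^ n) + h * (16 *\<^sub>R (1 - h) + of_real 8) * h)
      = h + of_real ((1/9) ^ Suc n)"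
  proof -
    define E :: 'a where "E = of_real ((1/9) ^ n)"
    have "of_real ((1/9) ^ Suc n) = (1/9) *\<^sub>R E" by (simp add: E_def of_real_def)
    then show ?thesis
      unfolding yy g_def E_def[symmetric] of_real_def[of 8]
      by (simp add: left_diff_distrib right_diff_distrib distrib_left distrib_right mult.assoc
          scaleR_diff_right) norm
  qed
  ultimately show ?case by (simp add: h_def)
qed

text \<open>
  Up to scaling, \<open>x\<^sup>* x + 9\<^sup>-\<^sup>n\<close> is positive of norm at most \<open>2\<close>, that is, its distance from \<open>2\<close>
  is at most \<open>2\<close>; this condition is closed.
\<close>

lemma star_mult_self_pos: "pos (star x * (x::'a::cstar_algebra))"
proof -
  have unit: "pos (star x * x)" if nx: "norm x \<le> 1" for x :: 'a
  proof -
    define h where "h = star x * x"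
    have sa: "star h = h" by (simp add: h_def star_mult star_star)
    have nh: "norm h \<le> 1" using cstar_identity[of x] nx by (simp add: h_def power_le_one)
    have "norm (of_real 2 - (h + of_real ((1/9) ^ n))) \<le> 2" for n
    proof -
      obtain k where k: "star k = k" "k * k = h + of_real ((1/9) ^ n)"
        using pos_sqrt[OF star_mult_self_pos_upto[OF nx, of n]] by (auto simp: h_def)
      have "(norm k)\<^sup>2 = norm (h + of_real ((1/9) ^ n))"
        using norm_square_selfadjoint[OF k(1)] k(2) by simp
      also have "\<dots> \<le> norm h + norm (of_real ((1/9) ^ n) :: 'a)" by (rule norm_triangle_ineq)
      also have "norm (of_real ((1/9) ^ n) :: 'a) \<le> 1" unfolding norm_of_real by (simp add: power_le_one)
      finally show ?thesis using norm_of_real_minus_square[OF k(1), of 2] k(2) nh by simp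
    qed
    moreover have "(\<lambda>n. of_real 2 - (h + of_real ((1/9::real) ^ n))) \<longlonglongrightarrow> of_real 2 - (h + of_real 0)"
      by (intro tendsto_intros LIMSEQ_power_zero) auto
    ultimately have "norm (of_real 2 - (h + of_real 0)) \<le> 2"
      by (intro LIMSEQ_le_const2[OF tendsto_norm]) auto
    then show ?thesis using sa unfolding pos_def h_def by (intro conjI exI[of _ 2]) auto
  qed
  define c where "c = norm x + 1"
  have c: "c > 0" by (simp add: c_def add_nonneg_pos)
  have "norm ((1/c) *\<^sub>R x) \<le> 1" using c by (simp add: c_def)
  from pos_scaleR[OF unit[OF this], of "c * c"] show ?thesis using c by (simp add: star_scaleR)
qed

text \<open>
  All elements \<open>1 \<plusminus> c h\<close> with \<open>c \<ge> 0\<close> are positive, so that \<open>\<parallel>c h\<parallel> \<le> 1\<close> for all of these \<open>c\<close>.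
\<close>

lemma pos_antisym:
  assumes "pos h" "pos (- h)" shows "(h::'a::cstar_algebra) = 0"
proof (rule ccontr)
  assume "h \<noteq> 0"
  then have n0: "norm h > 0" by simp
  define c where "c = 2 / norm h"
  have c: "c > 0" using n0 by (simp add: c_def)
  have "pos (1 + c *\<^sub>R h)" "pos (1 - c *\<^sub>R h)"
    using pos_add[OF pos_of_real[of 1] pos_scaleR[OF assms(1), of c]]
      pos_add[OF pos_of_real[of 1] pos_scaleR[OF assms(2), of c]] c by simp_all
  then have "norm (c *\<^sub>R h) \<le> 1" by (intro norm_le_one_of_pos)
  then show False using n0 by (simp add: c_def)
qed

lemma pos_sum: "(\<And>i. i \<in> S \<Longrightarrow> pos (f i)) \<Longrightarrow> pos (sum f S)"
  using pos_of_real[of 0] by (induction S rule: infinite_finite_induct) (auto intro: pos_add)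

text \<open>The cone of positive elements is pointed and contains every \<open>x\<^sup>* x\<close>.\<close>

lemma sum_star_mult_self_eq_0:
  fixes f :: "'i \<Rightarrow> 'a::cstar_algebra"
  assumes "finite S" "(\<Sum>i\<in>S. star (f i) * f i) = 0" "i \<in> S"
  shows "f i = 0"
proof -
  have "star (f i) * f i + (\<Sum>j\<in>S - {i}. star (f j) * f j) = 0"
    using sum.remove[OF assms(1,3), of "\<lambda>i. star (f i) * f i"] assms(2) by simp
  then have "(\<Sum>j\<in>S - {i}. star (f j) * f j) = - (star (f i) * f i)"
    by (simp add: eq_neg_iff_add_eq_0 add.commute)
  moreover have "pos (\<Sum>j\<in>S - {i}. star (f j) * f j)" by (intro pos_sum star_mult_self_pos)
  ultimately have "star (f i) * f i = 0" using pos_antisym[OF star_mult_self_pos[of "f i"]] by simp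
  then show ?thesis using cstar_identity[of "f i"] by simp
qed


section \<open>Complex matrices\<close>

lemma mat_adjoint_dim [simp]:
  "dim_row (mat_adjoint A) = dim_col A" "dim_col (mat_adjoint A) = dim_row A"
  by (auto simp: mat_adjoint_def)

lemma mat_adjoint_index [simp]:
  fixes A :: "complex mat"
  shows "i < dim_col A \<Longrightarrow> j < dim_row A \<Longrightarrow> mat_adjoint A $$ (i, j) = cnj (A $$ (j, i))"
  unfolding mat_adjoint_def by (subst mat_of_rows_index) simp_all

lemma mat_adjoint_carrier [simp]: "mat_adjoint A \<in> carrier_mat n m \<longleftrightarrow> A \<in> carrier_mat m n"
  unfolding carrier_mat_def by (simp add: conj_commute)

lemma mat_adjoint_adjoint [simp]: "mat_adjoint (mat_adjoint A) = (A :: complex mat)"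
  by (rule eq_matI) auto

lemma mat_adjoint_one [simp]: "mat_adjoint (1\<^sub>m n) = (1\<^sub>m n :: complex mat)"
  by (rule eq_matI) auto

lemma mult_mat_index:
  "i < dim_row A \<Longrightarrow> j < dim_col B \<Longrightarrow> dim_col A = dim_row B \<Longrightarrow>
    (A * B) $$ (i, j) = (\<Sum>k<dim_row B. A $$ (i, k) * B $$ (k, j))"
  by (auto simp: scalar_prod_def atLeast0LessThan intro!: sum.cong)

lemma mat_adjoint_mult:
  fixes A B :: "complex mat"
  assumes "dim_col A = dim_row B"
  shows "mat_adjoint (A * B) = mat_adjoint B * mat_adjoint A"
proof (rule eq_matI)
  fix i j assume "i < dim_row (mat_adjoint B * mat_adjoint A)" "j < dim_col (mat_adjoint B * mat_adjoint A)"
  then have ij: "i < dim_col B" "j < dim_row A" by auto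
  have "mat_adjoint (A * B) $$ (i, j) = (\<Sum>k<dim_row B. cnj (A $$ (j, k)) * cnj (B $$ (k, i)))"
    using ij assms by (simp add: mult_mat_index[of j A i B] del: index_mult_mat(1))
  also have "\<dots> = (\<Sum>k<dim_row B. mat_adjoint B $$ (i, k) * mat_adjoint A $$ (k, j))"
    using ij assms by (intro sum.cong) simp_all
  also have "\<dots> = (mat_adjoint B * mat_adjoint A) $$ (i, j)"
    using ij assms by (subst mult_mat_index) simp_all
  finally show "mat_adjoint (A * B) $$ (i, j) = (mat_adjoint B * mat_adjoint A) $$ (i, j)" .
qed (use assms in auto)

lemma mat_adjoint_minus:
  fixes A B :: "complex mat"
  assumes "A \<in> carrier_mat n m" "B \<in> carrier_mat n m"
  shows "mat_adjoint (A - B) = mat_adjoint A - mat_adjoint B"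
  by (rule eq_matI) (use assms in auto)

lemma trace_mat_sum: "trace_mat A = (\<Sum>i<dim_row A. A $$ (i, i))"
  unfolding trace_mat_def diag_mat_def by (simp add: sum_list_sum_nth atLeast0LessThan)

lemma trace_mat_mult:
  assumes "A \<in> carrier_mat n m" "B \<in> carrier_mat m n"
  shows "trace_mat (A * B) = (\<Sum>i<n. \<Sum>k<m. A $$ (i, k) * B $$ (k, i))"
proof -
  have "(A * B) $$ (i, i) = (\<Sum>k<m. A $$ (i, k) * B $$ (k, i))" if "i < n" for i
    using assms that by (subst mult_mat_index) auto
  then show ?thesis using assms by (simp add: trace_mat_sum del: index_mult_mat(1))
qed

lemma trace_mat_commute:
  assumes "A \<in> carrier_mat n m" "B \<in> carrier_mat m n"
  shows "trace_mat (A * B) = trace_mat (B * A)"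
  unfolding trace_mat_mult[OF assms] trace_mat_mult[OF assms(2,1)]
  by (subst sum.swap) (simp add: mult.commute)

lemma trace_mat_add:
  assumes "A \<in> carrier_mat n n" "B \<in> carrier_mat n n"
  shows "trace_mat (A + B) = trace_mat A + trace_mat B"
  using assms by (simp add: trace_mat_sum sum.distrib)

lemma trace_mat_minus:
  assumes "A \<in> carrier_mat n n" "B \<in> carrier_mat n n"
  shows "trace_mat (A - B) = trace_mat A - trace_mat B"
  using assms by (simp add: trace_mat_sum sum_subtractf)

lemma mult_adjoint_diag:
  fixes A :: "complex mat"
  assumes "i < dim_row A"
  shows "(A * mat_adjoint A) $$ (i, i) = of_real (\<Sum>k<dim_col A. (cmod (A $$ (i, k)))\<^sup>2)"
proof -
  have "(A * mat_adjoint A) $$ (i, i) = (\<Sum>k<dim_col A. A $$ (i, k) * cnj (A $$ (i, k)))"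
    using assms by (subst mult_mat_index) simp_all
  then show ?thesis by (simp only: complex_norm_square[symmetric] of_real_sum)
qed

lemma trace_mult_adjoint_eq_0:
  fixes A :: "complex mat"
  assumes "trace_mat (A * mat_adjoint A) = 0"
  shows "A = 0\<^sub>m (dim_row A) (dim_col A)"
proof (rule eq_matI)
  fix i j assume ij: "i < dim_row (0\<^sub>m (dim_row A) (dim_col A))" "j < dim_col (0\<^sub>m (dim_row A) (dim_col A))"
  have "trace_mat (A * mat_adjoint A) = of_real (\<Sum>i<dim_row A. \<Sum>k<dim_col A. (cmod (A $$ (i, k)))\<^sup>2)"
    unfolding trace_mat_sum by (simp add: mult_adjoint_diag del: index_mult_mat(1))
  then have "complex_of_real (\<Sum>i<dim_row A. \<Sum>k<dim_col A. (cmod (A $$ (i, k)))\<^sup>2) = 0"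
    unfolding assms by (rule sym)
  then have "(\<Sum>i<dim_row A. \<Sum>k<dim_col A. (cmod (A $$ (i, k)))\<^sup>2) = 0"
    by (simp only: of_real_eq_0_iff)
  then have "(\<Sum>k<dim_col A. (cmod (A $$ (i, k)))\<^sup>2) = 0"
    using ij sum_nonneg_eq_0_iff[of "{..<dim_row A}" "\<lambda>i. \<Sum>k<dim_col A. (cmod (A $$ (i, k)))\<^sup>2"]
    by (simp add: sum_nonneg)
  then show "A $$ (i, j) = 0\<^sub>m (dim_row A) (dim_col A) $$ (i, j)"
    using ij sum_nonneg_eq_0_iff[of "{..<dim_col A}" "\<lambda>k. (cmod (A $$ (i, k)))\<^sup>2"] by simp
qed auto

definition unitary_mat :: "nat \<Rightarrow> complex mat \<Rightarrow> bool" where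
  "unitary_mat n Q \<longleftrightarrow> Q \<in> carrier_mat n n \<and> mat_adjoint Q * Q = 1\<^sub>m n \<and> Q * mat_adjoint Q = 1\<^sub>m n"

definition real_diag :: "nat \<Rightarrow> (nat \<Rightarrow> real) \<Rightarrow> complex mat" where
  "real_diag n d = mat n n (\<lambda>(i, j). if i = j then complex_of_real (d i) else 0)"

lemma real_diag_dim [simp]: "dim_row (real_diag n d) = n" "dim_col (real_diag n d) = n"
  "real_diag n d \<in> carrier_mat n n"
  by (auto simp: real_diag_def)

lemma real_diag_index [simp]:
  "i < n \<Longrightarrow> j < n \<Longrightarrow> real_diag n d $$ (i, j) = (if i = j then complex_of_real (d i) else 0)"
  by (simp add: real_diag_def)

lemma mult_real_diag_index:
  assumes "A \<in> carrier_mat m n" "i < m" "j < n"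
  shows "(A * real_diag n d) $$ (i, j) = A $$ (i, j) * of_real (d j)"
proof -
  have "(A * real_diag n d) $$ (i, j) = (\<Sum>k<n. A $$ (i, k) * real_diag n d $$ (k, j))"
    using assms by (subst mult_mat_index) auto
  also have "\<dots> = (\<Sum>k<n. if k = j then A $$ (i, j) * of_real (d j) else 0)"
    using assms by (intro sum.cong) auto
  finally show ?thesis using assms by simp
qed

lemma real_diag_mult_index:
  assumes "A \<in> carrier_mat n m" "i < n" "j < m"
  shows "(real_diag n d * A) $$ (i, j) = of_real (d i) * A $$ (i, j)"
proof -
  have "(real_diag n d * A) $$ (i, j) = (\<Sum>k<n. real_diag n d $$ (i, k) * A $$ (k, j))"
    using assms by (subst mult_mat_index) auto
  also have "\<dots> = (\<Sum>k<n. if k = i then of_real (d i) * A $$ (i, j) else 0)"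
    using assms by (intro sum.cong) auto
  finally show ?thesis using assms by simp
qed

lemma eigenvector_exists:
  fixes H :: "complex mat"
  assumes "H \<in> carrier_mat n n" "n > 0"
  obtains v e where "v \<in> carrier_vec n" "v \<noteq> 0\<^sub>v n" "H *\<^sub>v v = e \<cdot>\<^sub>v v"
proof -
  have "degree (char_poly H) \<noteq> 0" using degree_monic_char_poly[OF assms(1)] assms(2) by simp
  then obtain e where "poly (char_poly H) e = 0"
    using fundamental_theorem_of_algebra[of "char_poly H"] by (auto simp: constant_degree)
  then have "eigenvalue H e" using eigenvalue_root_char_poly[OF assms(1)] by simp
  then show ?thesis using that assms(1) unfolding eigenvalue_def eigenvector_def by auto
qed

lemma unitary_with_first_column:
  fixes v :: "complex vec"
  assumes v: "v \<in> carrier_vec n" and v0: "v \<noteq> 0\<^sub>v n" and n: "n > 0"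
  obtains Q c where "unitary_mat n Q" "col Q 0 = c \<cdot>\<^sub>v v"
proof -
  interpret cof_vec_space n "TYPE(complex)" .
  define b where "b = basis_completion v"
  define ws where "ws = gram_schmidt n b"
  define W where "W = mat_of_cols n ws"
  from basis_completion[OF v v0, folded b_def]
  have dist_b: "distinct b" and indep: "\<not> lin_dep (set b)" and b: "set b \<subseteq> carrier_vec n"
    and hdb: "hd b = v" and len_b: "length b = n" by auto
  from hdb len_b n obtain vs where bv: "b = v # vs" by (cases b) auto
  from gram_schmidt_result[OF b dist_b indep refl, folded ws_def]
  have ws: "set ws \<subseteq> carrier_vec n" "corthogonal ws" "length ws = n" by (auto simp: len_b)
  from gram_schmidt_hd[OF v, of vs, folded bv] have hdws: "hd ws = v" unfolding ws_def .
  have W: "W \<in> carrier_mat n n" using ws mat_of_cols_carrier(1)[of n ws] unfolding W_def by auto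
  have orth: "corthogonal_mat W" using orthogonal_mat_of_cols ws unfolding W_def .
  define G where "G = mat_adjoint W * W"
  have Gc: "G \<in> carrier_mat n n" using W by (auto simp: G_def)
  have Goff: "G $$ (i, j) = 0" if "i < n" "j < n" "i \<noteq> j" for i j
    using orth that Gc unfolding corthogonal_mat_def Let_def G_def[symmetric] diagonal_mat_def by auto
  have Gdiag: "G $$ (i, i) \<noteq> 0" if "i < n" for i
    using orth that W unfolding corthogonal_mat_def Let_def G_def[symmetric] by auto
  define q where "q i = (\<Sum>k<n. (cmod (W $$ (k, i)))\<^sup>2)" for i
  have Gq: "G $$ (i, i) = of_real (q i)" if "i < n" for i
    using mult_adjoint_diag[of i "mat_adjoint W"] that W by (simp add: G_def q_def del: index_mult_mat(1))
  have q: "q i > 0" if "i < n" for i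
  proof -
    have "q i \<noteq> 0" using Gdiag[OF that] Gq[OF that] by auto
    moreover have "q i \<ge> 0" by (simp add: q_def sum_nonneg)
    ultimately show ?thesis by simp
  qed
  define Q where "Q = W * real_diag n (\<lambda>i. 1 / sqrt (q i))"
  have Q: "Q \<in> carrier_mat n n" using W by (auto simp: Q_def)
  have Qij: "Q $$ (i, j) = W $$ (i, j) / of_real (sqrt (q j))" if "i < n" "j < n" for i j
    using that W by (simp add: Q_def mult_real_diag_index[of _ n] del: index_mult_mat(1))
  have "mat_adjoint Q * Q = 1\<^sub>m n"
  proof (rule eq_matI)
    fix i j assume "i < dim_row (1\<^sub>m n :: complex mat)" "j < dim_col (1\<^sub>m n :: complex mat)"
    then have ij: "i < n" "j < n" by auto
    have "(mat_adjoint Q * Q) $$ (i, j) = (\<Sum>k<n. cnj (W $$ (k, i)) * W $$ (k, j)) / of_real (sqrt (q i) * sqrt (q j))"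
      using ij Q by (simp add: mult_mat_index Qij sum_divide_distrib del: index_mult_mat(1))
    also have "(\<Sum>k<n. cnj (W $$ (k, i)) * W $$ (k, j)) = G $$ (i, j)"
      using ij W by (simp add: G_def mult_mat_index del: index_mult_mat(1))
    also have "G $$ (i, j) / of_real (sqrt (q i) * sqrt (q j)) = (1\<^sub>m n) $$ (i, j)"
      using ij Goff Gq q[of i] by (cases "i = j") (auto simp flip: of_real_mult)
    finally show "(mat_adjoint Q * Q) $$ (i, j) = (1\<^sub>m n) $$ (i, j)" .
  qed (use Q in auto)
  moreover from this have "Q * mat_adjoint Q = 1\<^sub>m n"
    using mat_mult_left_right_inverse[of "mat_adjoint Q" n Q] Q by simp
  moreover have "col W 0 = v"
    unfolding W_def using hdws ws n by (cases ws) (auto simp: col_mat_of_cols)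
  then have "col Q 0 = (1 / of_real (sqrt (q 0))) \<cdot>\<^sub>v v"
    using Q W n by (intro eq_vecI) (auto simp: Qij v)
  ultimately show ?thesis using that[of Q] Q unfolding unitary_mat_def by blast
qed

text \<open>
  In an orthonormal basis that starts with an eigenvector, the first column of the matrix has only
  its diagonal entry, and then so does the first row, because the matrix is hermitian.
\<close>

lemma hermitian_diagonalization:
  fixes H :: "complex mat"
  assumes "H \<in> carrier_mat n n" "mat_adjoint H = H"
  shows "\<exists>Q d. unitary_mat n Q \<and> H = Q * real_diag n d * mat_adjoint Q"
  using assms
proof (induction n arbitrary: H)
  case 0
  then show ?case
    by (intro exI[of _ "1\<^sub>m 0"] exI[of _ "\<lambda>_. 0"]) (simp add: unitary_mat_def, auto intro!: eq_matI)
next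
  case (Suc n)
  let ?n = "Suc n"
  obtain v e where v: "v \<in> carrier_vec ?n" "v \<noteq> 0\<^sub>v ?n" "H *\<^sub>v v = e \<cdot>\<^sub>v v"
    using eigenvector_exists[OF Suc.prems(1)] by blast
  obtain Q c where Q: "unitary_mat ?n Q" and Q0: "col Q 0 = c \<cdot>\<^sub>v v"
    using unitary_with_first_column[OF v(1,2)] by blast
  have Qc: "Q \<in> carrier_mat ?n ?n" and QQ: "mat_adjoint Q * Q = 1\<^sub>m ?n" "Q * mat_adjoint Q = 1\<^sub>m ?n"
    using Q by (auto simp: unitary_mat_def)
  have aQc: "mat_adjoint Q \<in> carrier_mat ?n ?n" using Qc by simp
  define K where "K = mat_adjoint Q * (H * Q)"
  have K: "K \<in> carrier_mat ?n ?n" using Qc Suc.prems by (auto simp: K_def)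
  have Kh: "mat_adjoint K = K"
    using Qc Suc.prems by (simp add: K_def mat_adjoint_mult assoc_mult_mat[of _ ?n ?n _ ?n _ ?n])
  have "col (H * Q) 0 = H *\<^sub>v (c \<cdot>\<^sub>v v)" using col_mult2[OF Suc.prems(1) Qc] by (simp add: Q0[symmetric])
  also have "\<dots> = e \<cdot>\<^sub>v (c \<cdot>\<^sub>v v)"
    using Suc.prems v by (simp add: mult_mat_vec smult_smult_assoc mult.commute)
  finally have HQ0: "col (H * Q) 0 = e \<cdot>\<^sub>v col Q 0" by (simp add: Q0)
  have Kcol: "K $$ (i, 0) = (if i = 0 then e else 0)" if "i < ?n" for i
  proof -
    have "K $$ (i, 0) = row (mat_adjoint Q) i \<bullet> (e \<cdot>\<^sub>v col Q 0)"
      using that Qc Suc.prems by (simp add: K_def HQ0[symmetric])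
    also have "\<dots> = e * (mat_adjoint Q * Q) $$ (i, 0)"
      using that Qc by (simp add: scalar_prod_smult_distrib[of _ ?n])
    finally show ?thesis using that by (simp add: QQ)
  qed
  have Krow: "K $$ (0, j) = cnj (K $$ (j, 0))" if "j < ?n" for j
    using that K Kh mat_adjoint_index[of 0 K j] by simp
  define K' where "K' = mat n n (\<lambda>(i, j). K $$ (Suc i, Suc j))"
  have K': "K' \<in> carrier_mat n n" by (simp add: K'_def)
  have "mat_adjoint K' = K'"
  proof (rule eq_matI)
    fix i j assume "i < dim_row K'" "j < dim_col K'"
    then have ij: "i < n" "j < n" by (auto simp: K'_def)
    have "cnj (K $$ (Suc j, Suc i)) = K $$ (Suc i, Suc j)"
      using ij K Kh mat_adjoint_index[of "Suc i" K "Suc j"] by simp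
    then show "mat_adjoint K' $$ (i, j) = K' $$ (i, j)" using ij by (simp add: K'_def)
  qed (auto simp: K'_def)
  then obtain Q' d where Q': "unitary_mat n Q'" and d: "K' = Q' * real_diag n d * mat_adjoint Q'"
    using Suc.IH[OF K'] by blast
  have Q'c: "Q' \<in> carrier_mat n n" and QQ': "mat_adjoint Q' * Q' = 1\<^sub>m n" "Q' * mat_adjoint Q' = 1\<^sub>m n"
    using Q' by (auto simp: unitary_mat_def)
  define F where "F a M = four_block_mat (mat 1 1 (\<lambda>_. a)) (0\<^sub>m 1 n) (0\<^sub>m n 1) M"
    for a and M :: "complex mat"
  have Fc: "F a M \<in> carrier_mat ?n ?n" if "M \<in> carrier_mat n n" for a M
    using four_block_carrier_mat[of "mat 1 1 (\<lambda>_. a)" 1 1 M n n] that unfolding F_def by simp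
  have 11: "mat 1 1 (\<lambda>_. a) * mat 1 1 (\<lambda>_. b) = mat 1 1 (\<lambda>_. a * b)" for a b :: complex
    by (rule eq_matI) (auto simp: scalar_prod_def)
  have Fmult: "F a M * F b M' = F (a * b) (M * M')"
    if "M \<in> carrier_mat n n" "M' \<in> carrier_mat n n" for a b M M'
    unfolding F_def 11[symmetric] using that by (subst mult_four_block_mat[of _ 1 1 _ n _ n]) auto
  have Fadj: "mat_adjoint (F a M) = F (cnj a) (mat_adjoint M)" if "M \<in> carrier_mat n n" for a M
    unfolding F_def using that by (intro eq_matI) auto
  have "mat 1 1 (\<lambda>_. 1) = (1\<^sub>m 1 :: complex mat)" by (rule eq_matI) auto
  then have F1: "F 1 (1\<^sub>m n) = 1\<^sub>m ?n" unfolding F_def by simp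
  define d' where "d' i = (case i of 0 \<Rightarrow> Re e | Suc i \<Rightarrow> d i)" for i
  have e_real: "e = of_real (Re e)"
    using Krow[of 0] Kcol[of 0] by (simp add: complex_eq_iff)
  have Kblock: "K = F e K'"
  proof (rule eq_matI)
    fix i j assume "i < dim_row (F e K')" "j < dim_col (F e K')"
    then show "K $$ (i, j) = F e K' $$ (i, j)"
      using Kcol[of i] Kcol[of j] Krow[of j] by (cases i; cases j) (auto simp: K'_def F_def)
  qed (use K K' in \<open>auto simp: F_def\<close>)
  have Dblock: "real_diag ?n d' = F e (real_diag n d)"
    unfolding F_def
    by (rule eq_matI) (use e_real in \<open>auto simp: d'_def less_Suc_eq_0_disj\<close>)
  have KF: "F 1 Q' * real_diag ?n d' * mat_adjoint (F 1 Q') = K"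
    unfolding Dblock Kblock d using Q'c by (simp add: Fadj Fmult)
  define W where "W = F 1 Q'"
  have FQ: "W \<in> carrier_mat ?n ?n" "mat_adjoint W \<in> carrier_mat ?n ?n"
    using Fc[OF Q'c, of 1] by (auto simp: W_def)
  have FF: "mat_adjoint W * W = 1\<^sub>m ?n" "W * mat_adjoint W = 1\<^sub>m ?n"
    using Q'c by (auto simp: W_def Fadj Fmult QQ' F1)
  define V where "V = Q * W"
  have Vc: "V \<in> carrier_mat ?n ?n" using Qc FQ by (auto simp: V_def)
  note assoc = assoc_mult_mat[of _ ?n ?n _ ?n _ ?n]
  have aV: "mat_adjoint V = mat_adjoint W * mat_adjoint Q"
    using Qc FQ by (simp add: V_def mat_adjoint_mult)
  have "mat_adjoint V * V = mat_adjoint W * ((mat_adjoint Q * Q) * W)"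
    unfolding aV unfolding V_def using Qc FQ aQc by (simp add: assoc)
  then have V1: "mat_adjoint V * V = 1\<^sub>m ?n" using FQ by (simp add: QQ FF)
  then have V2: "V * mat_adjoint V = 1\<^sub>m ?n"
    using mat_mult_left_right_inverse[of "mat_adjoint V" ?n V] Vc by simp
  have "V * real_diag ?n d' * mat_adjoint V = Q * K * mat_adjoint Q"
  proof -
    have WD: "W * real_diag ?n d' \<in> carrier_mat ?n ?n" using FQ by simp
    have "V * real_diag ?n d' * mat_adjoint V = Q * (W * real_diag ?n d') * (mat_adjoint W * mat_adjoint Q)"
      unfolding aV unfolding V_def using Qc FQ by (simp add: assoc)
    also have "\<dots> = Q * (W * real_diag ?n d' * mat_adjoint W) * mat_adjoint Q"
      using Qc FQ aQc WD mult_carrier_mat[OF WD FQ(2)] by (simp add: assoc[OF Qc] assoc[OF WD])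
    finally show ?thesis unfolding W_def KF .
  qed
  also have "\<dots> = (Q * mat_adjoint Q) * H * (Q * mat_adjoint Q)"
    unfolding K_def using Qc aQc Suc.prems(1) by (simp add: assoc)
  also have "\<dots> = H" unfolding QQ using Suc.prems(1) by simp
  finally show ?case using V1 V2 Vc unfolding unitary_mat_def by metis
qed


section \<open>Matrices over a C*-algebra\<close>

text \<open>
  The laws of matrix algebra with conditions on dimensions instead of carrier sets: the simplifier
  can discharge these for compound factors.
\<close>

lemma mat_mult_assoc:
  fixes A B C :: "'r::semiring_0 mat"
  assumes "dim_col A = dim_row B" "dim_col B = dim_row C"
  shows "A * B * C = A * (B * C)"
  by (rule assoc_mult_mat[of A "dim_row A" "dim_col A" B "dim_col B" C "dim_col C"]; intro carrier_matI; simp add: assms)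

lemma mat_mult_add_right:
  fixes A B C :: "'r::semiring_0 mat"
  assumes "dim_col A = dim_row B" "dim_row C = dim_row B" "dim_col C = dim_col B"
  shows "A * (B + C) = A * B + A * C"
  by (rule mult_add_distrib_mat[of A "dim_row A" "dim_col A" B "dim_col B" C]; intro carrier_matI; simp add: assms)

lemma mat_mult_add_left:
  fixes A B C :: "'r::semiring_0 mat"
  assumes "dim_col A = dim_row C" "dim_row B = dim_row A" "dim_col B = dim_col A"
  shows "(A + B) * C = A * C + B * C"
  by (rule add_mult_distrib_mat[of A "dim_row A" "dim_col A" B C "dim_col C"]; intro carrier_matI; simp add: assms)

lemma mat_mult_minus_right:
  fixes A B C :: "'r::ring mat"
  assumes "dim_col A = dim_row B" "dim_row C = dim_row B" "dim_col C = dim_col B"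
  shows "A * (B - C) = A * B - A * C"
  by (rule mult_minus_distrib_mat[of A "dim_row A" "dim_col A" B "dim_col B" C]; intro carrier_matI; simp add: assms)

lemma mat_mult_minus_left:
  fixes A B C :: "'r::ring mat"
  assumes "dim_col A = dim_row C" "dim_row B = dim_row A" "dim_col B = dim_col A"
  shows "(A - B) * C = A * C - B * C"
  by (rule minus_mult_distrib_mat[of A "dim_row A" "dim_col A" B C "dim_col C"]; intro carrier_matI; simp add: assms)

lemma mat_mult_one:
  fixes A :: "'r::semiring_1 mat"
  shows "dim_col A = n \<Longrightarrow> A * 1\<^sub>m n = A" "dim_row A = n \<Longrightarrow> 1\<^sub>m n * A = A"
  by (rule right_mult_one_mat[of A "dim_row A" n]; intro carrier_matI; simp)
    (rule left_mult_one_mat[of A n "dim_col A"]; intro carrier_matI; simp)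

lemma mat_mult_zero:
  fixes A :: "'r::semiring_0 mat"
  shows "dim_col A = n \<Longrightarrow> A * 0\<^sub>m n k = 0\<^sub>m (dim_row A) k"
    "dim_row A = n \<Longrightarrow> 0\<^sub>m k n * A = 0\<^sub>m k (dim_col A)"
  by (rule right_mult_zero_mat[of A "dim_row A" n k]; intro carrier_matI; simp)
    (rule left_mult_zero_mat[of A n "dim_col A" k]; intro carrier_matI; simp)

lemma mat_add_zero:
  fixes A :: "'r::monoid_add mat"
  shows "dim_row A = n \<Longrightarrow> dim_col A = k \<Longrightarrow> 0\<^sub>m n k + A = A"
    "dim_row A = n \<Longrightarrow> dim_col A = k \<Longrightarrow> A + 0\<^sub>m n k = A"
  by (auto intro!: eq_matI)

lemmas mat_algebra = mat_add_zero mat_mult_assoc mat_mult_add_right mat_mult_add_left mat_mult_minus_right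
  mat_mult_minus_left mat_mult_one mat_mult_zero

lemma scaleC_one [simp]: "1 *\<^sub>C x = (x::'a::cstar_algebra)"
  using scaleC_of_real[of 1 x] by simp

lemma scaleC_zero [simp]: "0 *\<^sub>C x = (0::'a::cstar_algebra)" "c *\<^sub>C (0::'a) = 0"
  using scaleC_of_real[of 0 x] scaleC_add_right[of c "0::'a" 0] by simp_all

lemma scaleC_diff_left: "(c - d) *\<^sub>C x = c *\<^sub>C x - d *\<^sub>C (x::'a::cstar_algebra)"
  using scaleC_add_left[of "c - d" d x] by simp

lemma scaleC_sum_left: "sum c S *\<^sub>C x = (\<Sum>i\<in>S. c i *\<^sub>C (x::'a::cstar_algebra))"
  by (induction S rule: infinite_finite_induct) (auto simp: scaleC_add_left)

lemma scaleC_sum_right: "c *\<^sub>C sum f S = (\<Sum>i\<in>S. c *\<^sub>C (f i::'a::cstar_algebra))"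
  by (induction S rule: infinite_finite_induct) (auto simp: scaleC_add_right)

lemma ampliate_dim [simp]:
  "dim_row (ampliate T) = dim_row T" "dim_col (ampliate T) = dim_col T"
  by (auto simp: ampliate_def)

lemma ampliate_carrier [simp]: "ampliate T \<in> carrier_mat n m \<longleftrightarrow> T \<in> carrier_mat n m"
  unfolding carrier_mat_def by simp

lemma ampliate_index [simp]:
  "i < dim_row T \<Longrightarrow> j < dim_col T \<Longrightarrow> ampliate T $$ (i, j) = T $$ (i, j) *\<^sub>C 1"
  by (simp add: ampliate_def)

lemma ampliate_one [simp]: "ampliate (1\<^sub>m n) = 1\<^sub>m n"
  by (rule eq_matI) auto

lemma ampliate_minus:
  "S \<in> carrier_mat n m \<Longrightarrow> T \<in> carrier_mat n m \<Longrightarrow> ampliate (S - T) = ampliate S - ampliate T"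
  by (rule eq_matI) (auto simp: scaleC_diff_left)

lemma ampliate_mult:
  assumes "S \<in> carrier_mat n m" "T \<in> carrier_mat m k"
  shows "ampliate (S * T) = (ampliate S * ampliate T :: 'a::cstar_algebra mat)"
proof (rule eq_matI)
  fix i j assume "i < dim_row (ampliate S * ampliate T :: 'a mat)" "j < dim_col (ampliate S * ampliate T :: 'a mat)"
  then have ij: "i < n" "j < k" using assms by auto
  have "(S * T) $$ (i, j) = (\<Sum>l<m. S $$ (i, l) * T $$ (l, j))"
    using ij assms by (subst mult_mat_index) auto
  then have "ampliate (S * T) $$ (i, j) = (\<Sum>l<m. (S $$ (i, l) * T $$ (l, j)) *\<^sub>C (1::'a))"
    using ij assms by (simp add: scaleC_sum_left del: index_mult_mat(1))
  also have "\<dots> = (\<Sum>l<m. ampliate S $$ (i, l) * ampliate T $$ (l, j))"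
    using ij assms by (intro sum.cong) (simp_all add: mult_scaleC_left scaleC_scaleC)
  also have "\<dots> = (ampliate S * ampliate T :: 'a mat) $$ (i, j)"
    using ij assms by (subst mult_mat_index) simp_all
  finally show "ampliate (S * T) $$ (i, j) = (ampliate S * ampliate T :: 'a mat) $$ (i, j)" .
qed (use assms in auto)

lemma star_mat_dim [simp]:
  "dim_row (star_mat A) = dim_col A" "dim_col (star_mat A) = dim_row A"
  by (auto simp: star_mat_def)

lemma star_mat_carrier [simp]: "star_mat A \<in> carrier_mat n m \<longleftrightarrow> A \<in> carrier_mat m n"
  unfolding carrier_mat_def by (simp add: conj_commute)

lemma star_mat_index [simp]:
  "i < dim_col A \<Longrightarrow> j < dim_row A \<Longrightarrow> star_mat A $$ (i, j) = star (A $$ (j, i))"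
  by (simp add: star_mat_def)

lemma star_mat_star_mat [simp]: "star_mat (star_mat A) = A"
  by (rule eq_matI) (auto simp: star_star)

lemma star_mat_mult:
  assumes "A \<in> carrier_mat n m" "B \<in> carrier_mat m k"
  shows "star_mat (A * B) = star_mat B * star_mat A"
proof (rule eq_matI)
  fix i j assume "i < dim_row (star_mat B * star_mat A)" "j < dim_col (star_mat B * star_mat A)"
  then have ij: "i < k" "j < n" using assms by auto
  have "(A * B) $$ (j, i) = (\<Sum>l<m. A $$ (j, l) * B $$ (l, i))"
    using ij assms by (subst mult_mat_index) auto
  then have "star_mat (A * B) $$ (i, j) = (\<Sum>l<m. star (B $$ (l, i)) * star (A $$ (j, l)))"
    using ij assms by (simp add: star_sum star_mult del: index_mult_mat(1))
  also have "\<dots> = (\<Sum>l<m. star_mat B $$ (i, l) * star_mat A $$ (l, j))"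
    using ij assms by (intro sum.cong) simp_all
  also have "\<dots> = (star_mat B * star_mat A) $$ (i, j)"
    using ij assms by (subst mult_mat_index) simp_all
  finally show "star_mat (A * B) $$ (i, j) = (star_mat B * star_mat A) $$ (i, j)" .
qed (use assms in auto)

lemma star_mat_ampliate: "star_mat (ampliate T) = ampliate (mat_adjoint T)"
  by (rule eq_matI) (auto simp: star_scaleC)

lemma transpose_ampliate: "transpose_mat (ampliate T) = ampliate (transpose_mat T)"
  by (rule eq_matI) auto

text \<open>Over a noncommutative ring, transposition does not reverse products in general.\<close>

lemma transpose_mult_commuting:
  fixes A B :: "'r::semiring_0 mat"
  assumes "A \<in> carrier_mat n m" "B \<in> carrier_mat m k"
    and "\<And>i j l. i < n \<Longrightarrow> j < m \<Longrightarrow> l < k \<Longrightarrow> A $$ (i, j) * B $$ (j, l) = B $$ (j, l) * A $$ (i, j)"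
  shows "transpose_mat (A * B) = transpose_mat B * transpose_mat A"
proof (rule eq_matI)
  fix i j assume "i < dim_row (transpose_mat B * transpose_mat A)" "j < dim_col (transpose_mat B * transpose_mat A)"
  then have ij: "i < k" "j < n" using assms by auto
  have "transpose_mat (A * B) $$ (i, j) = (A * B) $$ (j, i)" using ij assms(1,2) by simp
  also have "\<dots> = (\<Sum>l<m. A $$ (j, l) * B $$ (l, i))"
    using ij assms(1,2) by (subst mult_mat_index) auto
  also have "\<dots> = (\<Sum>l<m. transpose_mat B $$ (i, l) * transpose_mat A $$ (l, j))"
    using ij assms by (intro sum.cong) simp_all
  also have "\<dots> = (transpose_mat B * transpose_mat A) $$ (i, j)"
    using ij assms(1,2) by (subst mult_mat_index) simp_all
  finally show "transpose_mat (A * B) $$ (i, j) = (transpose_mat B * transpose_mat A) $$ (i, j)" .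
qed (use assms in auto)

lemma transpose_ampliate_mult:
  assumes "T \<in> carrier_mat n m" "B \<in> carrier_mat m k"
  shows "transpose_mat (ampliate T * B) = transpose_mat B * transpose_mat (ampliate T)"
  by (rule transpose_mult_commuting[of _ n m _ k])
    (use assms in \<open>auto simp: mult_scaleC_left mult_scaleC_right\<close>)

lemma transpose_mult_ampliate:
  assumes "B \<in> carrier_mat n m" "T \<in> carrier_mat m k"
  shows "transpose_mat (B * ampliate T) = transpose_mat (ampliate T) * transpose_mat B"
  by (rule transpose_mult_commuting[of _ n m _ k])
    (use assms in \<open>auto simp: mult_scaleC_left mult_scaleC_right\<close>)

definition trace_over :: "'r::comm_monoid_add mat \<Rightarrow> 'r" where
  "trace_over A = (\<Sum>i<dim_row A. A $$ (i, i))"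

lemma trace_over_mult_commute:
  fixes A B :: "'r::semiring_0 mat"
  assumes "A \<in> carrier_mat n m" "B \<in> carrier_mat m n"
    and c: "\<And>i j. i < n \<Longrightarrow> j < m \<Longrightarrow> A $$ (i, j) * B $$ (j, i) = B $$ (j, i) * A $$ (i, j)"
  shows "trace_over (A * B) = trace_over (B * A)"
proof -
  have 1: "(A * B) $$ (i, i) = (\<Sum>k<m. A $$ (i, k) * B $$ (k, i))" if "i < n" for i
    using assms(1,2) that by (subst mult_mat_index) auto
  have 2: "(B * A) $$ (k, k) = (\<Sum>i<n. B $$ (k, i) * A $$ (i, k))" if "k < m" for k
    using assms(1,2) that by (subst mult_mat_index) auto
  have "trace_over (A * B) = (\<Sum>i<n. \<Sum>k<m. B $$ (k, i) * A $$ (i, k))"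
    using assms(1,2) by (simp add: trace_over_def 1 c del: index_mult_mat(1))
  also have "\<dots> = trace_over (B * A)"
    using assms(1,2) by (subst sum.swap) (simp add: trace_over_def 2 del: index_mult_mat(1))
  finally show ?thesis .
qed

lemma trace_over_ampliate: "trace_over (ampliate T) = trace_mat T *\<^sub>C 1" if "T \<in> carrier_mat n n"
  using that by (simp add: trace_over_def trace_mat_sum scaleC_sum_left)

lemma trace_over_minus:
  fixes A B :: "'r::ring mat"
  assumes "A \<in> carrier_mat n n" "B \<in> carrier_mat n n"
  shows "trace_over (A - B) = trace_over A - trace_over B"
  using assms by (simp add: trace_over_def sum_subtractf)

lemma trace_over_star_mult_self_eq_0:
  fixes Y :: "'a::cstar_algebra mat"
  assumes Y: "Y \<in> carrier_mat n m" and 0: "trace_over (star_mat Y * Y) = 0"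
  shows "Y = 0\<^sub>m n m"
proof (rule eq_matI)
  fix i j assume "i < dim_row (0\<^sub>m n m :: 'a mat)" "j < dim_col (0\<^sub>m n m :: 'a mat)"
  then have ij: "i < n" "j < m" by auto
  have d: "(star_mat Y * Y) $$ (k, k) = (\<Sum>l<n. star (Y $$ (l, k)) * Y $$ (l, k))" if "k < m" for k
    using Y that by (subst mult_mat_index) simp_all
  have "(\<Sum>p\<in>{..<m} \<times> {..<n}. star (Y $$ (snd p, fst p)) * Y $$ (snd p, fst p)) =
      (\<Sum>k<m. \<Sum>l<n. star (Y $$ (l, k)) * Y $$ (l, k))"
    by (simp add: sum.cartesian_product case_prod_unfold)
  also have "\<dots> = trace_over (star_mat Y * Y)"
    using Y by (simp add: trace_over_def d del: index_mult_mat(1))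
  finally have "(\<Sum>p\<in>{..<m} \<times> {..<n}. star (Y $$ (snd p, fst p)) * Y $$ (snd p, fst p)) = 0"
    using 0 by simp
  from sum_star_mult_self_eq_0[OF _ this, of "(j, i)"] ij
  show "Y $$ (i, j) = 0\<^sub>m n m $$ (i, j)" by simp
qed (use Y in auto)


section \<open>Complete reducibility\<close>

definition unitary_over :: "nat \<Rightarrow> 'a::cstar_algebra mat \<Rightarrow> bool" where
  "unitary_over n A \<longleftrightarrow> A \<in> carrier_mat n n \<and> A * star_mat A = 1\<^sub>m n \<and> star_mat A * A = 1\<^sub>m n"

definition inverse_pair :: "nat \<Rightarrow> complex mat \<Rightarrow> complex mat \<Rightarrow> bool" where
  "inverse_pair n R N \<longleftrightarrow> R \<in> carrier_mat n n \<and> N \<in> carrier_mat n n \<and> R * N = 1\<^sub>m n \<and> N * R = 1\<^sub>m n"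

text \<open>
  For a unitary \<open>A\<close> the contragredient \<open>A\<^sup>c\<close> is the transpose of \<open>A\<^sup>*\<close>. The two equations say that
  \<open>A\<^sup>c\<close> is invertible and that its inverse is the transpose of \<open>R A R\<^sup>-\<^sup>1\<close>, in other words that
  \<open>R\<close> intertwines \<open>A\<close> with \<open>A\<^sup>c\<^sup>c\<close>. In general \<open>A\<^sup>c\<close> is not unitary, since transposition does not
  reverse products of matrices with noncommuting entries.
\<close>

definition modular_pair :: "nat \<Rightarrow> 'a::cstar_algebra mat \<Rightarrow> complex mat \<Rightarrow> complex mat \<Rightarrow> bool" where
  "modular_pair n A R N \<longleftrightarrow> inverse_pair n R N \<and>
     transpose_mat (star_mat A) * transpose_mat (ampliate R * A * ampliate N) = 1\<^sub>m n \<and>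
     transpose_mat (ampliate R * A * ampliate N) * transpose_mat (star_mat A) = 1\<^sub>m n"

lemma modular_pair_right:
  assumes A: "A \<in> carrier_mat n n" and m: "modular_pair n A R N"
  shows "transpose_mat (star_mat A) * transpose_mat (A * ampliate N) = transpose_mat (ampliate N)"
proof -
  have R: "R \<in> carrier_mat n n" and N: "N \<in> carrier_mat n n" and NR: "N * R = 1\<^sub>m n"
    using m by (auto simp: modular_pair_def inverse_pair_def)
  let ?S = "transpose_mat (star_mat A)" and ?T = "transpose_mat (A * ampliate N)"
  let ?R = "transpose_mat (ampliate R) :: 'a mat" and ?N = "transpose_mat (ampliate N) :: 'a mat"
  have c: "?S \<in> carrier_mat n n" "?T \<in> carrier_mat n n" "?R \<in> carrier_mat n n" "?N \<in> carrier_mat n n"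
    using A R N by auto
  have AN: "A * ampliate N \<in> carrier_mat n n" using A N by simp
  have "transpose_mat (ampliate N * ampliate R :: 'a mat) = ?R * ?N"
    by (rule transpose_ampliate_mult[OF N]) (use R in simp)
  then have RN: "?R * ?N = 1\<^sub>m n" using NR by (simp flip: ampliate_mult[OF N R])
  have "transpose_mat (ampliate R * A * ampliate N) = transpose_mat (ampliate R * (A * ampliate N))"
    using R A N by (simp add: assoc_mult_mat[of _ n n _ n _ n])
  also have "\<dots> = ?T * ?R" by (rule transpose_ampliate_mult[OF R AN])
  finally have "?S * (?T * ?R) = 1\<^sub>m n" using m by (simp add: modular_pair_def)
  then have "?S * (?T * ?R) * ?N = ?N" using N by (simp add: mat_mult_one)
  moreover have "?S * (?T * ?R) * ?N = ?S * ?T * (?R * ?N)"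
    using A R N by (simp add: mat_mult_assoc)
  ultimately show ?thesis using A N by (simp add: RN mat_mult_one)
qed

lemma modular_pair_left:
  assumes A: "A \<in> carrier_mat n n" and m: "modular_pair n A R N"
  shows "transpose_mat (ampliate R * A) * transpose_mat (star_mat A) = transpose_mat (ampliate R)"
proof -
  have R: "R \<in> carrier_mat n n" and N: "N \<in> carrier_mat n n" and NR: "N * R = 1\<^sub>m n"
    using m by (auto simp: modular_pair_def inverse_pair_def)
  let ?S = "transpose_mat (star_mat A)" and ?T = "transpose_mat (ampliate R * A)"
  let ?R = "transpose_mat (ampliate R) :: 'a mat" and ?N = "transpose_mat (ampliate N) :: 'a mat"
  have c: "?S \<in> carrier_mat n n" "?T \<in> carrier_mat n n" "?R \<in> carrier_mat n n" "?N \<in> carrier_mat n n"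
    using A R N by auto
  have RA: "ampliate R * A \<in> carrier_mat n n" using A R by simp
  have "transpose_mat (ampliate N * ampliate R :: 'a mat) = ?R * ?N"
    by (rule transpose_ampliate_mult[OF N]) (use R in simp)
  then have RN: "?R * ?N = 1\<^sub>m n" using NR by (simp flip: ampliate_mult[OF N R])
  have "transpose_mat (ampliate R * A * ampliate N) = ?N * ?T" by (rule transpose_mult_ampliate[OF RA N])
  then have "?N * ?T * ?S = 1\<^sub>m n" using m by (simp add: modular_pair_def)
  then have "?R * (?N * ?T * ?S) = ?R" using R by (simp add: mat_mult_one)
  moreover have "?R * (?N * ?T * ?S) = ?R * ?N * (?T * ?S)"
    using A R N by (simp add: mat_mult_assoc)
  ultimately show ?thesis using A R by (simp add: RN mat_mult_one)
qed

text \<open>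
  The trace of a product is not cyclic over a noncommutative algebra, so unitarity of \<open>A\<close> does not
  evaluate the left-hand side. The factors occur in the order of the product of the transposes of
  \<open>A\<^sup>*\<close> and \<open>A N\<close>, and that product is known from the defining equations of a modular pair.
\<close>

lemma modular_trace_invariant:
  fixes A :: "'a::cstar_algebra mat"
  assumes A: "A \<in> carrier_mat n n" and m: "modular_pair n A R N" and T: "T \<in> carrier_mat n n"
  shows "trace_over (ampliate N * (star_mat A * ampliate T * A)) = trace_mat (N * T) *\<^sub>C 1"
proof -
  have N: "N \<in> carrier_mat n n" using m by (auto simp: modular_pair_def inverse_pair_def)
  let ?S = "star_mat A" and ?B = "A * ampliate N"
  have B: "?B \<in> carrier_mat n n" using A N by simp
  have ST: "?S * ampliate T \<in> carrier_mat n n" using A T by simp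
  have "trace_over (ampliate N * (?S * ampliate T * A)) = trace_over (?S * ampliate T * A * ampliate N)"
    by (rule trace_over_mult_commute[of _ n n])
      (use A N T in \<open>auto simp: mult_scaleC_left mult_scaleC_right simp del: index_mult_mat(1)\<close>)
  also have "?S * ampliate T * A * ampliate N = ?S * ampliate T * ?B"
    using A N T by (simp add: assoc_mult_mat[of _ n n _ n _ n])
  also have "trace_over \<dots> = (\<Sum>k<n. \<Sum>l<n. (?S * ampliate T) $$ (k, l) * ?B $$ (l, k))"
  proof -
    have "(?S * ampliate T * ?B) $$ (k, k) = (\<Sum>l<n. (?S * ampliate T) $$ (k, l) * ?B $$ (l, k))"
      if "k < n" for k using A N T that by (subst mult_mat_index) simp_all
    then show ?thesis using A by (simp add: trace_over_def del: index_mult_mat(1))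
  qed
  also have "\<dots> = (\<Sum>k<n. \<Sum>l<n. \<Sum>i<n. T $$ (i, l) *\<^sub>C (?S $$ (k, i) * ?B $$ (l, k)))"
  proof -
    have "(?S * ampliate T) $$ (k, l) * b = (\<Sum>i<n. T $$ (i, l) *\<^sub>C (?S $$ (k, i) * b))"
      if "k < n" "l < n" for k l and b :: 'a
    proof -
      have "(?S * ampliate T) $$ (k, l) = (\<Sum>i<n. ?S $$ (k, i) * ampliate T $$ (i, l))"
        using A T that by (subst mult_mat_index) auto
      also have "\<dots> = (\<Sum>i<n. T $$ (i, l) *\<^sub>C ?S $$ (k, i))"
        using A T that by (intro sum.cong) (simp_all add: mult_scaleC_right del: star_mat_index)
      finally show ?thesis by (simp add: sum_distrib_right mult_scaleC_left)
    qed
    then show ?thesis by (simp del: index_mult_mat(1) star_mat_index)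
  qed
  also have "\<dots> = (\<Sum>l<n. \<Sum>i<n. T $$ (i, l) *\<^sub>C (\<Sum>k<n. ?S $$ (k, i) * ?B $$ (l, k)))"
    unfolding scaleC_sum_right
    by (subst sum.swap) (intro sum.cong refl sum.swap)
  also have "\<dots> = (\<Sum>l<n. \<Sum>i<n. (N $$ (l, i) * T $$ (i, l)) *\<^sub>C 1)"
  proof -
    have "(\<Sum>k<n. ?S $$ (k, i) * ?B $$ (l, k)) = N $$ (l, i) *\<^sub>C 1" if "l < n" "i < n" for l i
    proof -
      have "(\<Sum>k<n. ?S $$ (k, i) * ?B $$ (l, k)) =
          (\<Sum>k<n. transpose_mat ?S $$ (i, k) * transpose_mat ?B $$ (k, l))"
        using that A N by (intro sum.cong) (simp_all del: index_mult_mat(1) star_mat_index)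
      also have "\<dots> = (transpose_mat ?S * transpose_mat ?B) $$ (i, l)"
        using that A N by (subst mult_mat_index) auto
      also have "\<dots> = N $$ (l, i) *\<^sub>C 1" unfolding modular_pair_right[OF A m] using that N by simp
      finally show ?thesis .
    qed
    then show ?thesis by (simp add: scaleC_scaleC mult.commute del: index_mult_mat(1) star_mat_index)
  qed
  also have "\<dots> = trace_mat (N * T) *\<^sub>C 1"
    unfolding trace_mat_mult[OF N T] scaleC_sum_left ..
  finally show ?thesis .
qed

text \<open>
  With respect to \<open>e\<close> and \<open>f = 1 - e\<close> the matrix \<open>A\<close> is block triangular; let \<open>x = e A f\<close> be the
  corner. Unitarity of \<open>A\<close> yields \<open>x\<^sup>* x = f - A\<^sup>* f A\<close>, hence \<open>Tr (N x\<^sup>* x) = 0\<close> by invariance of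
  the weighted trace. Since \<open>N = G G\<^sup>*\<close>, this is \<open>Tr (y\<^sup>* y)\<close> for \<open>y = x G\<close>, so \<open>y = 0\<close>, and
  \<open>x = 0\<close> because \<open>G\<close> has a right inverse.
\<close>

lemma invariant_projection_commutes:
  fixes A :: "'a::cstar_algebra mat"
  assumes A: "unitary_over n A" and m: "modular_pair n A R N" and N: "N = G * mat_adjoint G"
    and e: "e \<in> carrier_mat n n" "mat_adjoint e = e" "e * e = e"
    and inv: "ampliate e * A * ampliate e = A * ampliate e"
  shows "ampliate e * A = A * ampliate e"
proof -
  have Ac: "A \<in> carrier_mat n n" and uA: "star_mat A * A = 1\<^sub>m n" using A by (auto simp: unitary_over_def)
  have R: "R \<in> carrier_mat n n" and Nc: "N \<in> carrier_mat n n" and NR: "N * R = 1\<^sub>m n"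
    using m by (auto simp: modular_pair_def inverse_pair_def)
  note assoc = assoc_mult_mat[of _ n n _ n _ n]
  define f where "f = 1\<^sub>m n - e"
  define E F S :: "'a mat" where "E = ampliate e" and "F = ampliate f" and "S = star_mat A"
  have fc: "f \<in> carrier_mat n n" using e unfolding f_def by (intro minus_carrier_mat)
  have c: "E \<in> carrier_mat n n" "F \<in> carrier_mat n n" "S \<in> carrier_mat n n"
    using e fc Ac by (auto simp: E_def F_def S_def)
  have d: "dim_row E = n" "dim_col E = n" "dim_row F = n" "dim_col F = n" "dim_row S = n" "dim_col S = n"
    "dim_row A = n" "dim_col A = n" using c Ac by auto
  have F: "F = 1\<^sub>m n - E" using e by (simp add: F_def E_def f_def ampliate_minus[of _ n n])
  have EE: "E * E = E" using e by (simp add: E_def flip: ampliate_mult)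
  have FF: "F * F = F"
    unfolding F by (simp add: d EE mat_algebra) (rule eq_matI, auto simp: d)
  have sE: "star_mat E = E" using e by (simp add: E_def star_mat_ampliate)
  have "mat_adjoint f = f" using e by (simp add: f_def mat_adjoint_minus[of _ n n])
  then have sF: "star_mat F = F" by (simp add: F_def star_mat_ampliate)
  have SA: "S * A = 1\<^sub>m n" by (simp add: S_def uA)
  have AEF: "A = A * E + A * F"
    unfolding F by (simp add: d mat_algebra) (rule eq_matI, auto simp: d simp del: index_mult_mat(1))
  have FAE: "F * (A * E) = 0\<^sub>m n n"
  proof -
    have "E * (A * E) = A * E" using inv by (simp add: d mat_algebra flip: E_def)
    then show ?thesis
      unfolding F by (simp add: d mat_algebra) (rule eq_matI, auto simp: d simp del: index_mult_mat(1))
  qed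
  have FA: "F * A = F * (A * F)"
  proof -
    have "F * A = F * (A * E + A * F)" using AEF by simp
    also have "\<dots> = F * (A * E) + F * (A * F)" by (simp add: d mat_algebra)
    finally show ?thesis unfolding FAE by (simp add: d mat_add_zero)
  qed
  have SF: "S * F = F * (S * F)"
  proof -
    have "star_mat (F * A) = star_mat (F * (A * F))" using FA by simp
    then show ?thesis using c Ac sF by (simp add: star_mat_mult[of _ n n _ n] S_def assoc)
  qed
  define X where "X = E * (A * F)"
  have X: "X \<in> carrier_mat n n" using c Ac by (simp add: X_def)
  have "star_mat X = F * (S * E)"
    using c Ac by (simp add: X_def star_mat_mult[of _ n n _ n] sE sF S_def assoc)
  then have "star_mat X * X = F * (S * E) * (E * (A * F))" by (simp add: X_def)
  also have "\<dots> = F * (S * ((E * E) * (A * F)))" by (simp add: d mat_algebra)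
  also have "\<dots> = F * (S * (E * (A * F)))" by (simp add: EE)
  also have "E * (A * F) = A * F - F * (A * F)"
  proof -
    have "F * (A * F) = A * F - E * (A * F)"
      by (subst (1) F) (simp add: d mat_algebra)
    then show ?thesis by (simp, intro eq_matI) (auto simp: d simp del: index_mult_mat(1))
  qed
  also have "F * (S * (A * F - F * (A * F))) = F * (S * (A * F)) - F * (S * (F * (A * F)))"
    by (simp add: d mat_algebra)
  also have "F * (S * (A * F)) = F"
  proof -
    have "F * (S * (A * F)) = F * ((S * A) * F)" by (simp add: d mat_algebra)
    then show ?thesis by (simp add: SA FF d mat_algebra)
  qed
  also have "F * (S * (F * (A * F))) = (F * (S * F)) * A" by (simp add: d FA mat_mult_assoc)
  also have "\<dots> = S * F * A" by (simp only: SF[symmetric])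
  finally have XX: "star_mat X * X = F - S * F * A" .
  define Y where "Y = X * ampliate G"
  have Gr: "dim_row G = n" using N Nc by auto
  define p where "p = dim_col G"
  have G: "G \<in> carrier_mat n p" using Gr by (auto simp: p_def)
  have Y: "Y \<in> carrier_mat n p" using X G by (simp add: Y_def)
  have "star_mat Y * Y = ampliate (mat_adjoint G) * star_mat X * (X * ampliate G)"
    unfolding Y_def using X G by (simp add: star_mat_mult[of _ n n _ p] star_mat_ampliate)
  also have "\<dots> = ampliate (mat_adjoint G) * (star_mat X * X * ampliate G)"
    using X G by (simp add: mat_mult_assoc)
  also have "trace_over \<dots> = trace_over (star_mat X * X * ampliate G * ampliate (mat_adjoint G))"
    by (rule trace_over_mult_commute[of _ p n])
      (use X G in \<open>auto simp: mult_scaleC_left mult_scaleC_right simp del: index_mult_mat(1)\<close>)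
  also have "star_mat X * X * ampliate G * ampliate (mat_adjoint G) = star_mat X * X * ampliate N"
    using X G by (simp add: N ampliate_mult[of _ n p _ n] mat_mult_assoc)
  also have "trace_over \<dots> = trace_over (ampliate N * (star_mat X * X))"
    by (rule trace_over_mult_commute[of _ n n])
      (use X Nc in \<open>auto simp: mult_scaleC_left mult_scaleC_right simp del: index_mult_mat(1)\<close>)
  also have "ampliate N * (star_mat X * X) = ampliate N * F - ampliate N * (S * F * A)"
    unfolding XX using Nc by (simp add: d mat_algebra)
  also have "trace_over \<dots> = trace_over (ampliate N * F) - trace_over (ampliate N * (S * F * A))"
    using c Ac Nc by (intro trace_over_minus[of _ n]) simp_all
  also have "trace_over (ampliate N * (S * F * A)) = trace_mat (N * f) *\<^sub>C 1"
    unfolding S_def F_def by (rule modular_trace_invariant[OF Ac m fc])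
  also have "trace_over (ampliate N * F) = trace_mat (N * f) *\<^sub>C 1"
    unfolding F_def ampliate_mult[OF Nc fc, symmetric]
    using Nc fc by (simp add: trace_over_ampliate[of _ n])
  finally have "trace_over (star_mat Y * Y) = 0" by simp
  then have "Y = 0\<^sub>m n p" by (rule trace_over_star_mult_self_eq_0[OF Y])
  then have "X * ampliate G * ampliate (mat_adjoint G * R) = 0\<^sub>m n n"
    using G R by (simp add: Y_def)
  moreover have "X * ampliate G * ampliate (mat_adjoint G * R) = X * ampliate (N * R)"
    unfolding N using X G R
    by (simp add: ampliate_mult[of _ n p _ n] ampliate_mult[of _ p n _ n] ampliate_mult[of _ n n _ n]
        mat_mult_assoc)
  ultimately have X0: "X = 0\<^sub>m n n" using X by (simp add: NR)
  have "E * A = E * (A * E + A * F)" using AEF by simp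
  also have "\<dots> = E * (A * E) + X" by (simp add: d mat_algebra X_def)
  also have "\<dots> = A * E" using inv by (simp add: X0 d mat_algebra flip: E_def)
  finally show ?thesis by (simp add: E_def)
qed


section \<open>Tensor products\<close>

definition kron :: "'r::times mat \<Rightarrow> 'r mat \<Rightarrow> 'r mat" where
  "kron A B = mat (dim_row A * dim_row B) (dim_col A * dim_col B)
     (\<lambda>(r, s). A $$ (r div dim_row B, s div dim_col B) * B $$ (r mod dim_row B, s mod dim_col B))"

text \<open>
  As \<open>kron\<close>, with the entries multiplied in the opposite order; adjoints and inverses of tensor
  products of matrices over a noncommutative ring are of this form.
\<close>

definition opp_kron :: "'r::times mat \<Rightarrow> 'r mat \<Rightarrow> 'r mat" where
  "opp_kron A B = mat (dim_row A * dim_row B) (dim_col A * dim_col B)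
     (\<lambda>(r, s). B $$ (r mod dim_row B, s mod dim_col B) * A $$ (r div dim_row B, s div dim_col B))"

lemma tensor_rep_eq_kron: "tensor_rep A B = kron A B"
  by (simp add: tensor_rep_def kron_def)

lemma pair_index_less: "i < n \<Longrightarrow> k < p \<Longrightarrow> i * p + k < n * (p::nat)"
proof -
  assume "i < n" "k < p"
  then have "i * p + k < i * p + p" by simp
  also have "\<dots> = Suc i * p" by simp
  also have "\<dots> \<le> n * p" using \<open>i < n\<close> by (intro mult_le_mono1) simp
  finally show ?thesis .
qed

lemma kron_dim [simp]:
  "dim_row (kron A B) = dim_row A * dim_row B" "dim_col (kron A B) = dim_col A * dim_col B"
  "dim_row (opp_kron A B) = dim_row A * dim_row B" "dim_col (opp_kron A B) = dim_col A * dim_col B"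
  by (simp_all add: kron_def opp_kron_def)

lemma kron_index:
  assumes "A \<in> carrier_mat n m" "B \<in> carrier_mat p q" "i < n" "k < p" "j < m" "l < q"
  shows "kron A B $$ (i * p + k, j * q + l) = A $$ (i, j) * B $$ (k, l)"
    and "opp_kron A B $$ (i * p + k, j * q + l) = B $$ (k, l) * A $$ (i, j)"
  using assms pair_index_less[of i n k p] pair_index_less[of j m l q]
  by (simp_all add: kron_def opp_kron_def)

lemma mat_eq_by_pairs:
  assumes "M \<in> carrier_mat (n * p) (m * q)" "M' \<in> carrier_mat (n * p) (m * q)"
    and eq: "\<And>i k j l. i < n \<Longrightarrow> k < p \<Longrightarrow> j < m \<Longrightarrow> l < q \<Longrightarrow>
      M $$ (i * p + k, j * q + l) = M' $$ (i * p + k, j * q + l)"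
  shows "M = M'"
proof (rule eq_matI)
  fix r s assume "r < dim_row M'" "s < dim_col M'"
  then have r: "r < n * p" and s: "s < m * q" using assms by auto
  have "p > 0" "q > 0" using r s by (auto intro: gr0I)
  then have "M $$ (r div p * p + r mod p, s div q * q + s mod q) = M' $$ (r div p * p + r mod p, s div q * q + s mod q)"
    using r s by (intro eq) (simp_all add: less_mult_imp_div_less)
  then show "M $$ (r, s) = M' $$ (r, s)" by simp
qed (use assms in auto)

lemma sum_pairs: "(\<Sum>r<n * p. f r) = (\<Sum>i<n. \<Sum>k<p. f (i * p + k :: nat))"
proof -
  have "(\<Sum>k<p. f (i * p + k)) = sum f {i * p..<i * p + p}" for i
    using sum.shift_bounds_nat_ivl[of f 0 "i * p" p] by (simp add: atLeast0LessThan add.commute)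
  then show ?thesis by (simp add: sum.nat_group)
qed

lemma mult_mat_pair_index:
  fixes M M' :: "'r::semiring_0 mat"
  assumes "M \<in> carrier_mat a (m * q)" "M' \<in> carrier_mat (m * q) b" "r < a" "s < b"
  shows "(M * M') $$ (r, s) = (\<Sum>j<m. \<Sum>l<q. M $$ (r, j * q + l) * M' $$ (j * q + l, s))"
proof -
  have "(M * M') $$ (r, s) = (\<Sum>k<m * q. M $$ (r, k) * M' $$ (k, s))"
    using assms by (subst mult_mat_index) auto
  then show ?thesis by (simp only: sum_pairs)
qed

lemma mult_mat_index':
  fixes A B :: "'r::semiring_0 mat"
  assumes "A \<in> carrier_mat n m" "B \<in> carrier_mat m k" "i < n" "j < k"
  shows "(A * B) $$ (i, j) = (\<Sum>l<m. A $$ (i, l) * B $$ (l, j))"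
  using assms by (subst mult_mat_index) auto

lemma kron_carrier [intro]:
  "A \<in> carrier_mat n m \<Longrightarrow> B \<in> carrier_mat p q \<Longrightarrow> kron A B \<in> carrier_mat (n * p) (m * q)"
  "A \<in> carrier_mat n m \<Longrightarrow> B \<in> carrier_mat p q \<Longrightarrow> opp_kron A B \<in> carrier_mat (n * p) (m * q)"
  by (auto intro!: carrier_matI)

lemma kron_mult:
  fixes P Q R S :: "'r::semiring_0 mat"
  assumes P: "P \<in> carrier_mat n m" and R: "R \<in> carrier_mat m n'"
    and Q: "Q \<in> carrier_mat p q" and S: "S \<in> carrier_mat q p'"
    and comm: "\<And>k l j i. k < p \<Longrightarrow> l < q \<Longrightarrow> j < m \<Longrightarrow> i < n' \<Longrightarrow> Q $$ (k, l) * R $$ (j, i) = R $$ (j, i) * Q $$ (k, l)"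
  shows "kron P Q * kron R S = kron (P * R) (Q * S)"
proof (rule mat_eq_by_pairs[of _ n p n' p'])
  fix i k j l assume ij: "i < n" "k < p" "j < n'" "l < p'"
  have "(kron P Q * kron R S) $$ (i * p + k, j * p' + l) =
      (\<Sum>a<m. \<Sum>b<q. kron P Q $$ (i * p + k, a * q + b) * kron R S $$ (a * q + b, j * p' + l))"
    using ij kron_carrier(1)[OF P Q] kron_carrier(1)[OF R S]
    by (intro mult_mat_pair_index[of _ "n * p" m q _ "n' * p'"]) (auto intro: pair_index_less)
  also have "\<dots> = (\<Sum>a<m. \<Sum>b<q. (P $$ (i, a) * R $$ (a, j)) * (Q $$ (k, b) * S $$ (b, l)))"
  proof (intro sum.cong refl)
    fix a b assume "a \<in> {..<m}" "b \<in> {..<q}"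
    then have ab: "a < m" "b < q" by auto
    have "P $$ (i, a) * Q $$ (k, b) * (R $$ (a, j) * S $$ (b, l)) =
        P $$ (i, a) * (Q $$ (k, b) * R $$ (a, j)) * S $$ (b, l)" by (simp only: mult.assoc)
    also have "\<dots> = (P $$ (i, a) * R $$ (a, j)) * (Q $$ (k, b) * S $$ (b, l))"
      using comm[of k b a j] ij ab by (simp only: mult.assoc)
    finally show "kron P Q $$ (i * p + k, a * q + b) * kron R S $$ (a * q + b, j * p' + l) =
        (P $$ (i, a) * R $$ (a, j)) * (Q $$ (k, b) * S $$ (b, l))"
      using ij ab by (simp only: kron_index[OF P Q] kron_index[OF R S])
  qed
  also have "\<dots> = (\<Sum>a<m. P $$ (i, a) * R $$ (a, j)) * (\<Sum>b<q. Q $$ (k, b) * S $$ (b, l))"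
    by (simp only: sum_product)
  also have "\<dots> = kron (P * R) (Q * S) $$ (i * p + k, j * p' + l)"
    using ij mult_carrier_mat[OF P R] mult_carrier_mat[OF Q S]
    by (simp only: kron_index mult_mat_index'[OF P R] mult_mat_index'[OF Q S])
  finally show "(kron P Q * kron R S) $$ (i * p + k, j * p' + l) = kron (P * R) (Q * S) $$ (i * p + k, j * p' + l)" .
qed (use kron_carrier(1)[OF P Q] kron_carrier(1)[OF R S] kron_carrier(1)[OF mult_carrier_mat[OF P R] mult_carrier_mat[OF Q S]] in auto)

lemma one_mat_pair_index:
  assumes "i < n" "k < p" "j < n" "l < p"
  shows "(1\<^sub>m (n * p) :: 'r::{zero,one} mat) $$ (i * p + k, j * p + l) = (if i = j \<and> k = l then 1 else 0)"
proof -
  have "i * p + k = j * p + l \<longleftrightarrow> i = j \<and> k = l"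
  proof
    assume eq: "i * p + k = j * p + l"
    have "(i * p + k) div p = i" "(j * p + l) div p = j" using assms by simp_all
    then have "i = j" using eq by simp
    then show "i = j \<and> k = l" using eq by simp
  qed simp
  then show ?thesis using assms pair_index_less[of i n k p] pair_index_less[of j n l p] by simp
qed

text \<open>
  In an entry of the product the factors from \<open>Q\<close> and \<open>Q'\<close> are adjacent; they sum up to a scalar,
  which brings the factors from \<open>P\<close> and \<open>P'\<close> together.
\<close>

lemma kron_mult_opp_kron:
  fixes P P' Q Q' :: "'r::semiring_1 mat"
  assumes P: "P \<in> carrier_mat n m" "P' \<in> carrier_mat m n" "P * P' = 1\<^sub>m n"
    and Q: "Q \<in> carrier_mat p q" "Q' \<in> carrier_mat q p" "Q * Q' = 1\<^sub>m p"
  shows "kron P Q * opp_kron P' Q' = 1\<^sub>m (n * p)"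
proof (rule mat_eq_by_pairs[of _ n p n p])
  fix i k j l assume ij: "i < n" "k < p" "j < n" "l < p"
  have "(kron P Q * opp_kron P' Q') $$ (i * p + k, j * p + l) =
      (\<Sum>a<m. \<Sum>b<q. kron P Q $$ (i * p + k, a * q + b) * opp_kron P' Q' $$ (a * q + b, j * p + l))"
    using ij kron_carrier(1)[OF P(1) Q(1)] kron_carrier(2)[OF P(2) Q(2)]
    by (intro mult_mat_pair_index[of _ "n * p" m q _ "n * p"]) (auto intro: pair_index_less)
  also have "\<dots> = (\<Sum>a<m. \<Sum>b<q. P $$ (i, a) * (Q $$ (k, b) * Q' $$ (b, l)) * P' $$ (a, j))"
    using ij by (intro sum.cong refl) (simp only: lessThan_iff kron_index[OF P(1) Q(1)] kron_index[OF P(2) Q(2)] mult.assoc)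
  also have "\<dots> = (\<Sum>a<m. P $$ (i, a) * (\<Sum>b<q. Q $$ (k, b) * Q' $$ (b, l)) * P' $$ (a, j))"
    by (simp only: sum_distrib_left sum_distrib_right)
  also have "(\<Sum>b<q. Q $$ (k, b) * Q' $$ (b, l)) = 1\<^sub>m p $$ (k, l)"
    using ij by (simp only: mult_mat_index'[OF Q(1,2), symmetric] Q(3))
  also have "(\<Sum>a<m. P $$ (i, a) * 1\<^sub>m p $$ (k, l) * P' $$ (a, j)) =
      (if k = l then (\<Sum>a<m. P $$ (i, a) * P' $$ (a, j)) else 0)"
    using ij by simp
  also have "(\<Sum>a<m. P $$ (i, a) * P' $$ (a, j)) = 1\<^sub>m n $$ (i, j)"
    using ij by (simp only: mult_mat_index'[OF P(1,2), symmetric] P(3))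
  also have "(if k = l then 1\<^sub>m n $$ (i, j) else 0) = 1\<^sub>m (n * p) $$ (i * p + k, j * p + l)"
    using ij by (simp add: one_mat_pair_index)
  finally show "(kron P Q * opp_kron P' Q') $$ (i * p + k, j * p + l) = 1\<^sub>m (n * p) $$ (i * p + k, j * p + l)" .
qed (use kron_carrier(1)[OF P(1) Q(1)] kron_carrier(2)[OF P(2) Q(2)] in auto)

lemma opp_kron_mult_kron:
  fixes P P' Q Q' :: "'r::semiring_1 mat"
  assumes P: "P \<in> carrier_mat m n" "P' \<in> carrier_mat n m" "P' * P = 1\<^sub>m n"
    and Q: "Q \<in> carrier_mat q p" "Q' \<in> carrier_mat p q" "Q' * Q = 1\<^sub>m p"
  shows "opp_kron P' Q' * kron P Q = 1\<^sub>m (n * p)"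
proof (rule mat_eq_by_pairs[of _ n p n p])
  fix i k j l assume ij: "i < n" "k < p" "j < n" "l < p"
  have "(opp_kron P' Q' * kron P Q) $$ (i * p + k, j * p + l) =
      (\<Sum>a<m. \<Sum>b<q. opp_kron P' Q' $$ (i * p + k, a * q + b) * kron P Q $$ (a * q + b, j * p + l))"
    using ij kron_carrier(1)[OF P(1) Q(1)] kron_carrier(2)[OF P(2) Q(2)]
    by (intro mult_mat_pair_index[of _ "n * p" m q _ "n * p"]) (auto intro: pair_index_less)
  also have "\<dots> = (\<Sum>a<m. \<Sum>b<q. Q' $$ (k, b) * (P' $$ (i, a) * P $$ (a, j)) * Q $$ (b, l))"
    using ij by (intro sum.cong refl) (simp only: lessThan_iff kron_index[OF P(1) Q(1)] kron_index[OF P(2) Q(2)] mult.assoc)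
  also have "\<dots> = (\<Sum>b<q. Q' $$ (k, b) * (\<Sum>a<m. P' $$ (i, a) * P $$ (a, j)) * Q $$ (b, l))"
    by (subst sum.swap) (simp only: sum_distrib_left sum_distrib_right)
  also have "(\<Sum>a<m. P' $$ (i, a) * P $$ (a, j)) = 1\<^sub>m n $$ (i, j)"
    using ij by (simp only: mult_mat_index'[OF P(2,1), symmetric] P(3))
  also have "(\<Sum>b<q. Q' $$ (k, b) * 1\<^sub>m n $$ (i, j) * Q $$ (b, l)) =
      (if i = j then (\<Sum>b<q. Q' $$ (k, b) * Q $$ (b, l)) else 0)"
    using ij by simp
  also have "(\<Sum>b<q. Q' $$ (k, b) * Q $$ (b, l)) = 1\<^sub>m p $$ (k, l)"
    using ij by (simp only: mult_mat_index'[OF Q(2,1), symmetric] Q(3))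
  also have "(if i = j then 1\<^sub>m p $$ (k, l) else 0) = 1\<^sub>m (n * p) $$ (i * p + k, j * p + l)"
    using ij by (simp add: one_mat_pair_index)
  finally show "(opp_kron P' Q' * kron P Q) $$ (i * p + k, j * p + l) = 1\<^sub>m (n * p) $$ (i * p + k, j * p + l)" .
qed (use kron_carrier(1)[OF P(1) Q(1)] kron_carrier(2)[OF P(2) Q(2)] in auto)

lemma star_mat_kron: "star_mat (kron A B) = opp_kron (star_mat A) (star_mat B)"
proof (rule mat_eq_by_pairs[of _ "dim_col A" "dim_col B" "dim_row A" "dim_row B"])
  have A: "A \<in> carrier_mat (dim_row A) (dim_col A)" and B: "B \<in> carrier_mat (dim_row B) (dim_col B)" by auto
  have A': "star_mat A \<in> carrier_mat (dim_col A) (dim_row A)" and B': "star_mat B \<in> carrier_mat (dim_col B) (dim_row B)" by auto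
  fix i k j l assume ij: "i < dim_col A" "k < dim_col B" "j < dim_row A" "l < dim_row B"
  then show "star_mat (kron A B) $$ (i * dim_col B + k, j * dim_row B + l) =
      opp_kron (star_mat A) (star_mat B) $$ (i * dim_col B + k, j * dim_row B + l)"
    by (simp add: pair_index_less kron_index[OF A B] kron_index[OF A' B'] star_mult)
qed auto

lemma mat_adjoint_kron: "mat_adjoint (kron A B) = kron (mat_adjoint A) (mat_adjoint B :: complex mat)"
proof (rule mat_eq_by_pairs[of _ "dim_col A" "dim_col B" "dim_row A" "dim_row B"])
  have A: "A \<in> carrier_mat (dim_row A) (dim_col A)" and B: "B \<in> carrier_mat (dim_row B) (dim_col B)" by auto
  have A': "mat_adjoint A \<in> carrier_mat (dim_col A) (dim_row A)" and B': "mat_adjoint B \<in> carrier_mat (dim_col B) (dim_row B)" by auto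
  fix i k j l assume ij: "i < dim_col A" "k < dim_col B" "j < dim_row A" "l < dim_row B"
  then show "mat_adjoint (kron A B) $$ (i * dim_col B + k, j * dim_row B + l) =
      kron (mat_adjoint A) (mat_adjoint B) $$ (i * dim_col B + k, j * dim_row B + l)"
    by (simp add: pair_index_less kron_index[OF A B] kron_index[OF A' B'])
qed auto

lemma transpose_kron:
  "transpose_mat (kron A B) = kron (transpose_mat A) (transpose_mat B)"
  "transpose_mat (opp_kron A B) = opp_kron (transpose_mat A) (transpose_mat B)"
proof -
  have A: "A \<in> carrier_mat (dim_row A) (dim_col A)" and B: "B \<in> carrier_mat (dim_row B) (dim_col B)" by auto
  have A': "transpose_mat A \<in> carrier_mat (dim_col A) (dim_row A)" and B': "transpose_mat B \<in> carrier_mat (dim_col B) (dim_row B)" by auto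
  show "transpose_mat (kron A B) = kron (transpose_mat A) (transpose_mat B)"
    by (rule mat_eq_by_pairs[of _ "dim_col A" "dim_col B" "dim_row A" "dim_row B"])
      (auto simp: pair_index_less kron_index[OF A B] kron_index[OF A' B'])
  show "transpose_mat (opp_kron A B) = opp_kron (transpose_mat A) (transpose_mat B)"
    by (rule mat_eq_by_pairs[of _ "dim_col A" "dim_col B" "dim_row A" "dim_row B"])
      (auto simp: pair_index_less kron_index[OF A B] kron_index[OF A' B'])
qed

lemma ampliate_kron: "ampliate (kron S T) = kron (ampliate S) (ampliate T)"
proof (rule mat_eq_by_pairs[of _ "dim_row S" "dim_row T" "dim_col S" "dim_col T"])
  have S: "S \<in> carrier_mat (dim_row S) (dim_col S)" and T: "T \<in> carrier_mat (dim_row T) (dim_col T)" by auto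
  have S': "ampliate S \<in> carrier_mat (dim_row S) (dim_col S)" and T': "ampliate T \<in> carrier_mat (dim_row T) (dim_col T)" by auto
  fix i k j l assume ij: "i < dim_row S" "k < dim_row T" "j < dim_col S" "l < dim_col T"
  then show "ampliate (kron S T) $$ (i * dim_row T + k, j * dim_col T + l) =
      kron (ampliate S) (ampliate T) $$ (i * dim_row T + k, j * dim_col T + l)"
    by (simp add: pair_index_less kron_index[OF S T] kron_index[OF S' T'] mult_scaleC_left scaleC_scaleC)
qed auto

lemma kron_one: "kron (1\<^sub>m n) (1\<^sub>m p) = (1\<^sub>m (n * p) :: 'r::semiring_1 mat)"
  by (rule mat_eq_by_pairs[of _ n p n p])
    (auto simp: kron_index[of "1\<^sub>m n" n n "1\<^sub>m p" p p] one_mat_pair_index)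

lemma trace_mat_kron:
  assumes "A \<in> carrier_mat n n" "B \<in> carrier_mat p p"
  shows "trace_mat (kron A B) = trace_mat A * trace_mat B"
proof -
  have "trace_mat (kron A B) = (\<Sum>i<n. \<Sum>k<p. kron A B $$ (i * p + k, i * p + k))"
    using assms by (simp add: trace_mat_sum sum_pairs)
  also have "\<dots> = (\<Sum>i<n. \<Sum>k<p. A $$ (i, i) * B $$ (k, k))"
    by (intro sum.cong refl) (simp add: kron_index[OF assms])
  finally show ?thesis using assms by (simp add: trace_mat_sum sum_product)
qed

lemma kron_mult_complex:
  fixes P Q R S :: "complex mat"
  assumes "P \<in> carrier_mat n m" "R \<in> carrier_mat m n'" "Q \<in> carrier_mat p q" "S \<in> carrier_mat q p'"
  shows "kron P Q * kron R S = kron (P * R) (Q * S)"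
  by (rule kron_mult[OF assms]) (simp add: mult.commute)

lemma unitary_over_kron:
  assumes "unitary_over n A" "unitary_over p B"
  shows "unitary_over (n * p) (kron A B)"
  using assms kron_mult_opp_kron[of A n n "star_mat A" B p p "star_mat B"]
    opp_kron_mult_kron[of A n n "star_mat A" B p p "star_mat B"]
  unfolding unitary_over_def star_mat_kron by auto

lemma inverse_pair_kron:
  assumes "inverse_pair n R N" "inverse_pair p R' N'"
  shows "inverse_pair (n * p) (kron R R') (kron N N')"
  using assms unfolding inverse_pair_def
  by (auto simp: kron_mult_complex[of _ n n _ n _ p p _ p] kron_one)

text \<open>
  The adjoint reverses the order of the entries and \<open>R A N\<close> keeps it, so the two matrices that
  have to be inverse to each other are an \<open>opp_kron\<close> and a \<open>kron\<close>.
\<close>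

lemma modular_pair_kron:
  fixes A B :: "'a::cstar_algebra mat"
  assumes A: "A \<in> carrier_mat n n" and B: "B \<in> carrier_mat p p"
    and mA: "modular_pair n A R N" and mB: "modular_pair p B R' N'"
  shows "modular_pair (n * p) (kron A B) (kron R R') (kron N N')"
proof -
  have c: "R \<in> carrier_mat n n" "N \<in> carrier_mat n n" "R' \<in> carrier_mat p p" "N' \<in> carrier_mat p p"
    using mA mB by (auto simp: modular_pair_def inverse_pair_def)
  have "ampliate (kron R R') * kron A B = kron (ampliate R * A) (ampliate R' * B)"
    unfolding ampliate_kron
    by (rule kron_mult[of _ n n _ n _ p p _ p]) (use c A B in \<open>simp_all add: mult_scaleC_left mult_scaleC_right\<close>)
  moreover have "kron (ampliate R * A) (ampliate R' * B) * ampliate (kron N N') =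
      kron (ampliate R * A * ampliate N) (ampliate R' * B * ampliate N')"
    unfolding ampliate_kron
    by (rule kron_mult[of _ n n _ n _ p p _ p])
      (use c A B in \<open>simp_all add: mult_scaleC_left mult_scaleC_right del: index_mult_mat(1)\<close>)
  ultimately have eq: "ampliate (kron R R') * kron A B * ampliate (kron N N') =
      kron (ampliate R * A * ampliate N) (ampliate R' * B * ampliate N')" by simp
  let ?X = "ampliate R * A * ampliate N" and ?Y = "ampliate R' * B * ampliate N'"
  have X: "transpose_mat ?X \<in> carrier_mat n n" "transpose_mat ?Y \<in> carrier_mat p p"
    "transpose_mat (star_mat A) \<in> carrier_mat n n" "transpose_mat (star_mat B) \<in> carrier_mat p p"
    using c A B by simp_all
  show ?thesis
    unfolding modular_pair_def eq transpose_kron star_mat_kron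
  proof (intro conjI)
    show "inverse_pair (n * p) (kron R R') (kron N N')"
      using mA mB by (intro inverse_pair_kron) (auto simp: modular_pair_def)
    show "opp_kron (transpose_mat (star_mat A)) (transpose_mat (star_mat B)) *
        kron (transpose_mat ?X) (transpose_mat ?Y) = 1\<^sub>m (n * p)"
      by (rule opp_kron_mult_kron[OF X(1,3) _ X(2,4)]) (use mA mB in \<open>auto simp: modular_pair_def\<close>)
    show "kron (transpose_mat ?X) (transpose_mat ?Y) *
        opp_kron (transpose_mat (star_mat A)) (transpose_mat (star_mat B)) = 1\<^sub>m (n * p)"
      by (rule kron_mult_opp_kron[OF X(1,3) _ X(2,4)]) (use mA mB in \<open>auto simp: modular_pair_def\<close>)
  qed
qed

text \<open>
  Over a noncommutative algebra the usual partial trace over a factor does not absorb conjugation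
  by a unitary matrix on that factor; a suitable weight \<open>K\<close> restores this.
\<close>

definition partial_trace_right :: "nat \<Rightarrow> nat \<Rightarrow> complex mat \<Rightarrow> 'a::cstar_algebra mat \<Rightarrow> 'a mat" where
  "partial_trace_right n p K Y = mat n n (\<lambda>(a, c). \<Sum>b<p. \<Sum>f<p. K $$ (f, b) *\<^sub>C Y $$ (a * p + b, c * p + f))"

definition partial_trace_left :: "nat \<Rightarrow> nat \<Rightarrow> complex mat \<Rightarrow> 'a::cstar_algebra mat \<Rightarrow> 'a mat" where
  "partial_trace_left n p K Y = mat p p (\<lambda>(b, f). \<Sum>a<n. \<Sum>c<n. K $$ (c, a) *\<^sub>C Y $$ (a * p + b, c * p + f))"

lemma partial_trace_dim [simp]:
  "dim_row (partial_trace_right n p K Y) = n" "dim_col (partial_trace_right n p K Y) = n"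
  "dim_row (partial_trace_left n p K Y) = p" "dim_col (partial_trace_left n p K Y) = p"
  "partial_trace_right n p K Y \<in> carrier_mat n n" "partial_trace_left n p K Y \<in> carrier_mat p p"
  by (simp_all add: partial_trace_right_def partial_trace_left_def)

lemma trace_over_ampliate_mult:
  fixes Z :: "'a::cstar_algebra mat"
  assumes K: "K \<in> carrier_mat n n" and Z: "Z \<in> carrier_mat n n"
  shows "trace_over (ampliate K * Z) = (\<Sum>b<n. \<Sum>f<n. K $$ (f, b) *\<^sub>C Z $$ (b, f))"
proof -
  have K': "ampliate K \<in> carrier_mat n n" using K by simp
  have "trace_over (ampliate K * Z) = (\<Sum>f<n. (ampliate K * Z) $$ (f, f))"
    using K by (simp add: trace_over_def del: index_mult_mat(1))
  also have "\<dots> = (\<Sum>f<n. \<Sum>b<n. K $$ (f, b) *\<^sub>C Z $$ (b, f))"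
    using K by (intro sum.cong refl) (simp add: mult_mat_index'[OF K' Z] mult_scaleC_left del: index_mult_mat(1))
  also have "\<dots> = (\<Sum>b<n. \<Sum>f<n. K $$ (f, b) *\<^sub>C Z $$ (b, f))" by (rule sum.swap)
  finally show ?thesis .
qed

lemma mult_kron_one:
  fixes A :: "'r::semiring_1 mat"
  assumes A: "A \<in> carrier_mat n n" and Y: "Y \<in> carrier_mat (n * p) (n * p)"
    and "i < n" "k < p" "j < n" "l < p"
  shows "(kron A (1\<^sub>m p) * Y) $$ (i * p + k, j * p + l) = (\<Sum>a<n. A $$ (i, a) * Y $$ (a * p + k, j * p + l))"
    and "(Y * kron A (1\<^sub>m p)) $$ (i * p + k, j * p + l) = (\<Sum>a<n. Y $$ (i * p + k, a * p + l) * A $$ (a, j))"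
proof -
  have I: "1\<^sub>m p \<in> carrier_mat p p" by simp
  have AI: "kron A (1\<^sub>m p) \<in> carrier_mat (n * p) (n * p)" using A by (rule kron_carrier) simp
  have less: "i * p + k < n * p" "j * p + l < n * p" using assms by (simp_all add: pair_index_less)
  have "(kron A (1\<^sub>m p) * Y) $$ (i * p + k, j * p + l) =
      (\<Sum>a<n. \<Sum>b<p. kron A (1\<^sub>m p) $$ (i * p + k, a * p + b) * Y $$ (a * p + b, j * p + l))"
    by (rule mult_mat_pair_index[OF AI Y less])
  also have "\<dots> = (\<Sum>a<n. \<Sum>b<p. if k = b then A $$ (i, a) * Y $$ (a * p + b, j * p + l) else 0)"
    using assms by (intro sum.cong refl) (simp add: kron_index[OF A I])
  finally show "(kron A (1\<^sub>m p) * Y) $$ (i * p + k, j * p + l) = (\<Sum>a<n. A $$ (i, a) * Y $$ (a * p + k, j * p + l))"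
    using assms by simp
  have "(Y * kron A (1\<^sub>m p)) $$ (i * p + k, j * p + l) =
      (\<Sum>a<n. \<Sum>b<p. Y $$ (i * p + k, a * p + b) * kron A (1\<^sub>m p) $$ (a * p + b, j * p + l))"
    by (rule mult_mat_pair_index[OF Y AI less])
  also have "\<dots> = (\<Sum>a<n. \<Sum>b<p. if b = l then Y $$ (i * p + k, a * p + b) * A $$ (a, j) else 0)"
    using assms by (intro sum.cong refl) (simp add: kron_index[OF A I])
  finally show "(Y * kron A (1\<^sub>m p)) $$ (i * p + k, j * p + l) = (\<Sum>a<n. Y $$ (i * p + k, a * p + l) * A $$ (a, j))"
    using assms by simp
qed

lemma mult_one_kron:
  fixes B :: "'r::semiring_1 mat"
  assumes B: "B \<in> carrier_mat p p" and Y: "Y \<in> carrier_mat (n * p) (n * p)"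
    and "i < n" "k < p" "j < n" "l < p"
  shows "(kron (1\<^sub>m n) B * Y) $$ (i * p + k, j * p + l) = (\<Sum>b<p. B $$ (k, b) * Y $$ (i * p + b, j * p + l))"
    and "(Y * kron (1\<^sub>m n) B) $$ (i * p + k, j * p + l) = (\<Sum>b<p. Y $$ (i * p + k, j * p + b) * B $$ (b, l))"
proof -
  have I: "1\<^sub>m n \<in> carrier_mat n n" by simp
  have IB: "kron (1\<^sub>m n) B \<in> carrier_mat (n * p) (n * p)" using I B by (rule kron_carrier)
  have less: "i * p + k < n * p" "j * p + l < n * p" using assms by (simp_all add: pair_index_less)
  have "(kron (1\<^sub>m n) B * Y) $$ (i * p + k, j * p + l) =
      (\<Sum>a<n. \<Sum>b<p. kron (1\<^sub>m n) B $$ (i * p + k, a * p + b) * Y $$ (a * p + b, j * p + l))"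
    by (rule mult_mat_pair_index[OF IB Y less])
  also have "\<dots> = (\<Sum>a<n. if i = a then (\<Sum>b<p. B $$ (k, b) * Y $$ (a * p + b, j * p + l)) else 0)"
    using assms by (intro sum.cong refl) (simp add: kron_index[OF I B])
  finally show "(kron (1\<^sub>m n) B * Y) $$ (i * p + k, j * p + l) = (\<Sum>b<p. B $$ (k, b) * Y $$ (i * p + b, j * p + l))"
    using assms by simp
  have "(Y * kron (1\<^sub>m n) B) $$ (i * p + k, j * p + l) =
      (\<Sum>a<n. \<Sum>b<p. Y $$ (i * p + k, a * p + b) * kron (1\<^sub>m n) B $$ (a * p + b, j * p + l))"
    by (rule mult_mat_pair_index[OF Y IB less])
  also have "\<dots> = (\<Sum>a<n. if a = j then (\<Sum>b<p. Y $$ (i * p + k, a * p + b) * B $$ (b, l)) else 0)"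
    using assms by (intro sum.cong refl) (simp add: kron_index[OF I B])
  finally show "(Y * kron (1\<^sub>m n) B) $$ (i * p + k, j * p + l) = (\<Sum>b<p. Y $$ (i * p + k, j * p + b) * B $$ (b, l))"
    using assms by simp
qed

lemma partial_trace_right_bimodule:
  fixes A Y :: "'a::cstar_algebra mat"
  assumes A: "A \<in> carrier_mat n n" and Y: "Y \<in> carrier_mat (n * p) (n * p)"
  shows "partial_trace_right n p K (kron A (1\<^sub>m p) * Y) = A * partial_trace_right n p K Y" (is ?L)
    and "partial_trace_right n p K (Y * kron A (1\<^sub>m p)) = partial_trace_right n p K Y * A" (is ?R)
proof -
  let ?E = "partial_trace_right n p K Y"
  have E: "?E \<in> carrier_mat n n" by simp
  show ?L
  proof (rule eq_matI)
    fix a c assume "a < dim_row (A * ?E)" "c < dim_col (A * ?E)"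
    then have ac: "a < n" "c < n" using A by auto
    have "partial_trace_right n p K (kron A (1\<^sub>m p) * Y) $$ (a, c) =
        (\<Sum>b<p. \<Sum>f<p. \<Sum>i<n. A $$ (a, i) * (K $$ (f, b) *\<^sub>C Y $$ (i * p + b, c * p + f)))"
      unfolding partial_trace_right_def using ac
      by (simp add: mult_kron_one[OF A Y] scaleC_sum_right mult_scaleC_right del: index_mult_mat(1))
    also have "\<dots> = (\<Sum>b<p. \<Sum>i<n. \<Sum>f<p. A $$ (a, i) * (K $$ (f, b) *\<^sub>C Y $$ (i * p + b, c * p + f)))"
      by (intro sum.cong refl sum.swap)
    also have "\<dots> = (\<Sum>i<n. \<Sum>b<p. \<Sum>f<p. A $$ (a, i) * (K $$ (f, b) *\<^sub>C Y $$ (i * p + b, c * p + f)))"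
      by (rule sum.swap)
    also have "\<dots> = (\<Sum>i<n. A $$ (a, i) * ?E $$ (i, c))"
      using ac by (intro sum.cong refl) (simp add: partial_trace_right_def sum_distrib_left)
    also have "\<dots> = (A * ?E) $$ (a, c)" using ac by (simp only: mult_mat_index'[OF A E])
    finally show "partial_trace_right n p K (kron A (1\<^sub>m p) * Y) $$ (a, c) = (A * ?E) $$ (a, c)" .
  qed (use A in auto)
  show ?R
  proof (rule eq_matI)
    fix a c assume "a < dim_row (?E * A)" "c < dim_col (?E * A)"
    then have ac: "a < n" "c < n" using A by auto
    have "partial_trace_right n p K (Y * kron A (1\<^sub>m p)) $$ (a, c) =
        (\<Sum>b<p. \<Sum>f<p. \<Sum>i<n. (K $$ (f, b) *\<^sub>C Y $$ (a * p + b, i * p + f)) * A $$ (i, c))"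
      unfolding partial_trace_right_def using ac
      by (simp add: mult_kron_one[OF A Y] scaleC_sum_right mult_scaleC_left del: index_mult_mat(1))
    also have "\<dots> = (\<Sum>b<p. \<Sum>i<n. \<Sum>f<p. (K $$ (f, b) *\<^sub>C Y $$ (a * p + b, i * p + f)) * A $$ (i, c))"
      by (intro sum.cong refl sum.swap)
    also have "\<dots> = (\<Sum>i<n. \<Sum>b<p. \<Sum>f<p. (K $$ (f, b) *\<^sub>C Y $$ (a * p + b, i * p + f)) * A $$ (i, c))"
      by (rule sum.swap)
    also have "\<dots> = (\<Sum>i<n. ?E $$ (a, i) * A $$ (i, c))"
      using ac by (intro sum.cong refl) (simp add: partial_trace_right_def sum_distrib_right)
    also have "\<dots> = (?E * A) $$ (a, c)" using ac by (simp only: mult_mat_index'[OF E A])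
    finally show "partial_trace_right n p K (Y * kron A (1\<^sub>m p)) $$ (a, c) = (?E * A) $$ (a, c)" .
  qed (use A in auto)
qed

lemma partial_trace_left_bimodule:
  fixes B Y :: "'a::cstar_algebra mat"
  assumes B: "B \<in> carrier_mat p p" and Y: "Y \<in> carrier_mat (n * p) (n * p)"
  shows "partial_trace_left n p K (kron (1\<^sub>m n) B * Y) = B * partial_trace_left n p K Y" (is ?L)
    and "partial_trace_left n p K (Y * kron (1\<^sub>m n) B) = partial_trace_left n p K Y * B" (is ?R)
proof -
  let ?E = "partial_trace_left n p K Y"
  have E: "?E \<in> carrier_mat p p" by simp
  show ?L
  proof (rule eq_matI)
    fix b f assume "b < dim_row (B * ?E)" "f < dim_col (B * ?E)"
    then have bf: "b < p" "f < p" using B by auto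
    have "partial_trace_left n p K (kron (1\<^sub>m n) B * Y) $$ (b, f) =
        (\<Sum>a<n. \<Sum>c<n. \<Sum>i<p. B $$ (b, i) * (K $$ (c, a) *\<^sub>C Y $$ (a * p + i, c * p + f)))"
      unfolding partial_trace_left_def using bf
      by (simp add: mult_one_kron[OF B Y] scaleC_sum_right mult_scaleC_right del: index_mult_mat(1))
    also have "\<dots> = (\<Sum>a<n. \<Sum>i<p. \<Sum>c<n. B $$ (b, i) * (K $$ (c, a) *\<^sub>C Y $$ (a * p + i, c * p + f)))"
      by (intro sum.cong refl sum.swap)
    also have "\<dots> = (\<Sum>i<p. \<Sum>a<n. \<Sum>c<n. B $$ (b, i) * (K $$ (c, a) *\<^sub>C Y $$ (a * p + i, c * p + f)))"
      by (rule sum.swap)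
    also have "\<dots> = (\<Sum>i<p. B $$ (b, i) * ?E $$ (i, f))"
      using bf by (intro sum.cong refl) (simp add: partial_trace_left_def sum_distrib_left)
    also have "\<dots> = (B * ?E) $$ (b, f)" using bf by (simp only: mult_mat_index'[OF B E])
    finally show "partial_trace_left n p K (kron (1\<^sub>m n) B * Y) $$ (b, f) = (B * ?E) $$ (b, f)" .
  qed (use B in auto)
  show ?R
  proof (rule eq_matI)
    fix b f assume "b < dim_row (?E * B)" "f < dim_col (?E * B)"
    then have bf: "b < p" "f < p" using B by auto
    have "partial_trace_left n p K (Y * kron (1\<^sub>m n) B) $$ (b, f) =
        (\<Sum>a<n. \<Sum>c<n. \<Sum>i<p. (K $$ (c, a) *\<^sub>C Y $$ (a * p + b, c * p + i)) * B $$ (i, f))"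
      unfolding partial_trace_left_def using bf
      by (simp add: mult_one_kron[OF B Y] scaleC_sum_right mult_scaleC_left del: index_mult_mat(1))
    also have "\<dots> = (\<Sum>a<n. \<Sum>i<p. \<Sum>c<n. (K $$ (c, a) *\<^sub>C Y $$ (a * p + b, c * p + i)) * B $$ (i, f))"
      by (intro sum.cong refl sum.swap)
    also have "\<dots> = (\<Sum>i<p. \<Sum>a<n. \<Sum>c<n. (K $$ (c, a) *\<^sub>C Y $$ (a * p + b, c * p + i)) * B $$ (i, f))"
      by (rule sum.swap)
    also have "\<dots> = (\<Sum>i<p. ?E $$ (b, i) * B $$ (i, f))"
      using bf by (intro sum.cong refl) (simp add: partial_trace_left_def sum_distrib_right)
    also have "\<dots> = (?E * B) $$ (b, f)" using bf by (simp only: mult_mat_index'[OF E B])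
    finally show "partial_trace_left n p K (Y * kron (1\<^sub>m n) B) $$ (b, f) = (?E * B) $$ (b, f)" .
  qed (use B in auto)
qed

lemma partial_trace_right_ampliate:
  assumes "T \<in> carrier_mat (n * p) (n * p)"
  shows "partial_trace_right n p K (ampliate T) =
    ampliate (mat n n (\<lambda>(a, c). \<Sum>b<p. \<Sum>f<p. K $$ (f, b) * T $$ (a * p + b, c * p + f)))"
  by (rule eq_matI)
    (use assms in \<open>simp_all add: partial_trace_right_def pair_index_less scaleC_scaleC scaleC_sum_left\<close>)

lemma partial_trace_left_ampliate:
  assumes "T \<in> carrier_mat (n * p) (n * p)"
  shows "partial_trace_left n p K (ampliate T) =
    ampliate (mat p p (\<lambda>(b, f). \<Sum>a<n. \<Sum>c<n. K $$ (c, a) * T $$ (a * p + b, c * p + f)))"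
  by (rule eq_matI)
    (use assms in \<open>simp_all add: partial_trace_left_def pair_index_less scaleC_scaleC scaleC_sum_left\<close>)

text \<open>
  Conjugating the other way round exchanges the roles of the two equations of a modular pair, and
  with them those of \<open>R\<close> and \<open>N\<close>.
\<close>

lemma modular_trace_invariant':
  fixes A :: "'a::cstar_algebra mat"
  assumes A: "A \<in> carrier_mat n n" and m: "modular_pair n A R N" and T: "T \<in> carrier_mat n n"
  shows "trace_over (ampliate R * (A * ampliate T * star_mat A)) = trace_mat (R * T) *\<^sub>C 1"
proof -
  have R: "R \<in> carrier_mat n n" using m by (auto simp: modular_pair_def inverse_pair_def)
  let ?S = "star_mat A" and ?B = "ampliate R * A"
  have B: "?B \<in> carrier_mat n n" using A R by simp
  have TS: "ampliate T * ?S \<in> carrier_mat n n" using A T by simp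
  have "ampliate R * (A * ampliate T * ?S) = ?B * (ampliate T * ?S)"
    using A R T by (simp add: mat_mult_assoc)
  then have "trace_over (ampliate R * (A * ampliate T * ?S)) = (\<Sum>k<n. \<Sum>l<n. ?B $$ (k, l) * (ampliate T * ?S) $$ (l, k))"
    using R by (simp add: trace_over_def mult_mat_index'[OF B TS] del: index_mult_mat(1))
  also have "\<dots> = (\<Sum>k<n. \<Sum>l<n. \<Sum>i<n. T $$ (l, i) *\<^sub>C (?B $$ (k, l) * ?S $$ (i, k)))"
  proof -
    have "b * (ampliate T * ?S) $$ (l, k) = (\<Sum>i<n. T $$ (l, i) *\<^sub>C (b * ?S $$ (i, k)))"
      if "k < n" "l < n" for k l and b :: 'a
    proof -
      have "(ampliate T * ?S) $$ (l, k) = (\<Sum>i<n. ampliate T $$ (l, i) * ?S $$ (i, k))"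
        using A T that by (intro mult_mat_index') simp_all
      also have "\<dots> = (\<Sum>i<n. T $$ (l, i) *\<^sub>C ?S $$ (i, k))"
        using A T that by (intro sum.cong) (simp_all add: mult_scaleC_left del: star_mat_index)
      finally show ?thesis by (simp add: sum_distrib_left mult_scaleC_right)
    qed
    then show ?thesis by (simp del: index_mult_mat(1) star_mat_index)
  qed
  also have "\<dots> = (\<Sum>l<n. \<Sum>i<n. T $$ (l, i) *\<^sub>C (\<Sum>k<n. ?B $$ (k, l) * ?S $$ (i, k)))"
    unfolding scaleC_sum_right
    by (subst sum.swap) (intro sum.cong refl sum.swap)
  also have "\<dots> = (\<Sum>l<n. \<Sum>i<n. (R $$ (i, l) * T $$ (l, i)) *\<^sub>C 1)"
  proof -
    have "(\<Sum>k<n. ?B $$ (k, l) * ?S $$ (i, k)) = R $$ (i, l) *\<^sub>C 1" if "l < n" "i < n" for l i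
    proof -
      have "(\<Sum>k<n. ?B $$ (k, l) * ?S $$ (i, k)) =
          (\<Sum>k<n. transpose_mat ?B $$ (l, k) * transpose_mat ?S $$ (k, i))"
        using that A R by (intro sum.cong) (simp_all del: index_mult_mat(1) star_mat_index)
      also have "\<dots> = (transpose_mat ?B * transpose_mat ?S) $$ (l, i)"
        using that A R by (intro mult_mat_index'[symmetric, of _ n n _ n]) auto
      also have "\<dots> = R $$ (i, l) *\<^sub>C 1" unfolding modular_pair_left[OF A m] using that R by simp
      finally show ?thesis .
    qed
    then show ?thesis by (simp add: scaleC_scaleC mult.commute del: index_mult_mat(1) star_mat_index)
  qed
  also have "\<dots> = trace_mat (R * T) *\<^sub>C 1"
    unfolding trace_mat_mult[OF R T] scaleC_sum_left by (rule sum.swap)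
  finally show ?thesis .
qed

text \<open>
  Conjugation by \<open>1 \<otimes> B\<close> acts on each \<open>p \<times> p\<close> block of \<open>T\<close> separately, and the trace of a block
  weighted by \<open>R\<close> is invariant.
\<close>

lemma partial_trace_right_invariant:
  fixes B :: "'a::cstar_algebra mat"
  assumes B: "B \<in> carrier_mat p p" and m: "modular_pair p B R N" and T: "T \<in> carrier_mat (n * p) (n * p)"
  shows "partial_trace_right n p R (kron (1\<^sub>m n) B * ampliate T * kron (1\<^sub>m n) (star_mat B)) =
    partial_trace_right n p R (ampliate T)"
proof (rule eq_matI)
  have R: "R \<in> carrier_mat p p" using m by (auto simp: modular_pair_def inverse_pair_def)
  have T': "ampliate T \<in> carrier_mat (n * p) (n * p)" using T by simp
  have B': "star_mat B \<in> carrier_mat p p" using B by simp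
  have BT: "kron (1\<^sub>m n) B * ampliate T \<in> carrier_mat (n * p) (n * p)"
    using T' kron_carrier(1)[OF one_carrier_mat B] by (rule mult_carrier_mat[rotated])
  fix a c assume "a < dim_row (partial_trace_right n p R (ampliate T))" "c < dim_col (partial_trace_right n p R (ampliate T))"
  then have ac: "a < n" "c < n" by auto
  define Q where "Q = mat p p (\<lambda>(b, f). T $$ (a * p + b, c * p + f))"
  have Q: "Q \<in> carrier_mat p p" by (simp add: Q_def)
  have Qi: "Q $$ (b, f) = T $$ (a * p + b, c * p + f)" if "b < p" "f < p" for b f
    using that by (simp add: Q_def)
  have Q': "ampliate Q \<in> carrier_mat p p" using Q by simp
  have BQ: "B * ampliate Q \<in> carrier_mat p p" using B Q by simp
  have e: "(kron (1\<^sub>m n) B * ampliate T * kron (1\<^sub>m n) (star_mat B)) $$ (a * p + b, c * p + f) =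
      (B * ampliate Q * star_mat B) $$ (b, f)" if "b < p" "f < p" for b f
  proof -
    have "(kron (1\<^sub>m n) B * ampliate T) $$ (a * p + b, c * p + j) = (B * ampliate Q) $$ (b, j)" if "j < p" for j
      using ac \<open>b < p\<close> that T Q
      by (simp add: mult_one_kron(1)[OF B T'] mult_mat_index'[OF B Q'] Qi pair_index_less del: index_mult_mat(1))
    then show ?thesis
      using ac that
      by (simp add: mult_one_kron(2)[OF B' BT] mult_mat_index'[OF BQ B'] del: index_mult_mat(1))
  qed
  have "partial_trace_right n p R (kron (1\<^sub>m n) B * ampliate T * kron (1\<^sub>m n) (star_mat B)) $$ (a, c) =
      (\<Sum>b<p. \<Sum>f<p. R $$ (f, b) *\<^sub>C (B * ampliate Q * star_mat B) $$ (b, f))"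
    using ac by (simp add: partial_trace_right_def e del: index_mult_mat(1))
  also have "\<dots> = trace_over (ampliate R * (B * ampliate Q * star_mat B))"
    by (rule trace_over_ampliate_mult[OF R mult_carrier_mat[OF BQ B'], symmetric])
  also have "\<dots> = trace_mat (R * Q) *\<^sub>C 1" by (rule modular_trace_invariant'[OF B m Q])
  also have "\<dots> = trace_over (ampliate R * ampliate Q)"
    using R Q by (simp add: trace_over_ampliate[of _ p] flip: ampliate_mult[of _ p p _ p])
  also have "\<dots> = (\<Sum>b<p. \<Sum>f<p. R $$ (f, b) *\<^sub>C ampliate Q $$ (b, f))"
    by (rule trace_over_ampliate_mult[OF R Q'])
  also have "\<dots> = partial_trace_right n p R (ampliate T) $$ (a, c)"
    using ac T by (simp add: partial_trace_right_def Q_def pair_index_less)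
  finally show "partial_trace_right n p R (kron (1\<^sub>m n) B * ampliate T * kron (1\<^sub>m n) (star_mat B)) $$ (a, c) =
      partial_trace_right n p R (ampliate T) $$ (a, c)" .
qed auto

lemma partial_trace_left_invariant:
  fixes A :: "'a::cstar_algebra mat"
  assumes A: "A \<in> carrier_mat n n" and m: "modular_pair n A R N" and T: "T \<in> carrier_mat (n * p) (n * p)"
  shows "partial_trace_left n p N (kron (star_mat A) (1\<^sub>m p) * ampliate T * kron A (1\<^sub>m p)) =
    partial_trace_left n p N (ampliate T)"
proof (rule eq_matI)
  have N: "N \<in> carrier_mat n n" using m by (auto simp: modular_pair_def inverse_pair_def)
  have T': "ampliate T \<in> carrier_mat (n * p) (n * p)" using T by simp
  have A': "star_mat A \<in> carrier_mat n n" using A by simp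
  have AT: "kron (star_mat A) (1\<^sub>m p) * ampliate T \<in> carrier_mat (n * p) (n * p)"
    using T' kron_carrier(1)[OF A' one_carrier_mat] by (rule mult_carrier_mat[rotated])
  fix b f assume "b < dim_row (partial_trace_left n p N (ampliate T))" "f < dim_col (partial_trace_left n p N (ampliate T))"
  then have bf: "b < p" "f < p" by auto
  define Q where "Q = mat n n (\<lambda>(a, c). T $$ (a * p + b, c * p + f))"
  have Q: "Q \<in> carrier_mat n n" by (simp add: Q_def)
  have Qi: "Q $$ (a, c) = T $$ (a * p + b, c * p + f)" if "a < n" "c < n" for a c
    using that by (simp add: Q_def)
  have Q': "ampliate Q \<in> carrier_mat n n" using Q by simp
  have AQ: "star_mat A * ampliate Q \<in> carrier_mat n n" using A Q by simp
  have e: "(kron (star_mat A) (1\<^sub>m p) * ampliate T * kron A (1\<^sub>m p)) $$ (a * p + b, c * p + f) =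
      (star_mat A * ampliate Q * A) $$ (a, c)" if "a < n" "c < n" for a c
  proof -
    have "(kron (star_mat A) (1\<^sub>m p) * ampliate T) $$ (a * p + b, j * p + f) = (star_mat A * ampliate Q) $$ (a, j)"
      if "j < n" for j
      using bf \<open>a < n\<close> that T Q
      by (simp add: mult_kron_one(1)[OF A' T'] mult_mat_index'[OF A' Q'] Qi pair_index_less
          del: index_mult_mat(1) star_mat_index)
    then show ?thesis
      using bf that
      by (simp add: mult_kron_one(2)[OF A AT] mult_mat_index'[OF AQ A] del: index_mult_mat(1))
  qed
  have "partial_trace_left n p N (kron (star_mat A) (1\<^sub>m p) * ampliate T * kron A (1\<^sub>m p)) $$ (b, f) =
      (\<Sum>a<n. \<Sum>c<n. N $$ (c, a) *\<^sub>C (star_mat A * ampliate Q * A) $$ (a, c))"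
    using bf by (simp add: partial_trace_left_def e del: index_mult_mat(1))
  also have "\<dots> = trace_over (ampliate N * (star_mat A * ampliate Q * A))"
    by (rule trace_over_ampliate_mult[OF N mult_carrier_mat[OF AQ A], symmetric])
  also have "\<dots> = trace_mat (N * Q) *\<^sub>C 1" by (rule modular_trace_invariant[OF A m Q])
  also have "\<dots> = trace_over (ampliate N * ampliate Q)"
    using N Q by (simp add: trace_over_ampliate[of _ n] flip: ampliate_mult[of _ n n _ n])
  also have "\<dots> = (\<Sum>a<n. \<Sum>c<n. N $$ (c, a) *\<^sub>C ampliate Q $$ (a, c))"
    by (rule trace_over_ampliate_mult[OF N Q'])
  also have "\<dots> = partial_trace_left n p N (ampliate T) $$ (b, f)"
    using bf T by (simp add: partial_trace_left_def Q_def pair_index_less)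
  finally show "partial_trace_left n p N (kron (star_mat A) (1\<^sub>m p) * ampliate T * kron A (1\<^sub>m p)) $$ (b, f) =
      partial_trace_left n p N (ampliate T) $$ (b, f)" .
qed auto

lemma trace_mult_kron:
  fixes T X K :: "complex mat"
  assumes T: "T \<in> carrier_mat (n * p) (n * p)" and X: "X \<in> carrier_mat n n" and K: "K \<in> carrier_mat p p"
  shows "trace_mat (T * kron X K) =
      trace_mat (mat n n (\<lambda>(a, c). \<Sum>b<p. \<Sum>f<p. K $$ (f, b) * T $$ (a * p + b, c * p + f)) * X)" (is "_ = ?R")
    and "trace_mat (T * kron X K) =
      trace_mat (mat p p (\<lambda>(b, f). \<Sum>a<n. \<Sum>c<n. X $$ (c, a) * T $$ (a * p + b, c * p + f)) * K)" (is "_ = ?L")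
proof -
  let ?t = "\<lambda>a b c f. T $$ (a * p + b, c * p + f) * (X $$ (c, a) * K $$ (f, b))"
  have "trace_mat (T * kron X K) = (\<Sum>r<n*p. \<Sum>s<n*p. T $$ (r, s) * kron X K $$ (s, r))"
    by (rule trace_mat_mult[OF T kron_carrier(1)[OF X K]])
  also have "\<dots> = (\<Sum>a<n. \<Sum>b<p. \<Sum>c<n. \<Sum>f<p. ?t a b c f)"
    unfolding sum_pairs by (intro sum.cong refl) (simp add: kron_index[OF X K])
  finally have 1: "trace_mat (T * kron X K) = (\<Sum>a<n. \<Sum>b<p. \<Sum>c<n. \<Sum>f<p. ?t a b c f)" .
  also have "\<dots> = (\<Sum>a<n. \<Sum>c<n. \<Sum>b<p. \<Sum>f<p. ?t a b c f)"
    by (intro sum.cong refl sum.swap)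
  also have "\<dots> = ?R"
    by (subst trace_mat_mult[OF _ X]) (simp, intro sum.cong refl, simp add: sum_distrib_left mult_ac)
  finally show "trace_mat (T * kron X K) = ?R" .
  have "(\<Sum>a<n. \<Sum>b<p. \<Sum>c<n. \<Sum>f<p. ?t a b c f) = (\<Sum>a<n. \<Sum>b<p. \<Sum>f<p. \<Sum>c<n. ?t a b c f)"
    by (intro sum.cong refl sum.swap)
  also have "\<dots> = (\<Sum>b<p. \<Sum>a<n. \<Sum>f<p. \<Sum>c<n. ?t a b c f)" by (rule sum.swap)
  also have "\<dots> = (\<Sum>b<p. \<Sum>f<p. \<Sum>a<n. \<Sum>c<n. ?t a b c f)" by (intro sum.cong refl sum.swap)
  also have "\<dots> = ?L"
    by (subst trace_mat_mult[OF _ K]) (simp, intro sum.cong refl, simp add: sum_distrib_left mult_ac)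
  finally show "trace_mat (T * kron X K) = ?L" using 1 by simp
qed

definition commutant :: "nat \<Rightarrow> 'a::cstar_algebra mat \<Rightarrow> complex mat set" where
  "commutant n A = {T \<in> carrier_mat n n. ampliate T * A = A * ampliate T}"

definition traces_agree :: "nat \<Rightarrow> 'a::cstar_algebra mat \<Rightarrow> complex mat \<Rightarrow> complex mat \<Rightarrow> bool" where
  "traces_agree n A R N \<longleftrightarrow> (\<forall>T\<in>commutant n A. trace_mat (T * R) = trace_mat (T * N))"

text \<open>
  The factors are exchanged one at a time. An intertwiner \<open>T\<close> of \<open>A \<otimes> B\<close> satisfies
  \<open>T a = a (b T b\<^sup>*)\<close> for \<open>a = A \<otimes> 1\<close> and \<open>b = 1 \<otimes> B\<close>. The partial trace over the second factor
  with weight \<open>R'\<close> does not see the conjugation by \<open>b\<close>, so it maps \<open>T\<close> to an intertwiner \<open>S\<close> of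
  \<open>A\<close>; since \<open>Tr (T (X \<otimes> R')) = Tr (S X)\<close>, the weight \<open>R\<close> can be replaced by \<open>N\<close>. Afterwards the
  partial trace over the first factor, now with weight \<open>N\<close>, replaces \<open>R'\<close> by \<open>N'\<close>.
\<close>

lemma traces_agree_kron:
  fixes A B :: "'a::cstar_algebra mat"
  assumes A: "unitary_over n A" and B: "unitary_over p B"
    and mA: "modular_pair n A R N" and mB: "modular_pair p B R' N'"
    and tA: "traces_agree n A R N" and tB: "traces_agree p B R' N'"
  shows "traces_agree (n * p) (kron A B) (kron R R') (kron N N')"
  unfolding traces_agree_def
proof
  fix T assume "T \<in> commutant (n * p) (kron A B)"
  then have T: "T \<in> carrier_mat (n * p) (n * p)" and comm: "ampliate T * kron A B = kron A B * ampliate T"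
    by (auto simp: commutant_def)
  have c: "A \<in> carrier_mat n n" "B \<in> carrier_mat p p" "R \<in> carrier_mat n n" "N \<in> carrier_mat n n"
    "R' \<in> carrier_mat p p" "N' \<in> carrier_mat p p"
    using A B mA mB by (auto simp: unitary_over_def modular_pair_def inverse_pair_def)
  have cs: "star_mat A \<in> carrier_mat n n" "star_mat B \<in> carrier_mat p p" using c by auto
  have I: "1\<^sub>m p \<in> carrier_mat p p" "1\<^sub>m n \<in> carrier_mat n n" by auto
  define a a' b b' t :: "'a mat" where
    "a = kron A (1\<^sub>m p)" and "a' = kron (star_mat A) (1\<^sub>m p)" and
    "b = kron (1\<^sub>m n) B" and "b' = kron (1\<^sub>m n) (star_mat B)" and "t = ampliate T"
  have d: "a \<in> carrier_mat (n * p) (n * p)" "a' \<in> carrier_mat (n * p) (n * p)"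
    "b \<in> carrier_mat (n * p) (n * p)" "b' \<in> carrier_mat (n * p) (n * p)" "t \<in> carrier_mat (n * p) (n * p)"
    unfolding a_def a'_def b_def b'_def t_def using T by (auto intro!: kron_carrier(1) simp: c cs I)
  note dims = d[THEN carrier_matD(1)] d[THEN carrier_matD(2)]
  have "a * b = kron (A * 1\<^sub>m n) (1\<^sub>m p * B)"
    unfolding a_def b_def by (rule kron_mult[OF c(1) I(2) I(1) c(2)]) auto
  then have ab: "a * b = kron A B" using c by simp
  have "a' * a = kron (star_mat A * A) (1\<^sub>m p * 1\<^sub>m p)"
    unfolding a_def a'_def by (rule kron_mult[OF cs(1) c(1) I(1) I(1)]) auto
  then have aa: "a' * a = 1\<^sub>m (n * p)" using A by (simp add: unitary_over_def kron_one)
  have "b * b' = kron (1\<^sub>m n * 1\<^sub>m n) (B * star_mat B)"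
    unfolding b_def b'_def by (rule kron_mult[OF I(2) I(2) c(2) cs(2)]) auto
  then have bb: "b * b' = 1\<^sub>m (n * p)" using B by (simp add: unitary_over_def kron_one)
  have tab: "t * (a * b) = a * b * t" unfolding ab t_def by (rule comm)
  define S where "S = mat n n (\<lambda>(x, y). \<Sum>k<p. \<Sum>l<p. R' $$ (l, k) * T $$ (x * p + k, y * p + l))"
  define S' where "S' = mat p p (\<lambda>(k, l). \<Sum>x<n. \<Sum>y<n. N $$ (y, x) * T $$ (x * p + k, y * p + l))"
  have "t * a = t * a * (b * b')" by (simp add: bb dims mat_algebra)
  also have "\<dots> = t * (a * b) * b'" by (simp add: dims mat_algebra)
  also have "\<dots> = a * (b * t * b')" unfolding tab by (simp add: dims mat_algebra)
  finally have ta: "t * a = a * (b * t * b')" .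
  have "partial_trace_right n p R' t * A = partial_trace_right n p R' (t * a)"
    unfolding a_def by (rule partial_trace_right_bimodule(2)[OF c(1) d(5), symmetric])
  also have "\<dots> = A * partial_trace_right n p R' (b * t * b')"
    unfolding ta unfolding a_def
    by (rule partial_trace_right_bimodule(1)[OF c(1)]) (use d in simp)
  also have "partial_trace_right n p R' (b * t * b') = partial_trace_right n p R' t"
    unfolding b_def b'_def t_def by (rule partial_trace_right_invariant[OF c(2) mB T])
  finally have "S \<in> commutant n A"
    unfolding t_def partial_trace_right_ampliate[OF T] S_def commutant_def by simp
  then have 1: "trace_mat (S * R) = trace_mat (S * N)" using tA by (auto simp: traces_agree_def)
  have "b * t = a' * a * (b * t)" by (simp add: aa dims mat_algebra)
  also have "\<dots> = a' * (a * b * t)" by (simp add: dims mat_algebra)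
  also have "\<dots> = a' * t * a * b" unfolding tab[symmetric] by (simp add: dims mat_algebra)
  finally have bt: "b * t = a' * t * a * b" .
  have "B * partial_trace_left n p N t = partial_trace_left n p N (b * t)"
    unfolding b_def by (rule partial_trace_left_bimodule(1)[OF c(2) d(5), symmetric])
  also have "\<dots> = partial_trace_left n p N (a' * t * a) * B"
    unfolding bt unfolding b_def
    by (rule partial_trace_left_bimodule(2)[OF c(2)]) (use d in simp)
  also have "partial_trace_left n p N (a' * t * a) = partial_trace_left n p N t"
    unfolding a_def a'_def t_def by (rule partial_trace_left_invariant[OF c(1) mA T])
  finally have "S' \<in> commutant p B"
    unfolding t_def partial_trace_left_ampliate[OF T] S'_def commutant_def by simp
  then have 2: "trace_mat (S' * R') = trace_mat (S' * N')" using tB by (auto simp: traces_agree_def)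
  have "trace_mat (T * kron R R') = trace_mat (S * R)" unfolding S_def by (rule trace_mult_kron(1)[OF T c(3,5)])
  also have "\<dots> = trace_mat (S * N)" by (rule 1)
  also have "\<dots> = trace_mat (T * kron N R')" unfolding S_def by (rule trace_mult_kron(1)[OF T c(4,5), symmetric])
  also have "\<dots> = trace_mat (S' * R')" unfolding S'_def by (rule trace_mult_kron(2)[OF T c(4,5)])
  also have "\<dots> = trace_mat (S' * N')" by (rule 2)
  also have "\<dots> = trace_mat (T * kron N N')" unfolding S'_def by (rule trace_mult_kron(2)[OF T c(4,6), symmetric])
  finally show "trace_mat (T * kron R R') = trace_mat (T * kron N N')" .
qed


section \<open>Positive invertible matrices\<close>

text \<open>
  Positivity of a matrix in a form that passes at once to compressions and to tensor products.
\<close>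

definition gram :: "complex mat \<Rightarrow> bool" where
  "gram R \<longleftrightarrow> (\<exists>G. R = G * mat_adjoint G)"

lemma inverse_pair_sym: "inverse_pair n R N \<Longrightarrow> inverse_pair n N R"
  by (auto simp: inverse_pair_def)

lemma real_diag_mult:
  "real_diag n d * real_diag n d' = real_diag n (\<lambda>i. d i * d' i)"
  by (rule eq_matI) (simp_all add: mult_real_diag_index[of _ n n] del: index_mult_mat(1))

lemma real_diag_one: "(\<And>i. i < n \<Longrightarrow> d i = 1) \<Longrightarrow> real_diag n d = 1\<^sub>m n"
  by (rule eq_matI) auto

lemma unitary_conj_mult:
  assumes "unitary_mat n Q" "X \<in> carrier_mat n n" "Y \<in> carrier_mat n n"
  shows "(Q * X * mat_adjoint Q) * (Q * Y * mat_adjoint Q) = Q * (X * Y) * mat_adjoint Q"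
proof -
  have Q: "Q \<in> carrier_mat n n" and QQ: "mat_adjoint Q * Q = 1\<^sub>m n" using assms by (auto simp: unitary_mat_def)
  have "(Q * X * mat_adjoint Q) * (Q * Y * mat_adjoint Q) = Q * X * (mat_adjoint Q * Q) * (Y * mat_adjoint Q)"
    using Q assms(2,3) by (simp add: mat_mult_assoc)
  then show ?thesis using Q assms(2,3) by (simp add: QQ mat_algebra)
qed

lemma unitary_conj_pow:
  assumes "unitary_mat n Q"
  shows "(Q * real_diag n r * mat_adjoint Q) ^\<^sub>m s = Q * real_diag n (\<lambda>i. r i ^ s) * mat_adjoint Q"
proof (induction s)
  case 0
  have Q: "Q \<in> carrier_mat n n" and QQ: "Q * mat_adjoint Q = 1\<^sub>m n" using assms by (auto simp: unitary_mat_def)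
  then show ?case by (simp add: real_diag_one mat_mult_one)
next
  case (Suc s)
  then show ?case
    by (simp add: unitary_conj_mult[OF assms] real_diag_mult mult.commute)
qed

lemma trace_unitary_conj:
  assumes "unitary_mat n Q"
  shows "trace_mat (Q * real_diag n r * mat_adjoint Q) = of_real (\<Sum>i<n. r i)"
proof -
  have Q: "Q \<in> carrier_mat n n" and QQ: "mat_adjoint Q * Q = 1\<^sub>m n" using assms by (auto simp: unitary_mat_def)
  have "trace_mat (Q * real_diag n r * mat_adjoint Q) = trace_mat (mat_adjoint Q * (Q * real_diag n r))"
    using Q by (intro trace_mat_commute[of _ n n]) simp_all
  also have "mat_adjoint Q * (Q * real_diag n r) = real_diag n r"
    using Q QQ by (simp flip: mat_mult_assoc add: mat_mult_one)
  finally show ?thesis by (simp add: trace_mat_sum)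
qed

lemma mat_right_inverse_unique:
  fixes X Y N :: "'r::semiring_1 mat"
  assumes "X \<in> carrier_mat n n" "Y \<in> carrier_mat n n" "N \<in> carrier_mat n n" "N * X = 1\<^sub>m n" "X * Y = 1\<^sub>m n"
  shows "N = Y"
proof -
  have "N = N * (X * Y)" using assms(3) by (simp add: assms(5) mat_mult_one)
  also have "\<dots> = N * X * Y" using assms(1-3) by (simp add: mat_mult_assoc)
  also have "\<dots> = Y" unfolding assms(4) using assms(2) by (simp add: mat_mult_one)
  finally show ?thesis .
qed

lemma gram_diagonalization:
  assumes R: "inverse_pair n R N" and g: "gram R"
  obtains Q r where "unitary_mat n Q" "\<And>i. i < n \<Longrightarrow> r i > 0" "R = Q * real_diag n r * mat_adjoint Q"
    "N = Q * real_diag n (\<lambda>i. 1 / r i) * mat_adjoint Q"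
proof -
  have Rc: "R \<in> carrier_mat n n" and Nc: "N \<in> carrier_mat n n" and RN: "R * N = 1\<^sub>m n" "N * R = 1\<^sub>m n"
    using R by (auto simp: inverse_pair_def)
  obtain G where G: "R = G * mat_adjoint G" using g by (auto simp: gram_def)
  have "mat_adjoint R = R" by (simp add: G mat_adjoint_mult)
  then obtain Q r where Q: "unitary_mat n Q" and Rd: "R = Q * real_diag n r * mat_adjoint Q"
    using hermitian_diagonalization[OF Rc] by blast
  have Qc: "Q \<in> carrier_mat n n" and QQ: "mat_adjoint Q * Q = 1\<^sub>m n" "Q * mat_adjoint Q = 1\<^sub>m n"
    using Q by (auto simp: unitary_mat_def)
  have Gr: "dim_row G = n" using G Rc by auto
  have "mat_adjoint Q * R * Q = (mat_adjoint Q * Q) * real_diag n r * (mat_adjoint Q * Q)"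
    using Qc by (simp add: Rd mat_mult_assoc)
  then have D: "mat_adjoint Q * R * Q = real_diag n r" by (simp add: QQ mat_mult_one)
  have pos: "r i > 0" if i: "i < n" for i
  proof -
    have "mat_adjoint Q * R * Q = (mat_adjoint Q * G) * mat_adjoint (mat_adjoint Q * G)"
      using Qc Gr by (simp add: G mat_adjoint_mult mat_mult_assoc)
    then have "real_diag n r $$ (i, i) = of_real (\<Sum>k<dim_col (mat_adjoint Q * G). (cmod ((mat_adjoint Q * G) $$ (i, k)))\<^sup>2)"
      unfolding D[symmetric] using i Qc by (simp add: mult_adjoint_diag del: index_mult_mat(1))
    then have "r i = (\<Sum>k<dim_col (mat_adjoint Q * G). (cmod ((mat_adjoint Q * G) $$ (i, k)))\<^sup>2)"
      using i by (simp only: real_diag_index if_True simp_thms of_real_eq_iff)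
    then have "r i \<ge> 0" by (simp add: sum_nonneg del: index_mult_mat(1))
    moreover have "r i \<noteq> 0"
    proof
      assume 0: "r i = 0"
      have "mat_adjoint Q * N * Q \<in> carrier_mat n n" using Qc Nc by auto
      then have "(real_diag n r * (mat_adjoint Q * N * Q)) $$ (i, i) = 0"
        using real_diag_mult_index[of "mat_adjoint Q * N * Q" n n i i r] i 0 by simp
      moreover have "real_diag n r * (mat_adjoint Q * N * Q) = mat_adjoint Q * (R * ((Q * mat_adjoint Q) * N)) * Q"
        unfolding D[symmetric] using Qc Rc Nc by (simp add: mat_mult_assoc)
      then have "real_diag n r * (mat_adjoint Q * N * Q) = 1\<^sub>m n"
        using Qc Nc by (simp add: QQ RN mat_mult_one)
      ultimately show False using i by simp
    qed
    ultimately show ?thesis by simp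
  qed
  let ?X = "Q * real_diag n (\<lambda>i. 1 / r i) * mat_adjoint Q"
  have one: "real_diag n (\<lambda>i. r i * (1 / r i)) = 1\<^sub>m n"
  proof (rule real_diag_one)
    fix i assume "i < n"
    then show "r i * (1 / r i) = 1" using pos[of i] by simp
  qed
  have "R * ?X = 1\<^sub>m n"
    unfolding Rd unitary_conj_mult[OF Q real_diag_dim(3) real_diag_dim(3)] real_diag_mult one
    using Qc by (simp add: QQ mat_mult_one)
  moreover have "?X \<in> carrier_mat n n" using Qc by auto
  ultimately have "N = ?X" using mat_right_inverse_unique[OF Rc _ Nc RN(2)] by blast
  then show ?thesis using that Q pos Rd by blast
qed

lemma trace_gram_pow_nonneg:
  assumes "inverse_pair n R N" "gram R"
  shows "trace_mat (R ^\<^sub>m s) = of_real (Re (trace_mat (R ^\<^sub>m s)))" "0 \<le> Re (trace_mat (R ^\<^sub>m s))"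
proof -
  obtain Q r where Q: "unitary_mat n Q" "\<And>i. i < n \<Longrightarrow> r i > 0" "R = Q * real_diag n r * mat_adjoint Q"
    using gram_diagonalization[OF assms] by metis
  have "trace_mat (R ^\<^sub>m s) = of_real (\<Sum>i<n. r i ^ s)"
    unfolding Q(3) unitary_conj_pow[OF Q(1)] by (rule trace_unitary_conj[OF Q(1)])
  moreover have "0 \<le> (\<Sum>i<n. r i ^ s)"
    using Q(2) by (intro sum_nonneg) (simp add: less_imp_le)
  ultimately show "trace_mat (R ^\<^sub>m s) = of_real (Re (trace_mat (R ^\<^sub>m s)))" "0 \<le> Re (trace_mat (R ^\<^sub>m s))"
    by (simp_all only: Re_complex_of_real)
qed

text \<open>
  Let \<open>m\<close> be the largest eigenvalue of \<open>N\<close>. Every eigenvalue of \<open>R\<close> is at most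
  \<open>Tr R = Tr N \<le> n m\<close>, and \<open>m\<^sup>s \<le> Tr N\<^sup>s\<close>.
\<close>

lemma trace_pow_bound:
  assumes R: "inverse_pair n R N" and g: "gram R" and tr: "trace_mat R = trace_mat N"
  shows "Re (trace_mat (R ^\<^sub>m s)) \<le> real n ^ Suc s * Re (trace_mat (N ^\<^sub>m s))"
proof (cases "n = 0")
  case True
  then have "dim_row (R ^\<^sub>m s) = 0" using R by (cases s) (auto simp: inverse_pair_def)
  then show ?thesis using True by (simp add: trace_mat_sum)
next
  case False
  obtain Q r where Q: "unitary_mat n Q" and pos: "\<And>i. i < n \<Longrightarrow> r i > 0"
    and Rd: "R = Q * real_diag n r * mat_adjoint Q" and Nd: "N = Q * real_diag n (\<lambda>i. 1 / r i) * mat_adjoint Q"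
    using gram_diagonalization[OF R g] by metis
  have sums: "(\<Sum>i<n. r i) = (\<Sum>i<n. 1 / r i)"
    using tr unfolding Rd Nd trace_unitary_conj[OF Q] of_real_eq_iff .
  define m where "m = Max ((\<lambda>i. 1 / r i) ` {..<n})"
  have mge: "1 / r i \<le> m" if "i < n" for i unfolding m_def using that by (intro Max_ge) auto
  have "m \<in> (\<lambda>i. 1 / r i) ` {..<n}" unfolding m_def using False by (intro Max_in) auto
  then obtain j where j: "j < n" "m = 1 / r j" by auto
  have ms: "m ^ s \<le> (\<Sum>i<n. (1 / r i) ^ s)"
    unfolding j(2) using j(1) pos by (intro member_le_sum) (auto intro: less_imp_le)
  have "r i \<le> real n * m" if "i < n" for i
  proof -
    have "r i \<le> (\<Sum>i<n. r i)" using that pos by (intro member_le_sum) (auto intro: less_imp_le)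
    also have "\<dots> \<le> (\<Sum>i<n. m)" unfolding sums by (intro sum_mono mge) simp
    finally show ?thesis by simp
  qed
  then have "r i ^ s \<le> (real n * m) ^ s" if "i < n" for i
    using that pos by (intro power_mono) (auto intro: less_imp_le)
  then have "(\<Sum>i<n. r i ^ s) \<le> (\<Sum>i<n. (real n * m) ^ s)" by (intro sum_mono) simp
  also have "\<dots> = real n ^ Suc s * m ^ s" by (simp add: power_mult_distrib)
  also have "\<dots> \<le> real n ^ Suc s * (\<Sum>i<n. (1 / r i) ^ s)" by (intro mult_left_mono ms) simp
  finally show ?thesis
    unfolding Rd Nd unitary_conj_pow[OF Q] trace_unitary_conj[OF Q] by simp
qed

text \<open>A positive eigenvalue is determined by its square.\<close>

lemma commutes_of_square_commutes:
  assumes R: "inverse_pair n R N" and g: "gram R" and S: "S \<in> carrier_mat n n"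
    and c: "R * R * S = S * (R * R)"
  shows "R * S = S * R"
proof -
  obtain Q r where Q: "unitary_mat n Q" and pos: "\<And>i. i < n \<Longrightarrow> r i > 0"
    and Rd: "R = Q * real_diag n r * mat_adjoint Q"
    using gram_diagonalization[OF R g] by metis
  have Qc: "Q \<in> carrier_mat n n" and QQ: "mat_adjoint Q * Q = 1\<^sub>m n" "Q * mat_adjoint Q = 1\<^sub>m n"
    using Q by (auto simp: unitary_mat_def)
  define X where "X = mat_adjoint Q * S * Q"
  have X: "X \<in> carrier_mat n n" using Qc S by (auto simp: X_def)
  have "Q * X * mat_adjoint Q = (Q * mat_adjoint Q) * S * (Q * mat_adjoint Q)"
    using Qc S by (simp add: X_def mat_mult_assoc)
  then have Sd: "S = Q * X * mat_adjoint Q" using S by (simp add: QQ mat_mult_one)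
  let ?D = "real_diag n r" and ?D2 = "real_diag n (\<lambda>i. r i * r i)"
  have D: "?D \<in> carrier_mat n n" "?D2 \<in> carrier_mat n n" by simp_all
  have RR: "R * R = Q * ?D2 * mat_adjoint Q"
    unfolding Rd unitary_conj_mult[OF Q D(1) D(1)] real_diag_mult ..
  have "Q * (?D2 * X) * mat_adjoint Q = Q * (X * ?D2) * mat_adjoint Q"
    using c unfolding RR by (subst (asm) (1 2) Sd) (simp only: unitary_conj_mult[OF Q D(2) X] unitary_conj_mult[OF Q X D(2)])
  then have "mat_adjoint Q * (Q * (?D2 * X) * mat_adjoint Q) * Q = mat_adjoint Q * (Q * (X * ?D2) * mat_adjoint Q) * Q"
    by simp
  moreover have "mat_adjoint Q * (Q * M * mat_adjoint Q) * Q = M" if "M \<in> carrier_mat n n" for M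
  proof -
    have "mat_adjoint Q * (Q * M * mat_adjoint Q) * Q = (mat_adjoint Q * Q) * M * (mat_adjoint Q * Q)"
      using Qc that by (simp add: mat_mult_assoc)
    then show ?thesis using that by (simp add: QQ mat_mult_one)
  qed
  ultimately have e: "?D2 * X = X * ?D2"
    using mult_carrier_mat[OF D(2) X] mult_carrier_mat[OF X D(2)] by simp
  have "?D * X = X * ?D"
  proof (rule eq_matI)
    fix i j assume "i < dim_row (X * ?D)" "j < dim_col (X * ?D)"
    then have ij: "i < n" "j < n" using X by auto
    have "of_real (r i * r i) * X $$ (i, j) = X $$ (i, j) * of_real (r j * r j)"
      using arg_cong[OF e, of "\<lambda>M. M $$ (i, j)"]
      unfolding real_diag_mult_index[OF X ij] mult_real_diag_index[OF X ij] .
    then have "X $$ (i, j) = 0 \<or> complex_of_real (r i * r i) = of_real (r j * r j)" by auto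
    then have "X $$ (i, j) = 0 \<or> (r i)\<^sup>2 = (r j)\<^sup>2" unfolding of_real_eq_iff power2_eq_square .
    then have "X $$ (i, j) = 0 \<or> r i = r j" using pos[OF ij(1)] pos[OF ij(2)] by (auto simp: power2_eq_iff)
    then show "(?D * X) $$ (i, j) = (X * ?D) $$ (i, j)"
      unfolding real_diag_mult_index[OF X ij] mult_real_diag_index[OF X ij] by auto
  qed (use X in auto)
  then show ?thesis
    by (subst (1 2) Sd) (simp only: Rd unitary_conj_mult[OF Q D(1) X] unitary_conj_mult[OF Q X D(1)])
qed


section \<open>The modular operator commutes with all intertwiners\<close>

lemma commutantD: "T \<in> commutant n A \<Longrightarrow> T \<in> carrier_mat n n" "T \<in> commutant n A \<Longrightarrow> ampliate T * A = A * ampliate T"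
  by (auto simp: commutant_def)

lemma commutant_one: "A \<in> carrier_mat n n \<Longrightarrow> 1\<^sub>m n \<in> commutant n A"
  by (simp add: commutant_def mat_mult_one)

lemma commutant_minus:
  "A \<in> carrier_mat n n \<Longrightarrow> S \<in> commutant n A \<Longrightarrow> T \<in> commutant n A \<Longrightarrow> S - T \<in> commutant n A"
  unfolding commutant_def by (auto simp: ampliate_minus[of _ n n] mat_algebra)

lemma commutant_mult:
  assumes "A \<in> carrier_mat n n" "S \<in> commutant n A" "T \<in> commutant n A"
  shows "S * T \<in> commutant n A"
proof -
  have c: "S \<in> carrier_mat n n" "T \<in> carrier_mat n n" using assms by (auto simp: commutant_def)
  have "ampliate (S * T) * A = ampliate S * (ampliate T * A)"
    using c assms(1) by (simp add: ampliate_mult[of _ n n _ n] mat_mult_assoc)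
  also have "\<dots> = ampliate S * A * ampliate T"
    using c assms(1) by (simp add: commutantD(2)[OF assms(3)] mat_mult_assoc)
  also have "\<dots> = A * ampliate (S * T)"
    using c assms(1) by (simp add: commutantD(2)[OF assms(2)] ampliate_mult[of _ n n _ n] mat_mult_assoc)
  finally show ?thesis using c by (auto simp: commutant_def)
qed

lemma intertwiner_star:
  assumes U: "unitary_over n U" and V: "unitary_over m V" and T: "T \<in> carrier_mat m n"
    and TU: "ampliate T * U = V * ampliate T"
  shows "ampliate (mat_adjoint T) * V = U * ampliate (mat_adjoint T)"
proof -
  have c: "U \<in> carrier_mat n n" "V \<in> carrier_mat m m" using U V by (auto simp: unitary_over_def)
  let ?T = "ampliate (mat_adjoint T)"
  have s: "star_mat U * ?T = ?T * star_mat V"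
    using arg_cong[OF TU, of star_mat] c T
    by (simp add: star_mat_mult[of _ m n _ n] star_mat_mult[of _ m m _ n] star_mat_ampliate)
  have "?T * V = U * star_mat U * ?T * V" using U c T by (simp add: unitary_over_def mat_mult_one)
  also have "\<dots> = U * (star_mat U * ?T) * V" using c T by (simp add: mat_mult_assoc)
  also have "\<dots> = U * ?T * (star_mat V * V)" unfolding s using c T by (simp add: mat_mult_assoc)
  also have "\<dots> = U * ?T" using V c T by (simp add: unitary_over_def mat_mult_one)
  finally show ?thesis .
qed

lemma commutant_adjoint:
  "unitary_over n A \<Longrightarrow> T \<in> commutant n A \<Longrightarrow> mat_adjoint T \<in> commutant n A"
  using intertwiner_star[of n A n A T] by (auto simp: commutant_def)

text \<open>
  A matrix commuting with \<open>A\<close> also commutes with \<open>A\<^sup>*\<close>. Its transpose then commutes with the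
  contragredient, hence with the inverse of the contragredient, and transposing back shows that
  the matrix commutes with \<open>R A N\<close>.
\<close>

lemma commutant_modular_conj:
  fixes A :: "'a::cstar_algebra mat"
  assumes A: "unitary_over n A" and m: "modular_pair n A R N" and S: "S \<in> commutant n A"
  shows "N * S * R \<in> commutant n A"
proof -
  have c: "A \<in> carrier_mat n n" "R \<in> carrier_mat n n" "N \<in> carrier_mat n n" "S \<in> carrier_mat n n"
    and RN: "R * N = 1\<^sub>m n" "N * R = 1\<^sub>m n"
    using A m S by (auto simp: unitary_over_def modular_pair_def inverse_pair_def commutant_def)
  have aa: "star_mat A * A = 1\<^sub>m n" "A * star_mat A = 1\<^sub>m n" using A by (auto simp: unitary_over_def)
  let ?s = "ampliate S :: 'a mat" and ?r = "ampliate R :: 'a mat" and ?n = "ampliate N :: 'a mat"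
  define W where "W = ?r * A * ?n"
  have W: "W \<in> carrier_mat n n" using c by (simp add: W_def)
  have rn: "?r * ?n = 1\<^sub>m n" "?n * ?r = 1\<^sub>m n"
    using RN by (simp_all flip: ampliate_mult[OF c(2,3)] ampliate_mult[OF c(3,2)])
  have "?s * star_mat A = star_mat A * A * ?s * star_mat A" unfolding aa using c by (simp add: mat_mult_one)
  also have "\<dots> = star_mat A * (?s * A) * star_mat A"
    unfolding commutantD(2)[OF S] using c by (simp add: mat_mult_assoc)
  also have "\<dots> = star_mat A * ?s * (A * star_mat A)" using c by (simp add: mat_mult_assoc)
  also have "\<dots> = star_mat A * ?s" unfolding aa using c by (simp add: mat_mult_one)
  finally have sA: "?s * star_mat A = star_mat A * ?s" .
  define C D t where "C = transpose_mat (star_mat A)" and "D = transpose_mat W" and "t = transpose_mat ?s"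
  have cc: "C \<in> carrier_mat n n" "D \<in> carrier_mat n n" "t \<in> carrier_mat n n" using c W by (simp_all add: C_def D_def t_def)
  have CD: "C * D = 1\<^sub>m n" "D * C = 1\<^sub>m n" using m by (auto simp: modular_pair_def C_def D_def W_def)
  have A': "star_mat A \<in> carrier_mat n n" using c by simp
  have Ct: "C * t = t * C"
    using arg_cong[OF sA, of transpose_mat]
    unfolding transpose_ampliate_mult[OF c(4) A'] transpose_mult_ampliate[OF A' c(4)] C_def t_def .
  have "D * t = D * t * (C * D)" unfolding CD using cc by (simp add: mat_mult_one)
  also have "\<dots> = D * (C * t) * D" unfolding Ct using cc by (simp add: mat_mult_assoc)
  also have "\<dots> = D * C * (t * D)" using cc by (simp add: mat_mult_assoc)
  also have "\<dots> = t * D" unfolding CD using cc by (simp add: mat_mult_one)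
  finally have "transpose_mat (?s * W) = transpose_mat (W * ?s)"
    unfolding transpose_ampliate_mult[OF c(4) W] transpose_mult_ampliate[OF W c(4)] D_def t_def .
  then have sW: "?s * W = W * ?s" by (metis transpose_transpose)
  have nsr: "ampliate (N * S * R) = ?n * ?s * ?r"
    using c by (simp add: ampliate_mult[of _ n n _ n])
  have "?n * ?s * ?r * A = ?n * (?s * W) * ?r"
  proof -
    have "?n * (?s * W) * ?r = ?n * ?s * ?r * A * (?n * ?r)" unfolding W_def using c by (simp add: mat_mult_assoc)
    then show ?thesis unfolding rn using c by (simp add: mat_mult_one)
  qed
  also have "\<dots> = ?n * (W * ?s) * ?r" by (simp only: sW)
  also have "\<dots> = (?n * ?r) * A * (?n * ?s * ?r)" unfolding W_def using c by (simp add: mat_mult_assoc)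
  also have "\<dots> = A * (?n * ?s * ?r)" unfolding rn using c by (simp add: mat_mult_one)
  finally show ?thesis unfolding commutant_def mem_Collect_eq nsr using c by simp
qed

text \<open>
  The form \<open>X \<mapsto> Tr (X R) = Tr (X N)\<close> on the commutant is faithful. For \<open>T\<close> in the commutant,
  \<open>Tr (N S R T R) = Tr (T S R) = Tr (T S N) = Tr (R S N T N) = Tr (R S N T R)\<close>, so
  \<open>W = N S R - R S N\<close> satisfies \<open>Tr (W T R) = 0\<close>. The choice \<open>T = W\<^sup>*\<close> gives \<open>W = 0\<close>, which means
  that \<open>R\<^sup>2\<close> commutes with \<open>S\<close>.
\<close>

lemma modular_commutes:
  fixes A :: "'a::cstar_algebra mat"
  assumes A: "unitary_over n A" and m: "modular_pair n A R N" and g: "gram R" and gN: "gram N"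
    and tr: "traces_agree n A R N" and S: "S \<in> commutant n A"
  shows "R * S = S * R"
proof -
  have p: "inverse_pair n R N" using m by (auto simp: modular_pair_def)
  have c: "A \<in> carrier_mat n n" "R \<in> carrier_mat n n" "N \<in> carrier_mat n n" "S \<in> carrier_mat n n"
    and RN: "R * N = 1\<^sub>m n" "N * R = 1\<^sub>m n"
    using A m S by (auto simp: unitary_over_def modular_pair_def inverse_pair_def commutant_def)
  obtain G where G: "R = G * mat_adjoint G" using g by (auto simp: gram_def)
  obtain H where H: "N = H * mat_adjoint H" using gN by (auto simp: gram_def)
  have aR: "mat_adjoint R = R" and aN: "mat_adjoint N = N" by (simp_all add: G H mat_adjoint_mult)
  have Gr: "dim_row G = n" using G c by auto
  have conj1: "N * X * R \<in> commutant n A" if "X \<in> commutant n A" for X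
    by (rule commutant_modular_conj[OF A m that])
  have conj2: "R * X * N \<in> commutant n A" if X: "X \<in> commutant n A" for X
  proof -
    have "mat_adjoint (N * mat_adjoint X * R) \<in> commutant n A"
      by (intro commutant_adjoint[OF A] conj1 X)
    moreover have "mat_adjoint (N * mat_adjoint X * R) = R * X * N"
      using c commutantD(1)[OF X] by (simp add: mat_adjoint_mult aR aN mat_mult_assoc)
    ultimately show ?thesis by simp
  qed
  have agree: "trace_mat (X * R) = trace_mat (X * N)" if "X \<in> commutant n A" for X
    using tr that by (auto simp: traces_agree_def)
  define W where "W = N * S * R - R * S * N"
  have W: "W \<in> commutant n A"
    unfolding W_def by (intro commutant_minus[OF c(1)] conj1 conj2 S)
  define T where "T = mat_adjoint W"
  have T: "T \<in> commutant n A" unfolding T_def by (rule commutant_adjoint[OF A W])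
  have Wc: "W \<in> carrier_mat n n" and Tc: "T \<in> carrier_mat n n" using W T by (auto dest: commutantD)
  have k: "N * S * R \<in> carrier_mat n n" "R * S * N \<in> carrier_mat n n" using conj1[OF S] conj2[OF S] by (auto dest: commutantD)
  have "trace_mat (N * S * R * T * R) = trace_mat (T * R * (N * S * R))"
    using trace_mat_commute[OF k(1) mult_carrier_mat[OF Tc c(2)]] c Tc by (simp add: mat_mult_assoc)
  also have "T * R * (N * S * R) = T * (R * N) * S * R" using c Tc by (simp add: mat_mult_assoc)
  also have "\<dots> = T * S * R" unfolding RN using Tc by (simp add: mat_mult_one)
  also have "trace_mat \<dots> = trace_mat (T * S * N)"
    by (intro agree commutant_mult[OF c(1)] T S)
  also have "T * S * N = T * (N * R) * S * N" unfolding RN using Tc by (simp add: mat_mult_one)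
  also have "\<dots> = T * N * (R * S * N)" using c Tc by (simp add: mat_mult_assoc)
  also have "trace_mat \<dots> = trace_mat (R * S * N * T * N)"
    using trace_mat_commute[OF k(2) mult_carrier_mat[OF Tc c(3)]] c Tc by (simp add: mat_mult_assoc)
  also have "\<dots> = trace_mat (R * S * N * T * R)"
    by (intro agree[symmetric] commutant_mult[OF c(1)] T conj2 S)
  finally have eq: "trace_mat (N * S * R * T * R) = trace_mat (R * S * N * T * R)" .
  have WT: "W * T * R = N * S * R * T * R - R * S * N * T * R"
    unfolding W_def using c Tc by (simp add: mat_algebra)
  have "trace_mat (W * T * R) = trace_mat (N * S * R * T * R) - trace_mat (R * S * N * T * R)"
    unfolding WT using c Tc by (intro trace_mat_minus[of _ n]) auto
  then have "trace_mat (W * T * R) = 0" unfolding eq by simp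
  moreover have "trace_mat (W * T * R) = trace_mat (mat_adjoint G * W * mat_adjoint (mat_adjoint G * W))"
  proof -
    have "W * T * R = (W * T * G) * mat_adjoint G" unfolding G using Wc Tc Gr by (simp add: mat_mult_assoc)
    also have "trace_mat \<dots> = trace_mat (mat_adjoint G * (W * T * G))"
      using Wc Tc Gr by (intro trace_mat_commute[of _ n "dim_col G"]) (auto intro!: carrier_matI)
    also have "mat_adjoint G * (W * T * G) = mat_adjoint G * W * mat_adjoint (mat_adjoint G * W)"
      unfolding T_def using Wc Gr by (simp add: mat_adjoint_mult mat_mult_assoc)
    finally show ?thesis .
  qed
  ultimately have "mat_adjoint G * W = 0\<^sub>m (dim_col G) n"
    using trace_mult_adjoint_eq_0[of "mat_adjoint G * W"] Wc by simp
  then have "G * (mat_adjoint G * W) = 0\<^sub>m n n" using Gr by (simp add: mat_mult_zero)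
  then have "N * (R * W) = 0\<^sub>m n n" unfolding G using Wc Gr c by (simp add: mat_mult_assoc mat_mult_zero)
  then have "(N * R) * W = 0\<^sub>m n n" using c Wc by (simp add: mat_mult_assoc)
  then have W0: "W = 0\<^sub>m n n" unfolding RN using Wc by (simp add: mat_mult_one)
  have "N * S * R = R * S * N"
  proof (rule eq_matI)
    fix i j assume "i < dim_row (R * S * N)" "j < dim_col (R * S * N)"
    then have ij: "i < n" "j < n" using c by auto
    then have "W $$ (i, j) = (N * S * R) $$ (i, j) - (R * S * N) $$ (i, j)" unfolding W_def using c by simp
    then show "(N * S * R) $$ (i, j) = (R * S * N) $$ (i, j)" using W0 ij by simp
  qed (use c in auto)
  then have "R * (N * S * R) * R = R * (R * S * N) * R" by simp
  then have "(R * N) * S * (R * R) = R * R * S * (N * R)" using c by (simp add: mat_mult_assoc)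
  then have "R * R * S = S * (R * R)" unfolding RN using c by (simp add: mat_mult_one)
  then show ?thesis by (rule commutes_of_square_commutes[OF p g c(4)])
qed


section \<open>Splitting along an invariant projection\<close>

text \<open>The columns of \<open>P\<close> are orthonormal eigenvectors of \<open>e\<close> for the eigenvalue \<open>1\<close>.\<close>

lemma projection_isometry:
  assumes e: "e \<in> carrier_mat n n" "mat_adjoint e = e" "e * e = e"
  obtains k P where "P \<in> carrier_mat n k" "mat_adjoint P * P = 1\<^sub>m k" "P * mat_adjoint P = (e :: complex mat)"
proof -
  obtain Q d where Q: "unitary_mat n Q" and ed: "e = Q * real_diag n d * mat_adjoint Q"
    using hermitian_diagonalization[OF e(1,2)] by blast
  have Qc: "Q \<in> carrier_mat n n" and QQ: "mat_adjoint Q * Q = 1\<^sub>m n" using Q by (auto simp: unitary_mat_def)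
  have Qc': "mat_adjoint Q \<in> carrier_mat n n" using Qc by simp
  have D: "mat_adjoint Q * (Q * real_diag n x * mat_adjoint Q) * Q = real_diag n x" for x
  proof -
    have "mat_adjoint Q * (Q * real_diag n x * mat_adjoint Q) * Q = (mat_adjoint Q * Q) * real_diag n x * (mat_adjoint Q * Q)"
      using Qc by (simp add: mat_mult_assoc)
    then show ?thesis by (simp add: QQ mat_mult_one)
  qed
  have "Q * real_diag n (\<lambda>i. d i * d i) * mat_adjoint Q = Q * real_diag n d * mat_adjoint Q"
    using e(3) unfolding ed unitary_conj_mult[OF Q real_diag_dim(3) real_diag_dim(3)] real_diag_mult .
  from arg_cong[OF this, of "\<lambda>M. mat_adjoint Q * M * Q"]
  have dd: "real_diag n (\<lambda>i. d i * d i) = real_diag n d" by (simp only: D)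
  have d01: "d i = 0 \<or> d i = 1" if "i < n" for i
  proof -
    have "complex_of_real (d i * d i) = of_real (d i)"
      using arg_cong[OF dd, of "\<lambda>M. M $$ (i, i)"] that by simp
    then have "d i * d i = d i" by (simp only: of_real_eq_iff)
    then show ?thesis by auto
  qed
  define xs where "xs = filter (\<lambda>i. d i = 1) [0..<n]"
  define k where "k = length xs"
  have xs: "distinct xs" "set xs = {i. i < n \<and> d i = 1}" by (auto simp: xs_def)
  have xsn: "xs ! j < n" if "j < k" for j using xs(2) nth_mem[of j xs] that by (auto simp: k_def)
  define P where "P = mat n k (\<lambda>(i, j). Q $$ (i, xs ! j))"
  have P: "P \<in> carrier_mat n k" by (simp add: P_def)
  have P': "mat_adjoint P \<in> carrier_mat k n" using P by simp
  have "mat_adjoint P * P = 1\<^sub>m k"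
  proof (rule eq_matI)
    fix i j assume "i < dim_row (1\<^sub>m k :: complex mat)" "j < dim_col (1\<^sub>m k :: complex mat)"
    then have ij: "i < k" "j < k" by auto
    have "(mat_adjoint P * P) $$ (i, j) = (\<Sum>l<n. mat_adjoint P $$ (i, l) * P $$ (l, j))"
      by (rule mult_mat_index'[OF P' P ij])
    also have "\<dots> = (\<Sum>l<n. mat_adjoint Q $$ (xs ! i, l) * Q $$ (l, xs ! j))"
      using ij Qc xsn by (intro sum.cong refl) (simp add: P_def)
    also have "\<dots> = (1\<^sub>m n :: complex mat) $$ (xs ! i, xs ! j)"
      unfolding QQ[symmetric] using xsn ij by (intro mult_mat_index'[symmetric, OF Qc' Qc]) auto
    finally show "(mat_adjoint P * P) $$ (i, j) = (1\<^sub>m k) $$ (i, j)"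
      using ij xsn xs(1) by (simp add: nth_eq_iff_index_eq k_def)
  qed (use P in auto)
  moreover have "P * mat_adjoint P = e"
  proof (rule eq_matI)
    fix i j assume "i < dim_row e" "j < dim_col e"
    then have ij: "i < n" "j < n" using e by auto
    have "(P * mat_adjoint P) $$ (i, j) = (\<Sum>l<k. P $$ (i, l) * mat_adjoint P $$ (l, j))"
      by (rule mult_mat_index'[OF P P' ij])
    also have "\<dots> = (\<Sum>l<k. Q $$ (i, xs ! l) * cnj (Q $$ (j, xs ! l)))"
      using ij by (intro sum.cong refl) (simp add: P_def)
    also have "\<dots> = (\<Sum>l\<in>set xs. Q $$ (i, l) * cnj (Q $$ (j, l)))"
      using sum.reindex_bij_betw[OF bij_betw_nth[OF xs(1) refl refl], of "\<lambda>l. Q $$ (i, l) * cnj (Q $$ (j, l))"]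
      by (simp add: k_def)
    also have "\<dots> = (\<Sum>l<n. (Q * real_diag n d) $$ (i, l) * mat_adjoint Q $$ (l, j))"
      unfolding xs(2)
    proof (rule sum.mono_neutral_cong_left)
      show "\<forall>l\<in>{..<n} - {i. i < n \<and> d i = 1}. (Q * real_diag n d) $$ (i, l) * mat_adjoint Q $$ (l, j) = 0"
        using ij d01 by (auto simp: mult_real_diag_index[OF Qc] simp del: index_mult_mat(1))
      fix l assume "l \<in> {i. i < n \<and> d i = 1}"
      then show "Q $$ (i, l) * cnj (Q $$ (j, l)) = (Q * real_diag n d) $$ (i, l) * mat_adjoint Q $$ (l, j)"
        using ij Qc by (simp add: mult_real_diag_index[OF Qc] del: index_mult_mat(1))
    qed auto
    also have "\<dots> = e $$ (i, j)"
      unfolding ed using ij Qc' mult_carrier_mat[OF Qc real_diag_dim(3)[of n d]]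
      by (intro mult_mat_index'[symmetric]) auto
    finally show "(P * mat_adjoint P) $$ (i, j) = e $$ (i, j)" .
  qed (use P e in auto)
  ultimately show ?thesis using that P by blast
qed

text \<open>
  Subspaces are represented by their orthogonal projections: the orthogonal complement of an
  invariant subspace is invariant.
\<close>

definition completely_reducible :: "nat \<Rightarrow> 'a::cstar_algebra mat \<Rightarrow> bool" where
  "completely_reducible n A \<longleftrightarrow> (\<forall>e\<in>carrier_mat n n. mat_adjoint e = e \<and> e * e = e \<and>
     ampliate e * A * ampliate e = A * ampliate e \<longrightarrow> ampliate e * A = A * ampliate e)"

text \<open>
  The properties of the modular operator on which the growth estimate rests; subrepresentations
  inherit them.
\<close>

definition balanced :: "nat \<Rightarrow> 'a::cstar_algebra mat \<Rightarrow> complex mat \<Rightarrow> complex mat \<Rightarrow> bool" where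
  "balanced n A R N \<longleftrightarrow> inverse_pair n R N \<and> gram R \<and> gram N \<and>
     (\<forall>T\<in>commutant n A. R * T = T * R) \<and> traces_agree n A R N"

lemma balanced_sym:
  assumes "balanced n A R N" shows "balanced n A N R"
proof -
  have c: "R \<in> carrier_mat n n" "N \<in> carrier_mat n n" and RN: "R * N = 1\<^sub>m n" "N * R = 1\<^sub>m n"
    using assms by (auto simp: balanced_def inverse_pair_def)
  have "N * T = T * N" if T: "T \<in> commutant n A" for T
  proof -
    have Tc: "T \<in> carrier_mat n n" using T by (rule commutantD)
    have "N * T = N * T * (R * N)" unfolding RN using c Tc by (simp add: mat_mult_one)
    also have "\<dots> = N * (T * R) * N" using c Tc by (simp add: mat_mult_assoc)
    also have "T * R = R * T" using assms T by (auto simp: balanced_def)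
    also have "N * (R * T) * N = N * R * (T * N)" using c Tc by (simp add: mat_mult_assoc)
    also have "\<dots> = T * N" unfolding RN using c Tc by (simp add: mat_mult_one)
    finally show ?thesis .
  qed
  then show ?thesis using assms by (auto simp: balanced_def traces_agree_def intro: inverse_pair_sym)
qed

definition compress :: "complex mat \<Rightarrow> 'a::cstar_algebra mat \<Rightarrow> 'a mat" where
  "compress P A = ampliate (mat_adjoint P) * A * ampliate P"

text \<open>
  The isometry \<open>P\<close> identifies \<open>\<complex>\<^sup>k\<close> with a subspace that reduces \<open>A\<close>, and \<open>compress P A\<close> is the
  corresponding subrepresentation.
\<close>

locale reducing_isometry =
  fixes n k :: nat and P :: "complex mat" and A :: "'a::cstar_algebra mat"
  assumes P: "P \<in> carrier_mat n k" and iso: "mat_adjoint P * P = 1\<^sub>m k"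
    and A: "unitary_over n A" and reduces: "P * mat_adjoint P \<in> commutant n A"
begin

lemma carriers: "A \<in> carrier_mat n n" "mat_adjoint P \<in> carrier_mat k n" "compress P A \<in> carrier_mat k k"
  using A P by (auto simp: unitary_over_def compress_def)

lemma dims [simp]: "dim_row P = n" "dim_col P = k" "dim_row A = n" "dim_col A = n"
  "dim_row (compress P A) = k" "dim_col (compress P A) = k"
  using P carriers by auto

lemma ampliate_iso: "ampliate (mat_adjoint P) * ampliate P = (1\<^sub>m k :: 'a mat)"
  using iso by (simp flip: ampliate_mult[OF carriers(2) P])

lemma reduces': "ampliate P * ampliate (mat_adjoint P) * A = A * (ampliate P * ampliate (mat_adjoint P))"
  using commutantD(2)[OF reduces] by (simp only: ampliate_mult[OF P carriers(2)])

lemma intertwines: "A * ampliate P = ampliate P * compress P A"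
proof -
  have "ampliate P * compress P A = ampliate P * ampliate (mat_adjoint P) * A * ampliate P"
    by (simp add: compress_def mat_mult_assoc)
  also have "\<dots> = A * ampliate P * (ampliate (mat_adjoint P) * ampliate P)"
    unfolding reduces' by (simp add: mat_mult_assoc)
  also have "\<dots> = A * ampliate P" unfolding ampliate_iso by (simp add: mat_mult_one)
  finally show ?thesis ..
qed

lemma intertwines': "ampliate (mat_adjoint P) * A = compress P A * ampliate (mat_adjoint P)"
proof -
  have "compress P A * ampliate (mat_adjoint P) = ampliate (mat_adjoint P) * (A * (ampliate P * ampliate (mat_adjoint P)))"
    by (simp add: compress_def mat_mult_assoc)
  also have "\<dots> = (ampliate (mat_adjoint P) * ampliate P) * (ampliate (mat_adjoint P) * A)"
    unfolding reduces'[symmetric] by (simp add: mat_mult_assoc)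
  also have "\<dots> = ampliate (mat_adjoint P) * A" unfolding ampliate_iso by (simp add: mat_mult_one)
  finally show ?thesis ..
qed

lemma unitary_compress: "unitary_over k (compress P A)"
proof -
  let ?V = "compress P A" and ?p = "ampliate P :: 'a mat" and ?q = "ampliate (mat_adjoint P) :: 'a mat"
  have c: "?p \<in> carrier_mat n k" "?q \<in> carrier_mat k n" using P by auto
  have st: "star_mat ?p = ?q" "star_mat ?q = ?p" by (simp_all add: star_mat_ampliate)
  have 1: "star_mat A * ?p = ?p * star_mat ?V"
    using arg_cong[OF intertwines', of star_mat] c carriers
    by (simp add: star_mat_mult[of ?q k n A n] star_mat_mult[of ?V k k ?q n] st)
  have 2: "?q * star_mat A = star_mat ?V * ?q"
    using arg_cong[OF intertwines, of star_mat] c carriers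
    by (simp add: star_mat_mult[of A n n ?p k] star_mat_mult[of ?p n k ?V k] st)
  have "?V * star_mat ?V = ?q * A * (?p * star_mat ?V)" by (simp add: compress_def mat_mult_assoc)
  also have "\<dots> = ?q * (A * star_mat A) * ?p" unfolding 1[symmetric] by (simp add: mat_mult_assoc)
  finally have V1: "?V * star_mat ?V = 1\<^sub>m k" using A by (simp add: unitary_over_def ampliate_iso mat_mult_one)
  have "star_mat ?V * ?V = star_mat ?V * ?q * (A * ?p)" by (simp add: compress_def mat_mult_assoc)
  also have "\<dots> = ?q * (star_mat A * A) * ?p" unfolding 2[symmetric] by (simp add: mat_mult_assoc)
  finally have "star_mat ?V * ?V = 1\<^sub>m k" using A by (simp add: unitary_over_def ampliate_iso mat_mult_one)
  then show ?thesis using V1 carriers by (simp add: unitary_over_def)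
qed

lemma extend_carrier: "T \<in> carrier_mat k k \<Longrightarrow> P * T * mat_adjoint P \<in> carrier_mat n n"
  by (rule mult_carrier_mat[OF mult_carrier_mat[OF P] carriers(2)])

lemma restrict_carrier: "R \<in> carrier_mat n n \<Longrightarrow> mat_adjoint P * R * P \<in> carrier_mat k k"
  by (rule mult_carrier_mat[OF mult_carrier_mat[OF carriers(2)] P])

lemma ampliate_extend:
  assumes "T \<in> carrier_mat k k"
  shows "ampliate (P * T * mat_adjoint P) = ampliate P * ampliate T * (ampliate (mat_adjoint P) :: 'a mat)"
  by (simp only: ampliate_mult[OF mult_carrier_mat[OF P assms] carriers(2)] ampliate_mult[OF P assms])

text \<open>
  Intertwiners of the subrepresentation, extended by zero, are intertwiners of \<open>A\<close>; in this way
  properties of \<open>A\<close> are inherited.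
\<close>

lemma extend_commutant:
  assumes T: "T \<in> commutant k (compress P A)"
  shows "P * T * mat_adjoint P \<in> commutant n A"
proof -
  let ?V = "compress P A" and ?p = "ampliate P :: 'a mat" and ?q = "ampliate (mat_adjoint P) :: 'a mat"
  have Tc: "T \<in> carrier_mat k k" using T by (rule commutantD)
  have "?p * ampliate T * ?q * A = ?p * (ampliate T * ?V) * ?q"
    using Tc by (simp add: mat_mult_assoc intertwines')
  also have "\<dots> = (?p * ?V) * ampliate T * ?q" unfolding commutantD(2)[OF T] using Tc by (simp add: mat_mult_assoc)
  also have "\<dots> = A * (?p * ampliate T * ?q)" unfolding intertwines[symmetric] using Tc by (simp add: mat_mult_assoc)
  finally have "ampliate (P * T * mat_adjoint P) * A = A * ampliate (P * T * mat_adjoint P)"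
    unfolding ampliate_extend[OF Tc] .
  then show ?thesis using extend_carrier[OF Tc] by (simp only: commutant_def mem_Collect_eq)
qed

lemma completely_reducible_compress:
  assumes "completely_reducible n A"
  shows "completely_reducible k (compress P A)"
  unfolding completely_reducible_def
proof (intro ballI impI, elim conjE)
  fix f assume f: "f \<in> carrier_mat k k" "mat_adjoint f = f" "f * f = f"
    and inv: "ampliate f * compress P A * ampliate f = compress P A * ampliate f"
  let ?V = "compress P A" and ?p = "ampliate P :: 'a mat" and ?q = "ampliate (mat_adjoint P) :: 'a mat"
  let ?f = "ampliate f :: 'a mat"
  define g where "g = P * f * mat_adjoint P"
  have gc: "g \<in> carrier_mat n n" unfolding g_def by (rule extend_carrier[OF f(1)])
  have ga: "mat_adjoint g = g" using f by (simp add: g_def mat_adjoint_mult mat_mult_assoc)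
  have "g * g = P * f * (mat_adjoint P * P) * f * mat_adjoint P" using f by (simp add: g_def mat_mult_assoc)
  also have "\<dots> = P * (f * f) * mat_adjoint P" unfolding iso using f by (simp add: mat_mult_assoc mat_mult_one)
  finally have gg: "g * g = g" by (simp add: f g_def)
  have G: "ampliate g = ?p * ?f * ?q" unfolding g_def by (rule ampliate_extend[OF f(1)])
  have "ampliate g * A * ampliate g = ?p * ?f * (?q * A * ?p) * ?f * ?q"
    unfolding G using f by (simp add: mat_mult_assoc)
  also have "\<dots> = ?p * (?f * ?V * ?f) * ?q" using f by (simp add: mat_mult_assoc compress_def)
  also have "\<dots> = (?p * ?V) * ?f * ?q" unfolding inv using f by (simp add: mat_mult_assoc)
  also have "\<dots> = A * ampliate g" unfolding intertwines[symmetric] G using f by (simp add: mat_mult_assoc)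
  finally have "ampliate g * A * ampliate g = A * ampliate g" .
  then have gA: "ampliate g * A = A * ampliate g"
    using assms gc ga gg by (auto simp: completely_reducible_def)
  have "?f * ?V = (?q * ?p) * ?f * (?q * A) * ?p"
    unfolding ampliate_iso using f by (simp add: compress_def mat_mult_assoc mat_mult_one)
  also have "\<dots> = ?q * (ampliate g * A) * ?p" unfolding G using f by (simp add: mat_mult_assoc)
  also have "\<dots> = (?q * A * ?p) * ?f * (?q * ?p)" unfolding gA unfolding G using f by (simp add: mat_mult_assoc)
  also have "\<dots> = ?V * ?f" unfolding ampliate_iso using f by (simp add: compress_def mat_mult_assoc mat_mult_one)
  finally show "?f * ?V = ?V * ?f" .
qed

lemma restrict_operator:
  assumes R: "R \<in> carrier_mat n n" and comm: "R * (P * mat_adjoint P) = P * mat_adjoint P * R"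
  shows "R * P = P * (mat_adjoint P * R * P)"
proof -
  have "R * P = R * P * (mat_adjoint P * P)" unfolding iso using R by (simp add: mat_mult_one)
  also have "\<dots> = R * (P * mat_adjoint P) * P" using R by (simp add: mat_mult_assoc)
  also have "\<dots> = P * (mat_adjoint P * R * P)" unfolding comm using R by (simp add: mat_mult_assoc)
  finally show ?thesis .
qed

lemma restrict_power:
  assumes R: "R \<in> carrier_mat n n" and comm: "R * (P * mat_adjoint P) = P * mat_adjoint P * R"
  shows "R ^\<^sub>m s * P = P * (mat_adjoint P * R * P) ^\<^sub>m s"
proof (induction s)
  case 0
  have "R ^\<^sub>m 0 * P = P" "P * (mat_adjoint P * R * P) ^\<^sub>m 0 = P" using R P by simp_all
  then show ?case by simp
next
  case (Suc s)
  let ?V = "mat_adjoint P * R * P"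
  have d: "dim_row (R ^\<^sub>m s) = n" "dim_col (R ^\<^sub>m s) = n" "dim_row (?V ^\<^sub>m s) = k" "dim_col (?V ^\<^sub>m s) = k"
  proof -
    have V: "?V \<in> carrier_mat k k" by (rule restrict_carrier[OF R])
    show "dim_row (R ^\<^sub>m s) = n" "dim_col (R ^\<^sub>m s) = n" "dim_row (?V ^\<^sub>m s) = k" "dim_col (?V ^\<^sub>m s) = k"
      using carrier_matD[OF pow_carrier_mat[OF R]] carrier_matD[OF pow_carrier_mat[OF V]] by simp_all
  qed
  have "R ^\<^sub>m Suc s * P = R ^\<^sub>m s * (R * P)" using R d by (simp add: mat_mult_assoc)
  also have "\<dots> = (R ^\<^sub>m s * P) * ?V" unfolding restrict_operator[OF assms] using R d by (simp add: mat_mult_assoc)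
  also have "\<dots> = P * ?V ^\<^sub>m Suc s" unfolding Suc.IH using R d by (simp add: mat_mult_assoc)
  finally show ?case .
qed

lemma trace_restrict_power:
  assumes R: "R \<in> carrier_mat n n" and comm: "R * (P * mat_adjoint P) = P * mat_adjoint P * R"
  shows "trace_mat (R ^\<^sub>m s * (P * mat_adjoint P)) = trace_mat ((mat_adjoint P * R * P) ^\<^sub>m s)"
proof -
  let ?V = "mat_adjoint P * R * P"
  have Rs: "R ^\<^sub>m s \<in> carrier_mat n n" by (rule pow_carrier_mat[OF R])
  have V: "?V ^\<^sub>m s \<in> carrier_mat k k" by (rule pow_carrier_mat[OF restrict_carrier[OF R]])
  have "R ^\<^sub>m s * (P * mat_adjoint P) = R ^\<^sub>m s * P * mat_adjoint P" using carrier_matD[OF Rs] by (simp add: mat_mult_assoc)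
  also have "\<dots> = P * ?V ^\<^sub>m s * mat_adjoint P" by (simp only: restrict_power[OF assms])
  also have "trace_mat \<dots> = trace_mat (mat_adjoint P * (P * ?V ^\<^sub>m s))"
    by (rule trace_mat_commute[OF mult_carrier_mat[OF P V] carriers(2)])
  also have "mat_adjoint P * (P * ?V ^\<^sub>m s) = (mat_adjoint P * P) * ?V ^\<^sub>m s" using carrier_matD[OF V] by (simp add: mat_mult_assoc)
  also have "\<dots> = ?V ^\<^sub>m s" unfolding iso by (rule left_mult_one_mat[OF V])
  finally show ?thesis .
qed

lemma balanced_compress:
  assumes b: "balanced n A R N"
  shows "balanced k (compress P A) (mat_adjoint P * R * P) (mat_adjoint P * N * P)"
proof -
  have c: "R \<in> carrier_mat n n" "N \<in> carrier_mat n n" and RN: "R * N = 1\<^sub>m n" "N * R = 1\<^sub>m n"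
    using b by (auto simp: balanced_def inverse_pair_def)
  have comm: "R * (P * mat_adjoint P) = P * mat_adjoint P * R" "N * (P * mat_adjoint P) = P * mat_adjoint P * N"
    using b balanced_sym[OF b] reduces by (auto simp: balanced_def)
  let ?R = "mat_adjoint P * R * P" and ?N = "mat_adjoint P * N * P"
  note RP = restrict_operator[OF c(1) comm(1)] and NP = restrict_operator[OF c(2) comm(2)]
  have "?R * ?N = mat_adjoint P * R * (P * ?N)" using c by (simp add: mat_mult_assoc)
  also have "\<dots> = mat_adjoint P * (R * N) * P" unfolding NP[symmetric] using c by (simp add: mat_mult_assoc)
  finally have 1: "?R * ?N = 1\<^sub>m k" unfolding RN by (simp add: mat_mult_one iso)
  have "?N * ?R = mat_adjoint P * N * (P * ?R)" using c by (simp add: mat_mult_assoc)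
  also have "\<dots> = mat_adjoint P * (N * R) * P" unfolding RP[symmetric] using c by (simp add: mat_mult_assoc)
  finally have 2: "?N * ?R = 1\<^sub>m k" unfolding RN by (simp add: mat_mult_one iso)
  have g: "gram (mat_adjoint P * X * P)" if X: "gram X" "dim_row X = n" for X
  proof -
    obtain G where G: "X = G * mat_adjoint G" using X by (auto simp: gram_def)
    have "mat_adjoint P * X * P = (mat_adjoint P * G) * mat_adjoint (mat_adjoint P * G)"
      using X(2) unfolding G by (simp add: mat_adjoint_mult mat_mult_assoc)
    then show ?thesis unfolding gram_def by blast
  qed
  have ext: "T \<in> carrier_mat k k" "R * (P * T * mat_adjoint P) = (P * T * mat_adjoint P) * R"
    "trace_mat (P * T * mat_adjoint P * R) = trace_mat (P * T * mat_adjoint P * N)"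
    if "T \<in> commutant k (compress P A)" for T
    using extend_commutant[OF that] b that by (auto simp: balanced_def traces_agree_def dest: commutantD)
  have "?R * T = T * ?R" if T: "T \<in> commutant k (compress P A)" for T
  proof -
    have "?R * T = mat_adjoint P * R * P * T * (mat_adjoint P * P)" unfolding iso using c ext(1)[OF T] by (simp add: mat_mult_assoc mat_mult_one)
    also have "\<dots> = mat_adjoint P * (R * (P * T * mat_adjoint P)) * P" using c ext(1)[OF T] by (simp add: mat_mult_assoc)
    also have "\<dots> = (mat_adjoint P * P) * T * ?R" unfolding ext(2)[OF T] using c ext(1)[OF T] by (simp add: mat_mult_assoc)
    also have "\<dots> = T * ?R" unfolding iso using c ext(1)[OF T] by (simp add: mat_mult_assoc mat_mult_one)
    finally show ?thesis .
  qed
  moreover have "trace_mat (T * ?R) = trace_mat (T * ?N)" if T: "T \<in> commutant k (compress P A)" for T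
  proof -
    have tr: "trace_mat (T * (mat_adjoint P * X * P)) = trace_mat (P * T * mat_adjoint P * X)" if "X \<in> carrier_mat n n" for X
    proof -
      have "T * (mat_adjoint P * X * P) = (T * mat_adjoint P * X) * P" using ext(1)[OF T] that by (simp add: mat_mult_assoc)
      also have "trace_mat \<dots> = trace_mat (P * (T * mat_adjoint P * X))"
        by (rule trace_mat_commute[OF mult_carrier_mat[OF mult_carrier_mat[OF ext(1)[OF T] carriers(2)] that] P])
      also have "P * (T * mat_adjoint P * X) = P * T * mat_adjoint P * X" using ext(1)[OF T] that by (simp add: mat_mult_assoc)
      finally show ?thesis .
    qed
    show ?thesis unfolding tr[OF c(1)] tr[OF c(2)] by (rule ext(3)[OF T])
  qed
  moreover have "inverse_pair k ?R ?N" unfolding inverse_pair_def using 1 2 restrict_carrier c by blast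
  moreover have "gram ?R" "gram ?N" using b c g by (auto simp: balanced_def)
  ultimately show ?thesis by (auto simp: balanced_def traces_agree_def)
qed

end


section \<open>Decomposition into irreducible representations\<close>

lemma invertible_matI:
  fixes T S :: "complex mat"
  assumes "T \<in> carrier_mat n n" "S \<in> carrier_mat n n" "T * S = 1\<^sub>m n"
  shows "invertible_mat T"
proof -
  note d = carrier_matD[OF assms(1)] carrier_matD[OF assms(2)]
  have "S * T = 1\<^sub>m n" by (rule mat_mult_left_right_inverse[OF assms])
  then show ?thesis
    unfolding invertible_mat_def inverts_mat_def square_mat.simps d(1,2)
    by (intro conjI exI[of _ S]) (simp_all only: d assms(3))
qed

lemma invertible_matE:
  fixes T :: "complex mat"
  assumes "invertible_mat T" "T \<in> carrier_mat m n"
  obtains S where "m = n" "S \<in> carrier_mat n n" "T * S = 1\<^sub>m n" "S * T = 1\<^sub>m n"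
proof -
  obtain S where mn: "m = n" and S: "T * S = 1\<^sub>m m" "S * T = 1\<^sub>m (dim_row S)"
    using assms unfolding invertible_mat_def inverts_mat_def by auto
  have "dim_col (T * S) = m" using S(1) by simp
  then have c: "dim_col S = n" using mn by simp
  have "dim_col (S * T) = dim_row S" using S(2) by simp
  then have r: "dim_row S = n" using assms(2) by simp
  show ?thesis using that[of S] S mn c r by auto
qed

definition linear_over :: "('a::cstar_algebra \<Rightarrow> 'b::cstar_algebra) \<Rightarrow> bool" where
  "linear_over h \<longleftrightarrow> (\<forall>x y. h (x + y) = h x + h y) \<and> (\<forall>c x. h (c *\<^sub>C x) = c *\<^sub>C h x)"

lemma linear_over_sum: "linear_over h \<Longrightarrow> h (sum f S) = (\<Sum>i\<in>S. h (f i))"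
proof (induction S rule: infinite_finite_induct)
  have "h 0 = h (0 *\<^sub>C 0)" by simp
  also have "\<dots> = 0 *\<^sub>C h 0" if "linear_over h" using that unfolding linear_over_def by blast
  finally have h0: "h 0 = 0" if "linear_over h" using that by simp
  {
    case (infinite S) then show ?case using h0 by simp
  next
    case empty then show ?case using h0 by simp
  }
next
  case (insert x F)
  then show ?case by (simp add: linear_over_def)
qed

lemma map_mat_mult_ampliate:
  fixes A :: "'a::cstar_algebra mat" and h :: "'a \<Rightarrow> 'b::cstar_algebra"
  assumes h: "linear_over h" and A: "A \<in> carrier_mat n m"
  shows "S \<in> carrier_mat k n \<Longrightarrow> map_mat h (ampliate S * A) = ampliate S * map_mat h A"
    and "T \<in> carrier_mat m k \<Longrightarrow> map_mat h (A * ampliate T) = map_mat h A * ampliate T"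
proof -
  have hC: "h (c *\<^sub>C x) = c *\<^sub>C h x" for c x using h by (simp add: linear_over_def)
  have hA: "map_mat h A \<in> carrier_mat n m" using A by simp
  show "map_mat h (ampliate S * A) = ampliate S * map_mat h A" if S: "S \<in> carrier_mat k n"
  proof (rule eq_matI)
    fix i j assume "i < dim_row (ampliate S * map_mat h A)" "j < dim_col (ampliate S * map_mat h A)"
    then have ij: "i < k" "j < m" using S A by auto
    have Sa: "(ampliate S :: 'a mat) \<in> carrier_mat k n" "(ampliate S :: 'b mat) \<in> carrier_mat k n" using S by simp_all
    have "map_mat h (ampliate S * A) $$ (i, j) = h ((ampliate S * A) $$ (i, j))"
      using ij S A by (simp del: index_mult_mat(1))
    also have "\<dots> = (\<Sum>l<n. S $$ (i, l) *\<^sub>C h (A $$ (l, j)))"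
      unfolding mult_mat_index'[OF Sa(1) A ij] linear_over_sum[OF h]
      using ij S by (intro sum.cong refl) (simp add: mult_scaleC_left hC)
    also have "\<dots> = (ampliate S * map_mat h A) $$ (i, j)"
      unfolding mult_mat_index'[OF Sa(2) hA ij]
      using ij S A by (intro sum.cong refl) (simp add: mult_scaleC_left)
    finally show "map_mat h (ampliate S * A) $$ (i, j) = (ampliate S * map_mat h A) $$ (i, j)" .
  qed (use S A in auto)
  show "map_mat h (A * ampliate T) = map_mat h A * ampliate T" if T: "T \<in> carrier_mat m k"
  proof (rule eq_matI)
    fix i j assume "i < dim_row (map_mat h A * ampliate T)" "j < dim_col (map_mat h A * ampliate T)"
    then have ij: "i < n" "j < k" using T A by auto
    have Ta: "(ampliate T :: 'a mat) \<in> carrier_mat m k" "(ampliate T :: 'b mat) \<in> carrier_mat m k" using T by simp_all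
    have "map_mat h (A * ampliate T) $$ (i, j) = h ((A * ampliate T) $$ (i, j))"
      using ij T A by (simp del: index_mult_mat(1))
    also have "\<dots> = (\<Sum>l<m. T $$ (l, j) *\<^sub>C h (A $$ (i, l)))"
      unfolding mult_mat_index'[OF A Ta(1) ij] linear_over_sum[OF h]
      using ij T by (intro sum.cong refl) (simp add: mult_scaleC_right hC)
    also have "\<dots> = (map_mat h A * ampliate T) $$ (i, j)"
      unfolding mult_mat_index'[OF hA Ta(2) ij]
      using ij T A by (intro sum.cong refl) (simp add: mult_scaleC_right)
    finally show "map_mat h (A * ampliate T) $$ (i, j) = (map_mat h A * ampliate T) $$ (i, j)" .
  qed (use T A in auto)
qed

definition comultiplicative ::
    "('a::cstar_algebra \<Rightarrow> 'b::cstar_algebra) \<Rightarrow> ('a \<Rightarrow> 'a \<Rightarrow> 'b) \<Rightarrow> 'a mat \<Rightarrow> bool" where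
  "comultiplicative \<Delta> \<tau> A \<longleftrightarrow> map_mat \<Delta> A = map_mat (\<lambda>a. \<tau> a 1) A * map_mat (\<lambda>a. \<tau> 1 a) A"

lemma unitary_representation_iff:
  "unitary_representation \<Delta> \<tau> A \<longleftrightarrow>
    0 < dim_row A \<and> unitary_over (dim_row A) A \<and> comultiplicative \<Delta> \<tau> A"
proof
  assume *: "unitary_representation \<Delta> \<tau> A"
  then have sq: "dim_col A = dim_row A"
    unfolding unitary_representation_def representation_def invertible_mat_def square_mat.simps by (elim conjE)
  have "A \<in> carrier_mat (dim_row A) (dim_row A)" by (rule carrier_matI[OF refl sq])
  then show "0 < dim_row A \<and> unitary_over (dim_row A) A \<and> comultiplicative \<Delta> \<tau> A"
    using * unfolding unitary_representation_def representation_def inverts_mat_def unitary_over_def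
      comultiplicative_def star_mat_dim sq by blast
next
  assume *: "0 < dim_row A \<and> unitary_over (dim_row A) A \<and> comultiplicative \<Delta> \<tau> A"
  then have "A \<in> carrier_mat (dim_row A) (dim_row A)" by (simp only: unitary_over_def)
  then have sq: "dim_col A = dim_row A" by (rule carrier_matD(2))
  show "unitary_representation \<Delta> \<tau> A"
    using * unfolding unitary_representation_def representation_def invertible_mat_def inverts_mat_def
      unitary_over_def comultiplicative_def star_mat_dim sq square_mat.simps
    by (intro conjI exI[of _ "star_mat A"]) (simp_all only: star_mat_dim sq)
qed

text \<open>
  The projection \<open>P P\<^sup>*\<close> commutes with \<open>A\<close>, so it can be inserted between the two legs of the
  coproduct.
\<close>

lemma (in reducing_isometry) comultiplicative_compress:
  fixes \<Delta> :: "'a \<Rightarrow> 'b::cstar_algebra"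
  assumes lin: "linear_over \<Delta>" "linear_over (\<lambda>a. \<tau> a 1)" "linear_over (\<lambda>a. \<tau> 1 a)"
    and com: "comultiplicative \<Delta> \<tau> A"
  shows "comultiplicative \<Delta> \<tau> (compress P A)"
proof -
  have pA: "ampliate (mat_adjoint P) * A \<in> carrier_mat k n" using mult_carrier_mat[of _ k n A n] carriers by simp
  have map: "map_mat h (compress P A) = ampliate (mat_adjoint P) * map_mat h A * ampliate P"
    if "linear_over h" for h :: "'a \<Rightarrow> 'b"
    unfolding compress_def map_mat_mult_ampliate(2)[OF that pA P] map_mat_mult_ampliate(1)[OF that carriers(1,2)] ..
  let ?p = "ampliate P :: 'b mat" and ?q = "ampliate (mat_adjoint P) :: 'b mat"
  let ?B = "map_mat (\<lambda>a. \<tau> a 1) A" and ?C = "map_mat (\<lambda>a. \<tau> 1 a) A"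
  have PP: "P * mat_adjoint P \<in> carrier_mat n n" by (rule mult_carrier_mat[OF P carriers(2)])
  have e: "?p * ?q * ?B = ?B * (?p * ?q)"
    using arg_cong[OF commutantD(2)[OF reduces], of "map_mat (\<lambda>a. \<tau> a 1)"]
    unfolding map_mat_mult_ampliate(1)[OF lin(2) carriers(1) PP] map_mat_mult_ampliate(2)[OF lin(2) carriers(1) PP]
    by (simp only: ampliate_mult[OF P carriers(2)])
  have iso': "?q * ?p = 1\<^sub>m k" using iso by (simp flip: ampliate_mult[OF carriers(2) P])
  have "map_mat \<Delta> (compress P A) = ?q * (?B * ?C) * ?p"
    unfolding map[OF lin(1)] using com by (simp only: comultiplicative_def)
  also have "\<dots> = (?q * ?p) * ?q * ?B * ?C * ?p" unfolding iso' by (simp add: mat_mult_assoc mat_mult_one)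
  also have "\<dots> = ?q * (?p * ?q * ?B) * ?C * ?p" by (simp add: mat_mult_assoc)
  also have "\<dots> = (?q * ?B * ?p) * (?q * ?C * ?p)" unfolding e by (simp add: mat_mult_assoc)
  finally show ?thesis unfolding comultiplicative_def map[OF lin(2)] map[OF lin(3)] .
qed

text \<open>The inclusion of the summand of dimension \<open>k\<close> starting at position \<open>s\<close>.\<close>

definition summand_inclusion :: "nat \<Rightarrow> nat \<Rightarrow> nat \<Rightarrow> 'r::{zero,one} mat" where
  "summand_inclusion n k s = mat n k (\<lambda>(i, j). if i = j + s then 1 else 0)"

lemma summand_inclusion_carrier [simp]:
  "summand_inclusion n k s \<in> carrier_mat n k" "dim_row (summand_inclusion n k s) = n"
  "dim_col (summand_inclusion n k s) = k"
  by (auto simp: summand_inclusion_def)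

lemma summand_inclusion_index:
  "i < n \<Longrightarrow> j < k \<Longrightarrow> summand_inclusion n k s $$ (i, j) = (if i = j + s then 1 else 0)"
  by (simp add: summand_inclusion_def)

lemma ampliate_summand_inclusion: "ampliate (summand_inclusion n k s) = summand_inclusion n k s"
  by (rule eq_matI) (auto simp: summand_inclusion_index)

lemma mult_summand_inclusion_index:
  fixes M :: "'r::semiring_1 mat"
  assumes M: "M \<in> carrier_mat m n" and "k + s \<le> n" "i < m" "j < k"
  shows "(M * summand_inclusion n k s) $$ (i, j) = M $$ (i, j + s)"
proof -
  have "(M * summand_inclusion n k s) $$ (i, j) = (\<Sum>l<n. M $$ (i, l) * summand_inclusion n k s $$ (l, j))"
    by (rule mult_mat_index'[OF M summand_inclusion_carrier(1) assms(3,4)])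
  also have "\<dots> = (\<Sum>l<n. if l = j + s then M $$ (i, l) else 0)"
    using assms by (intro sum.cong refl) (simp add: summand_inclusion_index)
  finally show ?thesis using assms by simp
qed

lemma summand_inclusion_mult_index:
  fixes M :: "'r::semiring_1 mat"
  assumes M: "M \<in> carrier_mat k m" and "i < n" "j < m"
  shows "(summand_inclusion n k s * M) $$ (i, j) = (if s \<le> i \<and> i < k + s then M $$ (i - s, j) else 0)"
proof -
  have "(summand_inclusion n k s * M) $$ (i, j) = (\<Sum>l<k. summand_inclusion n k s $$ (i, l) * M $$ (l, j))"
    by (rule mult_mat_index'[OF summand_inclusion_carrier(1) M assms(2,3)])
  also have "\<dots> = (\<Sum>l<k. if l = i - s then (if s \<le> i then M $$ (l, j) else 0) else 0)"
    using assms by (intro sum.cong refl) (auto simp: summand_inclusion_index)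
  finally show ?thesis by auto
qed

lemma block_inclusions:
  fixes k k' :: nat
  defines "J \<equiv> summand_inclusion (k + k') k 0 :: complex mat"
    and "J' \<equiv> summand_inclusion (k + k') k' k :: complex mat"
  shows "mat_adjoint J * J = 1\<^sub>m k" "mat_adjoint J' * J' = 1\<^sub>m k'"
    "J * mat_adjoint J + J' * mat_adjoint J' = 1\<^sub>m (k + k')"
    and "\<And>D D' :: 'a::cstar_algebra mat. D \<in> carrier_mat k k \<Longrightarrow> D' \<in> carrier_mat k' k' \<Longrightarrow>
      four_block_mat D (0\<^sub>m k k') (0\<^sub>m k' k) D' * ampliate J = ampliate J * D"
    and "\<And>D D' :: 'a::cstar_algebra mat. D \<in> carrier_mat k k \<Longrightarrow> D' \<in> carrier_mat k' k' \<Longrightarrow>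
      four_block_mat D (0\<^sub>m k k') (0\<^sub>m k' k) D' * ampliate J' = ampliate J' * D'"
proof -
  have aJ: "mat_adjoint J \<in> carrier_mat k (k + k')" and aJ': "mat_adjoint J' \<in> carrier_mat k' (k + k')"
    by (simp_all add: J_def J'_def)
  show "mat_adjoint J * J = 1\<^sub>m k"
    by (rule eq_matI) (use aJ in \<open>auto simp: J_def mult_summand_inclusion_index[of _ k "k + k'" k 0]
      summand_inclusion_index simp del: index_mult_mat(1)\<close>)
  show "mat_adjoint J' * J' = 1\<^sub>m k'"
    by (rule eq_matI) (use aJ' in \<open>auto simp: J'_def mult_summand_inclusion_index[of _ k' "k + k'" k' k]
      summand_inclusion_index simp del: index_mult_mat(1)\<close>)
  show "J * mat_adjoint J + J' * mat_adjoint J' = 1\<^sub>m (k + k')"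
  proof (rule eq_matI)
    fix i j assume "i < dim_row (1\<^sub>m (k + k') :: complex mat)" "j < dim_col (1\<^sub>m (k + k') :: complex mat)"
    then have ij: "i < k + k'" "j < k + k'" by auto
    have "(J * mat_adjoint J + J' * mat_adjoint J') $$ (i, j) = (J * mat_adjoint J) $$ (i, j) + (J' * mat_adjoint J') $$ (i, j)"
      using ij by (simp add: J_def J'_def del: index_mult_mat(1))
    also have "(J * mat_adjoint J) $$ (i, j) = (if i < k then mat_adjoint J $$ (i, j) else 0)"
      using summand_inclusion_mult_index[OF aJ ij, of 0] by (simp add: J_def)
    also have "(J' * mat_adjoint J') $$ (i, j) = (if k \<le> i then mat_adjoint J' $$ (i - k, j) else 0)"
      using summand_inclusion_mult_index[OF aJ' ij, of k] ij by (simp add: J'_def)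
    also have "(if i < k then mat_adjoint J $$ (i, j) else 0) + (if k \<le> i then mat_adjoint J' $$ (i - k, j) else 0) =
        (if i = j then 1 else 0)"
      using ij by (auto simp: J_def J'_def summand_inclusion_index)
    finally show "(J * mat_adjoint J + J' * mat_adjoint J') $$ (i, j) = 1\<^sub>m (k + k') $$ (i, j)" using ij by simp
  qed (auto simp: J_def J'_def)
  fix D D' :: "'a mat" assume D: "D \<in> carrier_mat k k" and D': "D' \<in> carrier_mat k' k'"
  let ?F = "four_block_mat D (0\<^sub>m k k') (0\<^sub>m k' k) D'"
  have F: "?F \<in> carrier_mat (k + k') (k + k')" by (rule four_block_carrier_mat[OF D D'])
  show "?F * ampliate J = ampliate J * D"
  proof (rule eq_matI)
    fix i j assume "i < dim_row (ampliate J * D)" "j < dim_col (ampliate J * D)"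
    then have ij: "i < k + k'" "j < k" using D by (auto simp: J_def)
    then show "(?F * ampliate J) $$ (i, j) = (ampliate J * D) $$ (i, j)"
      unfolding J_def ampliate_summand_inclusion using D D'
      by (simp add: mult_summand_inclusion_index[OF F] summand_inclusion_mult_index[OF D] del: index_mult_mat(1))
  qed (use D D' in \<open>auto simp: J_def\<close>)
  show "?F * ampliate J' = ampliate J' * D'"
  proof (rule eq_matI)
    fix i j assume "i < dim_row (ampliate J' * D')" "j < dim_col (ampliate J' * D')"
    then have ij: "i < k + k'" "j < k'" using D' by (auto simp: J'_def)
    then show "(?F * ampliate J') $$ (i, j) = (ampliate J' * D') $$ (i, j)"
      unfolding J'_def ampliate_summand_inclusion using D D'
      by (simp add: mult_summand_inclusion_index[OF F] summand_inclusion_mult_index[OF D'] del: index_mult_mat(1))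
  qed (use D D' in \<open>auto simp: J'_def\<close>)
qed

lemma diag_block_mat_square_dim:
  assumes "\<And>V. V \<in> set Vs \<Longrightarrow> dim_col V = dim_row V"
  shows "dim_col (diag_block_mat Vs) = dim_row (diag_block_mat Vs)"
  unfolding dim_diag_block_mat using assms by (intro arg_cong[of _ _ sum_list] map_cong) auto

lemma ampliate_add:
  "S \<in> carrier_mat n m \<Longrightarrow> T \<in> carrier_mat n m \<Longrightarrow> ampliate (S + T) = ampliate S + ampliate T"
  by (rule eq_matI) (auto simp: scaleC_add_left)

lemma balanced_trace_nonneg: "balanced n A R N \<Longrightarrow> 0 \<le> Re (trace_mat (N ^\<^sub>m s))"
  unfolding balanced_def by (elim conjE) (rule trace_gram_pow_nonneg(2)[OF inverse_pair_sym])

text \<open>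
  As long as a representation is reducible, an invariant projection splits it into two summands of
  smaller dimension. The trace estimate is part of the induction because traces of powers are
  additive along these orthogonal splittings; the equivalence with the direct sum of the
  irreducible summands, by contrast, is only given by an invertible intertwiner, which need not
  transport balanced operators to balanced ones.
\<close>

lemma decomposition_exists:
  fixes \<Delta> :: "'a::cstar_algebra \<Rightarrow> 'b::cstar_algebra"
  assumes lin: "linear_over \<Delta>" "linear_over (\<lambda>a. \<tau> a 1)" "linear_over (\<lambda>a. \<tau> 1 a)"
  shows "unitary_over n A \<Longrightarrow> 0 < n \<Longrightarrow> comultiplicative \<Delta> \<tau> A \<Longrightarrow> completely_reducible n A \<Longrightarrow>
    \<exists>Vs. decomposition \<Delta> \<tau> A Vs \<and> Vs \<noteq> [] \<and>
      (\<forall>R N s. balanced n A R N \<longrightarrow>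
        Re (trace_mat (R ^\<^sub>m s)) \<le> real (Max (dim_row ` set Vs)) ^ Suc s * Re (trace_mat (N ^\<^sub>m s)))"
proof (induction n arbitrary: A rule: less_induct)
  case (less n)
  have Ac: "A \<in> carrier_mat n n" using less.prems by (simp add: unitary_over_def)
  show ?case
  proof (cases "irreducible_rep A")
    case True
    have "equivalent A (diag_block_mat [A])"
      unfolding equivalent_def
    proof
      show "1\<^sub>m n \<in> Mor A (diag_block_mat [A])" unfolding diag_block_mat_singleton using Ac by (simp add: Mor_def mat_mult_one)
      show "invertible_mat (1\<^sub>m n :: complex mat)" by (rule invertible_matI[of _ n "1\<^sub>m n"]) auto
    qed
    moreover have "unitary_representation \<Delta> \<tau> A"
      using less.prems Ac by (simp add: unitary_representation_iff)
    ultimately have "decomposition \<Delta> \<tau> A [A]" using True by (simp add: decomposition_def del: diag_block_mat.simps)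
    moreover have "Re (trace_mat (R ^\<^sub>m s)) \<le> real n ^ Suc s * Re (trace_mat (N ^\<^sub>m s))"
      if b: "balanced n A R N" for R N s
    proof (rule trace_pow_bound)
      have "trace_mat (1\<^sub>m n * R) = trace_mat (1\<^sub>m n * N)"
        using b commutant_one[OF Ac] unfolding balanced_def traces_agree_def by blast
      moreover have "R \<in> carrier_mat n n" "N \<in> carrier_mat n n" using b by (auto simp: balanced_def inverse_pair_def)
      ultimately show "trace_mat R = trace_mat N" by simp
    qed (use b in \<open>auto simp: balanced_def\<close>)
    ultimately show ?thesis using Ac by (intro exI[of _ "[A]"]) auto
  next
    case False
    then obtain e where e: "e \<in> carrier_mat n n" "mat_adjoint e = e" "e * e = e"
      and inv: "ampliate e * A * ampliate e = A * ampliate e" and ne: "e \<noteq> 0\<^sub>m n n" "e \<noteq> 1\<^sub>m n"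
      unfolding irreducible_rep_def using Ac by auto
    have ec: "e \<in> commutant n A"
      using less.prems(4) e inv by (auto simp: completely_reducible_def commutant_def)
    define f where "f = 1\<^sub>m n - e"
    have f: "f \<in> carrier_mat n n" unfolding f_def by (rule minus_carrier_mat[OF e(1)])
    have fa: "mat_adjoint f = f" using e by (simp add: f_def mat_adjoint_minus[of _ n n])
    have ee: "1\<^sub>m n - e - (e - e) = 1\<^sub>m n - e" "e + f = 1\<^sub>m n" "e - e = 0\<^sub>m n n"
      using e(1) by (auto intro!: eq_matI simp: f_def)
    have ff: "f * f = f" using e ee(1) by (simp add: f_def mat_algebra)
    have ef: "e * f = 0\<^sub>m n n" using e ee(3) by (simp add: f_def mat_algebra)
    have fc: "f \<in> commutant n A" unfolding f_def by (rule commutant_minus[OF Ac commutant_one[OF Ac] ec])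
    obtain k P where P: "P \<in> carrier_mat n k" "mat_adjoint P * P = 1\<^sub>m k" "P * mat_adjoint P = e"
      using projection_isometry[OF e] by blast
    obtain k' P' where P': "P' \<in> carrier_mat n k'" "mat_adjoint P' * P' = 1\<^sub>m k'" "P' * mat_adjoint P' = f"
      using projection_isometry[OF f fa ff] by blast
    interpret p: reducing_isometry n k P A using P less.prems(1) ec by unfold_locales auto
    interpret p': reducing_isometry n k' P' A using P' less.prems(1) fc by unfold_locales auto
    have "trace_mat e = of_nat k"
      using trace_mat_commute[OF P(1) p.carriers(2)] unfolding P(2,3) by (simp add: trace_mat_sum)
    moreover have "trace_mat f = of_nat k'"
      using trace_mat_commute[OF P'(1) p'.carriers(2)] unfolding P'(2,3) by (simp add: trace_mat_sum)
    moreover have "trace_mat f = of_nat n - trace_mat e"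
      unfolding f_def using e(1) by (subst trace_mat_minus[of _ n]) (simp_all add: trace_mat_sum)
    ultimately have "of_nat k' = (of_nat n :: complex) - of_nat k" by simp
    then have "of_nat k + of_nat k' = (of_nat n :: complex)" by (simp add: algebra_simps)
    then have nk: "n = k + k'" by (metis of_nat_add of_nat_eq_iff)
    have "k \<noteq> 0"
    proof
      assume "k = 0"
      then have "e = 0\<^sub>m n n" using P(1) unfolding P(3)[symmetric] by (intro eq_matI) (auto simp: scalar_prod_def)
      then show False using ne by simp
    qed
    moreover have "k' \<noteq> 0"
    proof
      assume "k' = 0"
      then have "f = 0\<^sub>m n n" using P'(1) unfolding P'(3)[symmetric] by (intro eq_matI) (auto simp: scalar_prod_def)
      then have "e = 1\<^sub>m n" using ee(2) e(1) by (simp add: mat_add_zero)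
      then show False using ne by simp
    qed
    ultimately have kn: "k < n" "k' < n" "0 < k" "0 < k'" using nk by auto
    let ?V = "compress P A" and ?V' = "compress P' A"
    obtain Vs where Vs: "decomposition \<Delta> \<tau> ?V Vs" "Vs \<noteq> []"
      and bV: "\<And>R N s. balanced k ?V R N \<Longrightarrow>
        Re (trace_mat (R ^\<^sub>m s)) \<le> real (Max (dim_row ` set Vs)) ^ Suc s * Re (trace_mat (N ^\<^sub>m s))"
      using less.IH[OF kn(1) p.unitary_compress kn(3) p.comultiplicative_compress[OF lin less.prems(3)]
          p.completely_reducible_compress[OF less.prems(4)]] by blast
    obtain Vs' where Vs': "decomposition \<Delta> \<tau> ?V' Vs'" "Vs' \<noteq> []"
      and bV': "\<And>R N s. balanced k' ?V' R N \<Longrightarrow>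
        Re (trace_mat (R ^\<^sub>m s)) \<le> real (Max (dim_row ` set Vs')) ^ Suc s * Re (trace_mat (N ^\<^sub>m s))"
      using less.IH[OF kn(2) p'.unitary_compress kn(4) p'.comultiplicative_compress[OF lin less.prems(3)]
          p'.completely_reducible_compress[OF less.prems(4)]] by blast
    have sq: "dim_col V = dim_row V" if "V \<in> set Vs \<or> V \<in> set Vs'" for V
      using that Vs(1) Vs'(1) by (auto simp: decomposition_def unitary_representation_iff unitary_over_def)
    define D D' where "D = diag_block_mat Vs" and "D' = diag_block_mat Vs'"
    obtain T where T: "T \<in> Mor ?V D" "invertible_mat T"
      using Vs(1) by (auto simp: decomposition_def equivalent_def D_def)
    obtain T' where T': "T' \<in> Mor ?V' D'" "invertible_mat T'"
      using Vs'(1) by (auto simp: decomposition_def equivalent_def D'_def)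
    have Tc0: "T \<in> carrier_mat (dim_row D) k" and TV: "ampliate T * ?V = D * ampliate T"
      using T(1) by (auto simp: Mor_def)
    have Tc0': "T' \<in> carrier_mat (dim_row D') k'" and TV': "ampliate T' * ?V' = D' * ampliate T'"
      using T'(1) by (auto simp: Mor_def)
    obtain S where S: "dim_row D = k" "S \<in> carrier_mat k k" "T * S = 1\<^sub>m k"
      using invertible_matE[OF T(2) Tc0] by metis
    obtain S' where S': "dim_row D' = k'" "S' \<in> carrier_mat k' k'" "T' * S' = 1\<^sub>m k'"
      using invertible_matE[OF T'(2) Tc0'] by metis
    have Tc: "T \<in> carrier_mat k k" and Tc': "T' \<in> carrier_mat k' k'" using Tc0 Tc0' S S' by simp_all
    have "dim_col D = k" "dim_col D' = k'"
      using S(1) S'(1) sq unfolding D_def D'_def by (simp_all add: diag_block_mat_square_dim)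
    then have Dc: "D \<in> carrier_mat k k" and Dc': "D' \<in> carrier_mat k' k'" using S S' by auto
    define J J' where "J = (summand_inclusion (k + k') k 0 :: complex mat)" and "J' = (summand_inclusion (k + k') k' k :: complex mat)"
    have Jc: "J \<in> carrier_mat n k" "J' \<in> carrier_mat n k'" by (simp_all add: J_def J'_def nk)
    have JJ: "J * mat_adjoint J + J' * mat_adjoint J' = 1\<^sub>m n"
      unfolding J_def J'_def nk by (rule block_inclusions(3))
    define F where "F = four_block_mat D (0\<^sub>m k k') (0\<^sub>m k' k) D'"
    have F: "F \<in> carrier_mat n n" unfolding F_def nk by (rule four_block_carrier_mat[OF Dc Dc'])
    have diag: "diag_block_mat (Vs @ Vs') = F"
      unfolding diag_block_mat_append Let_def F_def D_def[symmetric] D'_def[symmetric] using Dc Dc' by simp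
    have FJ: "F * ampliate J = ampliate J * D" "F * ampliate J' = ampliate J' * D'"
      unfolding F_def J_def J'_def by (rule block_inclusions(4)[OF Dc Dc'], rule block_inclusions(5)[OF Dc Dc'])
    define M where "M = J * T * mat_adjoint P + J' * T' * mat_adjoint P'"
    define L where "L = P * S * mat_adjoint J + P' * S' * mat_adjoint J'"
    have c1: "J * T * mat_adjoint P \<in> carrier_mat n n"
      by (rule mult_carrier_mat[OF mult_carrier_mat[OF Jc(1) Tc] p.carriers(2)])
    have c2: "J' * T' * mat_adjoint P' \<in> carrier_mat n n"
      by (rule mult_carrier_mat[OF mult_carrier_mat[OF Jc(2) Tc'] p'.carriers(2)])
    have M: "M \<in> carrier_mat n n" unfolding M_def by (rule add_carrier_mat[OF c2])
    have Jc': "mat_adjoint J' \<in> carrier_mat k' n" using Jc by simp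
    have "P' * S' * mat_adjoint J' \<in> carrier_mat n n"
      by (rule mult_carrier_mat[OF mult_carrier_mat[OF P'(1) S'(2)] Jc'])
    then have L: "L \<in> carrier_mat n n" unfolding L_def by (rule add_carrier_mat)
    have orth: "mat_adjoint P * P' = 0\<^sub>m k k'" "mat_adjoint P' * P = 0\<^sub>m k' k"
    proof -
      have "mat_adjoint P * P' = (mat_adjoint P * P) * (mat_adjoint P * P') * (mat_adjoint P' * P')"
        unfolding P(2) P'(2) by (simp add: mat_mult_one)
      also have "\<dots> = mat_adjoint P * (e * f) * P'" unfolding P(3)[symmetric] P'(3)[symmetric] by (simp add: mat_mult_assoc)
      finally show 0: "mat_adjoint P * P' = 0\<^sub>m k k'" unfolding ef by (simp add: mat_mult_zero)
      have "mat_adjoint P' * P = mat_adjoint (mat_adjoint P * P')" by (simp add: mat_adjoint_mult)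
      then show "mat_adjoint P' * P = 0\<^sub>m k' k" unfolding 0 by (simp, intro eq_matI) auto
    qed
    have "M * L = J * T * (mat_adjoint P * P) * S * mat_adjoint J + J' * T' * (mat_adjoint P' * P) * S * mat_adjoint J
        + (J * T * (mat_adjoint P * P') * S' * mat_adjoint J' + J' * T' * (mat_adjoint P' * P') * S' * mat_adjoint J')"
      unfolding M_def L_def using Tc Tc' S S' Jc by (simp add: mat_mult_assoc mat_mult_add_left mat_mult_add_right)
    also have "\<dots> = J * (T * S) * mat_adjoint J + J' * (T' * S') * mat_adjoint J'"
      unfolding orth P(2) P'(2) using Tc Tc' S(2) S'(2) Jc by (simp add: mat_algebra)
    also have "\<dots> = 1\<^sub>m n" unfolding S(3) S'(3) using Jc JJ by (simp add: mat_mult_one)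
    finally have inv_M: "M * L = 1\<^sub>m n" .
    have am: "(ampliate M :: 'a mat) = ampliate J * ampliate T * ampliate (mat_adjoint P) + ampliate J' * ampliate T' * ampliate (mat_adjoint P')"
    proof -
      have "(ampliate M :: 'a mat) = ampliate (J * T * mat_adjoint P) + ampliate (J' * T' * mat_adjoint P')"
        unfolding M_def by (rule ampliate_add[OF c1 c2])
      then show ?thesis
        by (simp only: ampliate_mult[OF mult_carrier_mat[OF Jc(1) Tc] p.carriers(2)] ampliate_mult[OF Jc(1) Tc]
            ampliate_mult[OF mult_carrier_mat[OF Jc(2) Tc'] p'.carriers(2)] ampliate_mult[OF Jc(2) Tc'])
    qed
    have "ampliate M * A = ampliate J * ampliate T * (ampliate (mat_adjoint P) * A) + ampliate J' * ampliate T' * (ampliate (mat_adjoint P') * A)"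
      unfolding am using Tc Tc' Jc by (simp add: mat_mult_assoc mat_mult_add_left)
    also have "\<dots> = ampliate J * (ampliate T * ?V) * ampliate (mat_adjoint P) + ampliate J' * (ampliate T' * ?V') * ampliate (mat_adjoint P')"
      unfolding p.intertwines' p'.intertwines' using Tc Tc' Jc by (simp add: mat_mult_assoc)
    also have "\<dots> = (ampliate J * D) * ampliate T * ampliate (mat_adjoint P) + (ampliate J' * D') * ampliate T' * ampliate (mat_adjoint P')"
      unfolding TV TV' using Tc Tc' Jc Dc Dc' by (simp add: mat_mult_assoc)
    also have "\<dots> = F * ampliate M"
      unfolding am FJ[symmetric] using Tc Tc' Jc F by (simp add: mat_mult_assoc mat_mult_add_right)
    finally have "M \<in> Mor A (diag_block_mat (Vs @ Vs'))" unfolding diag Mor_def mem_Collect_eq carrier_matD[OF F] carrier_matD[OF Ac] using M by blast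
    then have "equivalent A (diag_block_mat (Vs @ Vs'))"
      unfolding equivalent_def using invertible_matI[OF M L inv_M] by blast
    then have dec: "decomposition \<Delta> \<tau> A (Vs @ Vs')"
      using Vs(1) Vs'(1) by (auto simp: decomposition_def)
    have "Re (trace_mat (R ^\<^sub>m s)) \<le> real (Max (dim_row ` set (Vs @ Vs'))) ^ Suc s * Re (trace_mat (N ^\<^sub>m s))"
      if b: "balanced n A R N" for R N s
    proof -
      let ?m = "Max (dim_row ` set Vs)" and ?m' = "Max (dim_row ` set Vs')" and ?M = "Max (dim_row ` set (Vs @ Vs'))"
      have c: "R \<in> carrier_mat n n" "N \<in> carrier_mat n n" using b by (auto simp: balanced_def inverse_pair_def)
      have tr: "Re (trace_mat (X ^\<^sub>m s)) = Re (trace_mat ((mat_adjoint P * X * P) ^\<^sub>m s)) + Re (trace_mat ((mat_adjoint P' * X * P') ^\<^sub>m s))"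
        if X: "X \<in> carrier_mat n n" and com: "\<And>T. T \<in> commutant n A \<Longrightarrow> X * T = T * X" for X
      proof -
        have Xs: "X ^\<^sub>m s \<in> carrier_mat n n" by (rule pow_carrier_mat[OF X])
        have "X ^\<^sub>m s = X ^\<^sub>m s * (e + f)" unfolding ee(2) by (rule right_mult_one_mat[OF Xs, symmetric])
        also have "\<dots> = X ^\<^sub>m s * e + X ^\<^sub>m s * f" by (rule mult_add_distrib_mat[OF Xs e(1) f])
        finally have "trace_mat (X ^\<^sub>m s) = trace_mat (X ^\<^sub>m s * e + X ^\<^sub>m s * f)" by simp
        also have "\<dots> = trace_mat (X ^\<^sub>m s * e) + trace_mat (X ^\<^sub>m s * f)"
          by (rule trace_mat_add[OF mult_carrier_mat[OF Xs e(1)] mult_carrier_mat[OF Xs f]])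
        finally show ?thesis
          using p.trace_restrict_power[OF X, of s] p'.trace_restrict_power[OF X, of s] com[OF ec] com[OF fc]
          unfolding P(3) P'(3) by simp
      qed
      have cR: "R * T = T * R" and cN: "N * T = T * N" if "T \<in> commutant n A" for T
        using that b balanced_sym[OF b] by (auto simp: balanced_def)
      have trR: "Re (trace_mat (R ^\<^sub>m s)) =
          Re (trace_mat ((mat_adjoint P * R * P) ^\<^sub>m s)) + Re (trace_mat ((mat_adjoint P' * R * P') ^\<^sub>m s))"
        by (rule tr[OF c(1)]) (rule cR)
      have trN: "Re (trace_mat (N ^\<^sub>m s)) =
          Re (trace_mat ((mat_adjoint P * N * P) ^\<^sub>m s)) + Re (trace_mat ((mat_adjoint P' * N * P') ^\<^sub>m s))"
        by (rule tr[OF c(2)]) (rule cN)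
      have mono: "?m \<le> ?M" "?m' \<le> ?M" using Vs(2) Vs'(2) by (auto intro!: Max_mono)
      have bb: "balanced k ?V (mat_adjoint P * R * P) (mat_adjoint P * N * P)"
        "balanced k' ?V' (mat_adjoint P' * R * P') (mat_adjoint P' * N * P')"
        using p.balanced_compress[OF b] p'.balanced_compress[OF b] by auto
      have nn: "0 \<le> Re (trace_mat ((mat_adjoint P * N * P) ^\<^sub>m s))" "0 \<le> Re (trace_mat ((mat_adjoint P' * N * P') ^\<^sub>m s))"
        by (rule balanced_trace_nonneg[OF bb(1)], rule balanced_trace_nonneg[OF bb(2)])
      have "Re (trace_mat (R ^\<^sub>m s)) \<le> real ?m ^ Suc s * Re (trace_mat ((mat_adjoint P * N * P) ^\<^sub>m s))
          + real ?m' ^ Suc s * Re (trace_mat ((mat_adjoint P' * N * P') ^\<^sub>m s))"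
        unfolding trR by (intro add_mono bV bV' bb)
      also have "\<dots> \<le> real ?M ^ Suc s * Re (trace_mat ((mat_adjoint P * N * P) ^\<^sub>m s))
          + real ?M ^ Suc s * Re (trace_mat ((mat_adjoint P' * N * P') ^\<^sub>m s))"
        using mono nn by (intro add_mono mult_right_mono power_mono) simp_all
      also have "\<dots> = real ?M ^ Suc s * Re (trace_mat (N ^\<^sub>m s))"
        unfolding trN by (rule distrib_left[symmetric])
      finally show ?thesis .
    qed
    then show ?thesis using dec Vs(2) by (intro exI[of _ "Vs @ Vs'"] conjI allI impI) simp_all
  qed
qed


section \<open>Uniqueness of the dimensions\<close>

text \<open>
  In an eigenbasis of \<open>H\<close>, the entries of \<open>V\<close> between different eigenvalues vanish. So the
  projection onto an eigenspace of \<open>H\<close> is invariant, and by irreducibility there is only one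
  eigenspace.
\<close>

lemma irreducible_hermitian_scalar:
  fixes V :: "'a::cstar_algebra mat"
  assumes irr: "irreducible_rep V" and V: "unitary_over n V" and n: "0 < n"
    and H: "H \<in> commutant n V" and Ha: "mat_adjoint H = H"
  obtains c where "H = real_diag n (\<lambda>_. c)"
proof -
  have Vc: "V \<in> carrier_mat n n" using V by (simp add: unitary_over_def)
  have Hc: "H \<in> carrier_mat n n" using H by (rule commutantD)
  obtain Q d where Q: "unitary_mat n Q" and Hd: "H = Q * real_diag n d * mat_adjoint Q"
    using hermitian_diagonalization[OF Hc Ha] by blast
  have Qc: "Q \<in> carrier_mat n n" "mat_adjoint Q \<in> carrier_mat n n"
    and QQ: "mat_adjoint Q * Q = 1\<^sub>m n" "Q * mat_adjoint Q = 1\<^sub>m n"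
    using Q by (auto simp: unitary_mat_def)
  note dQ = carrier_matD[OF Qc(1)] carrier_matD[OF Vc]
  let ?q = "ampliate Q :: 'a mat" and ?q' = "ampliate (mat_adjoint Q) :: 'a mat"
  have qq: "?q' * ?q = 1\<^sub>m n" "?q * ?q' = 1\<^sub>m n"
    using QQ by (simp_all flip: ampliate_mult[OF Qc(2,1)] ampliate_mult[OF Qc(1,2)])
  define X where "X = ?q' * V * ?q"
  have X: "X \<in> carrier_mat n n"
    unfolding X_def using Qc Vc by (intro mult_carrier_mat[of _ n n]) simp_all
  have amp: "ampliate (Q * real_diag n f * mat_adjoint Q) = ?q * ampliate (real_diag n f) * ?q'" for f
    by (simp only: ampliate_mult[OF mult_carrier_mat[OF Qc(1) real_diag_dim(3)] Qc(2)]
        ampliate_mult[OF Qc(1) real_diag_dim(3)])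
  have VX: "V = ?q * X * ?q'"
  proof -
    have "?q * X * ?q' = (?q * ?q') * V * (?q * ?q')" unfolding X_def by (simp add: dQ mat_mult_assoc)
    then show ?thesis unfolding qq by (simp add: dQ mat_mult_one)
  qed
  have transfer: "ampliate (Q * real_diag n f * mat_adjoint Q) * V = V * ampliate (Q * real_diag n f * mat_adjoint Q) \<longleftrightarrow>
      ampliate (real_diag n f) * X = X * ampliate (real_diag n f)" (is "?l \<longleftrightarrow> ?r") for f
  proof -
    let ?d = "ampliate (real_diag n f) :: 'a mat"
    have 1: "?q' * (ampliate (Q * real_diag n f * mat_adjoint Q) * V) * ?q = (?q' * ?q) * ?d * X"
      unfolding amp X_def by (simp add: dQ mat_mult_assoc)
    have 2: "?q' * (V * ampliate (Q * real_diag n f * mat_adjoint Q)) * ?q = X * ?d * (?q' * ?q)"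
      unfolding amp X_def by (simp add: dQ mat_mult_assoc)
    have 3: "?q * (?d * X) * ?q' = ampliate (Q * real_diag n f * mat_adjoint Q) * V"
    proof -
      have "?q * (?d * X) * ?q' = ?q * ?d * ?q' * V * (?q * ?q')" unfolding X_def by (simp add: dQ mat_mult_assoc)
      then show ?thesis unfolding qq amp by (simp add: dQ mat_mult_one)
    qed
    have 4: "?q * (X * ?d) * ?q' = V * ampliate (Q * real_diag n f * mat_adjoint Q)"
    proof -
      have "?q * (X * ?d) * ?q' = (?q * ?q') * V * (?q * ?d * ?q')" unfolding X_def by (simp add: dQ mat_mult_assoc)
      then show ?thesis unfolding qq amp by (simp add: dQ mat_mult_one)
    qed
    show ?thesis
    proof
      assume ?l
      then have "(?q' * ?q) * ?d * X = X * ?d * (?q' * ?q)" using 1 2 by simp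
      then show ?r unfolding qq using carrier_matD[OF X] by (simp add: mat_mult_one)
    next
      assume ?r
      then show ?l using 3 4 by simp
    qed
  qed
  have left: "(ampliate (real_diag n f) * X) $$ (i, j) = of_real (f i) *\<^sub>C X $$ (i, j)"
    and right: "(X * ampliate (real_diag n f)) $$ (i, j) = of_real (f j) *\<^sub>C X $$ (i, j)"
    if ij: "i < n" "j < n" for f i j
  proof -
    have d: "(ampliate (real_diag n f) :: 'a mat) \<in> carrier_mat n n" by simp
    have "(ampliate (real_diag n f) * X) $$ (i, j) = (\<Sum>l<n. ampliate (real_diag n f) $$ (i, l) * X $$ (l, j))"
      by (rule mult_mat_index'[OF d X ij])
    also have "\<dots> = (\<Sum>l<n. if l = i then of_real (f i) *\<^sub>C X $$ (i, j) else 0)"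
      using ij by (intro sum.cong refl) (auto simp: mult_scaleC_left)
    finally show "(ampliate (real_diag n f) * X) $$ (i, j) = of_real (f i) *\<^sub>C X $$ (i, j)" using ij by simp
    have "(X * ampliate (real_diag n f)) $$ (i, j) = (\<Sum>l<n. X $$ (i, l) * ampliate (real_diag n f) $$ (l, j))"
      by (rule mult_mat_index'[OF X d ij])
    also have "\<dots> = (\<Sum>l<n. if l = j then of_real (f j) *\<^sub>C X $$ (i, j) else 0)"
      using ij by (intro sum.cong refl) (auto simp: mult_scaleC_right)
    finally show "(X * ampliate (real_diag n f)) $$ (i, j) = of_real (f j) *\<^sub>C X $$ (i, j)" using ij by simp
  qed
  have dX: "ampliate (real_diag n d) * X = X * ampliate (real_diag n d)"
    using transfer[of d] commutantD(2)[OF H] unfolding Hd by blast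
  have X0: "X $$ (i, j) = 0" if ij: "i < n" "j < n" "d i \<noteq> d j" for i j
  proof -
    have "of_real (d i) *\<^sub>C X $$ (i, j) = of_real (d j) *\<^sub>C X $$ (i, j)"
      using arg_cong[OF dX, of "\<lambda>M. M $$ (i, j)"] unfolding left[OF ij(1,2)] right[OF ij(1,2)] .
    then have "norm ((complex_of_real (d i) - of_real (d j)) *\<^sub>C X $$ (i, j)) = 0" by (simp add: scaleC_diff_left)
    then show ?thesis using ij(3) unfolding norm_scaleC by simp
  qed
  define f where "f i = (if d i = d 0 then 1 else 0 :: real)" for i
  define e where "e = Q * real_diag n f * mat_adjoint Q"
  have fX: "ampliate (real_diag n f) * X = X * ampliate (real_diag n f)"
  proof (rule eq_matI)
    fix i j assume "i < dim_row (X * ampliate (real_diag n f))" "j < dim_col (X * ampliate (real_diag n f))"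
    then have ij: "i < n" "j < n" using carrier_matD[OF X] by auto
    show "(ampliate (real_diag n f) * X) $$ (i, j) = (X * ampliate (real_diag n f)) $$ (i, j)"
      unfolding left[OF ij] right[OF ij] using X0[OF ij] by (cases "d i = d j") (auto simp: f_def)
  qed (use carrier_matD[OF X] in auto)
  have eV: "ampliate e * V = V * ampliate e" unfolding e_def using transfer[of f] fX by blast
  have ec: "e \<in> carrier_mat n n"
    unfolding e_def by (rule mult_carrier_mat[OF mult_carrier_mat[OF Qc(1) real_diag_dim(3)] Qc(2)])
  have ff: "(\<lambda>i. f i * f i) = f" by (rule ext) (simp add: f_def)
  have ee: "e * e = e"
    unfolding e_def unitary_conj_mult[OF Q real_diag_dim(3) real_diag_dim(3)] real_diag_mult ff ..
  have "mat_adjoint (real_diag n f) = real_diag n f" by (rule eq_matI) auto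
  then have ea: "mat_adjoint e = e" unfolding e_def by (simp add: mat_adjoint_mult dQ mat_mult_assoc)
  have eea: "ampliate e * ampliate e = (ampliate e :: 'a mat)"
    by (simp only: ampliate_mult[OF ec ec, symmetric] ee)
  have "ampliate e * V * ampliate e = V * (ampliate e * ampliate e)"
    unfolding eV using carrier_matD[OF ec] by (simp add: dQ mat_mult_assoc)
  then have inv: "ampliate e * V * ampliate e = V * ampliate e" unfolding eea .
  have e01: "e = 0\<^sub>m n n \<or> e = 1\<^sub>m n"
    using irr ec ea ee inv unfolding irreducible_rep_def dQ by blast
  have De: "mat_adjoint Q * e * Q = real_diag n f"
  proof -
    have "mat_adjoint Q * e * Q = (mat_adjoint Q * Q) * real_diag n f * (mat_adjoint Q * Q)"
      unfolding e_def by (simp add: dQ mat_mult_assoc)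
    then show ?thesis unfolding QQ by (simp add: mat_mult_one)
  qed
  have "e \<noteq> 0\<^sub>m n n"
  proof
    assume "e = 0\<^sub>m n n"
    then have "real_diag n f = 0\<^sub>m n n" unfolding De[symmetric] by (simp add: dQ mat_mult_zero)
    then have "real_diag n f $$ (0, 0) = 0" using n by simp
    then show False using n by (simp add: f_def)
  qed
  then have "e = 1\<^sub>m n" using e01 by blast
  then have f1: "real_diag n f = 1\<^sub>m n" unfolding De[symmetric] by (simp add: dQ mat_mult_one QQ)
  have d0: "d i = d 0" if "i < n" for i
    using arg_cong[OF f1, of "\<lambda>M. M $$ (i, i)"] that by (simp add: f_def split: if_splits)
  have dd: "real_diag n d = real_diag n (\<lambda>_. d 0)"
  proof (rule eq_matI)
    fix i j assume "i < dim_row (real_diag n (\<lambda>_. d 0))" "j < dim_col (real_diag n (\<lambda>_. d 0))"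
    then show "real_diag n d $$ (i, j) = real_diag n (\<lambda>_. d 0) $$ (i, j)" using d0[of i] by (cases "i = j") simp_all
  qed simp_all
  have "real_diag n (\<lambda>_. d 0) * mat_adjoint Q = mat_adjoint Q * real_diag n (\<lambda>_. d 0)"
  proof (rule eq_matI)
    fix i j assume "i < dim_row (mat_adjoint Q * real_diag n (\<lambda>_. d 0))" "j < dim_col (mat_adjoint Q * real_diag n (\<lambda>_. d 0))"
    then have ij: "i < n" "j < n" by (auto simp: dQ)
    show "(real_diag n (\<lambda>_. d 0) * mat_adjoint Q) $$ (i, j) = (mat_adjoint Q * real_diag n (\<lambda>_. d 0)) $$ (i, j)"
      unfolding real_diag_mult_index[OF Qc(2) ij] mult_real_diag_index[OF Qc(2) ij] by (rule mult.commute)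
  qed (auto simp: dQ)
  then have "H = (Q * mat_adjoint Q) * real_diag n (\<lambda>_. d 0)" unfolding Hd dd by (simp add: dQ mat_mult_assoc)
  then have "H = real_diag n (\<lambda>_. d 0)" unfolding QQ by (simp add: mat_mult_one)
  then show ?thesis by (rule that)
qed

text \<open>
  Both \<open>S\<^sup>* S\<close> and \<open>S S\<^sup>*\<close> are scalars \<open>c\<close> and \<open>c'\<close>. They are equal, since
  \<open>S (S\<^sup>* S) = (S S\<^sup>*) S\<close>, and nonzero, and the traces \<open>n c\<close> and \<open>m c\<close> agree.
\<close>

lemma schur_dim_eq:
  fixes V W :: "'a::cstar_algebra mat"
  assumes V: "irreducible_rep V" "unitary_over n V" "0 < n" and W: "irreducible_rep W" "unitary_over m W" "0 < m"
    and S: "S \<in> carrier_mat m n" "ampliate S * V = W * ampliate S" "S \<noteq> 0\<^sub>m m n"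
  shows "n = m"
proof -
  have Vc: "V \<in> carrier_mat n n" and Wc: "W \<in> carrier_mat m m" using V W by (simp_all add: unitary_over_def)
  let ?S = "mat_adjoint S"
  have Sc': "?S \<in> carrier_mat n m" using S by simp
  note d = carrier_matD[OF S(1)] carrier_matD[OF Vc] carrier_matD[OF Wc]
  have S': "ampliate ?S * W = V * ampliate ?S" by (rule intertwiner_star[OF V(2) W(2) S(1,2)])
  have "ampliate (?S * S) * V = ampliate ?S * (ampliate S * V)"
    unfolding ampliate_mult[OF Sc' S(1)] by (simp add: d mat_mult_assoc)
  also have "\<dots> = (ampliate ?S * W) * ampliate S" unfolding S(2) by (simp add: d mat_mult_assoc)
  also have "\<dots> = V * ampliate (?S * S)" unfolding S' ampliate_mult[OF Sc' S(1)] by (simp add: d mat_mult_assoc)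
  finally have 1: "?S * S \<in> commutant n V"
    unfolding commutant_def using mult_carrier_mat[OF Sc' S(1)] by blast
  have "ampliate (S * ?S) * W = ampliate S * (ampliate ?S * W)"
    unfolding ampliate_mult[OF S(1) Sc'] by (simp add: d mat_mult_assoc)
  also have "\<dots> = (ampliate S * V) * ampliate ?S" unfolding S' by (simp add: d mat_mult_assoc)
  also have "\<dots> = W * ampliate (S * ?S)" unfolding S(2) ampliate_mult[OF S(1) Sc'] by (simp add: d mat_mult_assoc)
  finally have 2: "S * ?S \<in> commutant m W"
    unfolding commutant_def using mult_carrier_mat[OF S(1) Sc'] by blast
  have h: "mat_adjoint (?S * S) = ?S * S" "mat_adjoint (S * ?S) = S * ?S"
    by (simp_all add: mat_adjoint_mult d)
  obtain c where c: "?S * S = real_diag n (\<lambda>_. c)"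
    using irreducible_hermitian_scalar[OF V 1 h(1)] by blast
  obtain c' where c': "S * ?S = real_diag m (\<lambda>_. c')"
    using irreducible_hermitian_scalar[OF W 2 h(2)] by blast
  have "\<exists>i<m. \<exists>j<n. S $$ (i, j) \<noteq> 0"
  proof (rule ccontr)
    assume "\<not> ?thesis"
    then have "S = 0\<^sub>m m n" by (intro eq_matI) (simp_all add: d)
    then show False using S(3) by simp
  qed
  then obtain i j where ij: "i < m" "j < n" "S $$ (i, j) \<noteq> 0" by blast
  have "S * (?S * S) = (S * ?S) * S" by (simp add: d mat_mult_assoc)
  then have "S * real_diag n (\<lambda>_. c) = real_diag m (\<lambda>_. c') * S" unfolding c c' .
  from arg_cong[OF this, of "\<lambda>M. M $$ (i, j)"] have "S $$ (i, j) * of_real c = of_real c' * S $$ (i, j)"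
    unfolding mult_real_diag_index[OF S(1) ij(1,2)] real_diag_mult_index[OF S(1) ij(1,2)] .
  then have cc: "c = c'" using ij(3) by simp
  have "trace_mat (S * ?S) = trace_mat (?S * S)" by (rule trace_mat_commute[OF S(1) Sc'])
  then have "complex_of_real (real m * c') = of_real (real n * c)"
    unfolding c c' by (simp add: trace_mat_sum)
  then have tr: "real m * c = real n * c" unfolding of_real_eq_iff cc .
  have "c \<noteq> 0"
  proof
    assume "c = 0"
    then have "trace_mat (S * ?S) = 0" unfolding c' cc[symmetric] by (simp add: trace_mat_sum)
    then have "S = 0\<^sub>m m n" using trace_mult_adjoint_eq_0[of S] by (simp add: d)
    then show False using S(3) by simp
  qed
  then show ?thesis using tr by simp
qed

lemma block_inclusions_adjoint:
  fixes D D' :: "'a::cstar_algebra mat"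
  assumes D: "D \<in> carrier_mat k k" and D': "D' \<in> carrier_mat k' k'"
  defines "J \<equiv> summand_inclusion (k + k') k 0 :: complex mat"
    and "J' \<equiv> summand_inclusion (k + k') k' k :: complex mat"
  shows "ampliate (mat_adjoint J) * four_block_mat D (0\<^sub>m k k') (0\<^sub>m k' k) D' = D * ampliate (mat_adjoint J)"
    and "ampliate (mat_adjoint J') * four_block_mat D (0\<^sub>m k k') (0\<^sub>m k' k) D' = D' * ampliate (mat_adjoint J')"
proof -
  let ?F = "four_block_mat D (0\<^sub>m k k') (0\<^sub>m k' k) D'"
  let ?F' = "four_block_mat (star_mat D) (0\<^sub>m k k') (0\<^sub>m k' k) (star_mat D')"
  have F: "?F \<in> carrier_mat (k + k') (k + k')" by (rule four_block_carrier_mat[OF D D'])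
  have sD: "star_mat D \<in> carrier_mat k k" "star_mat D' \<in> carrier_mat k' k'" using D D' by simp_all
  have F': "?F' \<in> carrier_mat (k + k') (k + k')" by (rule four_block_carrier_mat[OF sD])
  have sF: "star_mat ?F' = ?F"
  proof (rule eq_matI)
    fix i j assume "i < dim_row ?F" "j < dim_col ?F"
    then show "star_mat ?F' $$ (i, j) = ?F $$ (i, j)"
      using carrier_matD[OF D] carrier_matD[OF D'] by (simp add: star_star)
  qed (use carrier_matD[OF D] carrier_matD[OF D'] in simp_all)
  have J: "(ampliate J :: 'a mat) \<in> carrier_mat (k + k') k" "(ampliate J' :: 'a mat) \<in> carrier_mat (k + k') k'"
    by (simp_all add: J_def J'_def)
  have "star_mat (?F' * ampliate J) = star_mat (ampliate J * star_mat D)"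
    unfolding J_def by (simp only: block_inclusions(4)[OF sD])
  then show "ampliate (mat_adjoint J) * ?F = D * ampliate (mat_adjoint J)"
    unfolding star_mat_mult[OF F' J(1)] star_mat_mult[OF J(1) sD(1)] sF star_mat_ampliate star_mat_star_mat .
  have "star_mat (?F' * ampliate J') = star_mat (ampliate J' * star_mat D')"
    unfolding J'_def by (simp only: block_inclusions(5)[OF sD])
  then show "ampliate (mat_adjoint J') * ?F = D' * ampliate (mat_adjoint J')"
    unfolding star_mat_mult[OF F' J(2)] star_mat_mult[OF J(2) sD(2)] sF star_mat_ampliate star_mat_star_mat .
qed

lemma summand_isometry_exists:
  fixes Vs :: "'a::cstar_algebra mat list"
  assumes "V \<in> set Vs" "\<And>V. V \<in> set Vs \<Longrightarrow> dim_col V = dim_row V"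
  shows "\<exists>J \<in> carrier_mat (dim_row (diag_block_mat Vs)) (dim_row V).
    mat_adjoint J * J = 1\<^sub>m (dim_row V) \<and> diag_block_mat Vs * ampliate J = ampliate J * V"
  using assms
proof (induction Vs)
  case Nil
  then show ?case by simp
next
  case (Cons W Ws)
  define k k' where "k = dim_row W" and "k' = dim_row (diag_block_mat Ws)"
  have sq: "dim_col W = k" "dim_col (diag_block_mat Ws) = k'"
    unfolding k_def k'_def using Cons.prems(2) by (simp, intro diag_block_mat_square_dim, simp)
  have W: "W \<in> carrier_mat k k" and D: "diag_block_mat Ws \<in> carrier_mat k' k'"
    by (rule carrier_matI[OF k_def[symmetric] sq(1)], rule carrier_matI[OF k'_def[symmetric] sq(2)])
  define F where "F = diag_block_mat (W # Ws)"
  have F_eq: "F = four_block_mat W (0\<^sub>m k k') (0\<^sub>m k' k) (diag_block_mat Ws)"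
    unfolding F_def diag_block_mat.simps Let_def sq k_def[symmetric] k'_def[symmetric] ..
  have Fc: "F \<in> carrier_mat (k + k') (k + k')" unfolding F_eq by (rule four_block_carrier_mat[OF W D])
  note dF = carrier_matD[OF Fc]
  let ?J = "summand_inclusion (k + k') k 0 :: complex mat" and ?J' = "summand_inclusion (k + k') k' k :: complex mat"
  show ?case
  proof (cases "V = W")
    case True
    have "F * ampliate ?J = ampliate ?J * W" unfolding F_eq by (rule block_inclusions(4)[OF W D])
    then show ?thesis
      unfolding F_def[symmetric] dF True k_def[symmetric]
      by (intro bexI[of _ ?J] conjI block_inclusions(1)) simp_all
  next
    case False
    then have "V \<in> set Ws" using Cons.prems(1) by simp
    then obtain J where J: "J \<in> carrier_mat k' (dim_row V)" "mat_adjoint J * J = 1\<^sub>m (dim_row V)"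
      and JV: "diag_block_mat Ws * ampliate J = ampliate J * V"
      using Cons.IH Cons.prems(2) by (auto simp: k'_def)
    have J'c: "?J' \<in> carrier_mat (k + k') k'" by simp
    have dV: "dim_col V = dim_row V" using Cons.prems by simp
    note dd = carrier_matD[OF J(1)] carrier_matD[OF D] dF dV
    have "mat_adjoint (?J' * J) * (?J' * J) = mat_adjoint J * (mat_adjoint ?J' * ?J') * J"
      by (simp add: mat_adjoint_mult dd mat_mult_assoc)
    also have "\<dots> = 1\<^sub>m (dim_row V)" unfolding block_inclusions(2) by (simp add: dd mat_mult_one J(2))
    finally have 1: "mat_adjoint (?J' * J) * (?J' * J) = 1\<^sub>m (dim_row V)" .
    have "F * ampliate (?J' * J) = (F * ampliate ?J') * ampliate J"
      unfolding ampliate_mult[OF J'c J(1)] by (simp add: dd mat_mult_assoc)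
    also have "F * ampliate ?J' = ampliate ?J' * diag_block_mat Ws" unfolding F_eq by (rule block_inclusions(5)[OF W D])
    also have "ampliate ?J' * diag_block_mat Ws * ampliate J = ampliate ?J' * (diag_block_mat Ws * ampliate J)"
      by (simp add: dd mat_mult_assoc)
    also have "\<dots> = ampliate (?J' * J) * V"
      unfolding JV ampliate_mult[OF J'c J(1)] by (simp add: dd mat_mult_assoc)
    finally have 2: "F * ampliate (?J' * J) = ampliate (?J' * J) * V" .
    show ?thesis
      unfolding F_def[symmetric] dF using 1 2 mult_carrier_mat[OF J'c J(1)] by blast
  qed
qed

lemma nonzero_component_exists:
  fixes X :: "'a::cstar_algebra mat"
  assumes X: "X \<in> carrier_mat n n"
  shows "(\<And>W. W \<in> set Ws \<Longrightarrow> dim_col W = dim_row W) \<Longrightarrow>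
    M \<in> carrier_mat (dim_row (diag_block_mat Ws)) n \<Longrightarrow> ampliate M * X = diag_block_mat Ws * ampliate M \<Longrightarrow>
    M \<noteq> 0\<^sub>m (dim_row (diag_block_mat Ws)) n \<Longrightarrow>
    \<exists>W\<in>set Ws. \<exists>S\<in>carrier_mat (dim_row W) n. S \<noteq> 0\<^sub>m (dim_row W) n \<and> ampliate S * X = W * ampliate S"
proof (induction Ws arbitrary: M)
  case Nil
  have "dim_row M = 0" "dim_col M = n" using carrier_matD[OF Nil.prems(2)] by simp_all
  then have "M = 0\<^sub>m 0 n" by (intro eq_matI) simp_all
  then show ?case using Nil.prems(4) by simp
next
  case (Cons W Ws)
  define k k' where "k = dim_row W" and "k' = dim_row (diag_block_mat Ws)"
  have sq: "dim_col W = k" "dim_col (diag_block_mat Ws) = k'"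
    unfolding k_def k'_def using Cons.prems(1) by (simp, intro diag_block_mat_square_dim, simp)
  have W: "W \<in> carrier_mat k k" and D: "diag_block_mat Ws \<in> carrier_mat k' k'"
    by (rule carrier_matI[OF k_def[symmetric] sq(1)], rule carrier_matI[OF k'_def[symmetric] sq(2)])
  define F where "F = diag_block_mat (W # Ws)"
  have F_eq: "F = four_block_mat W (0\<^sub>m k k') (0\<^sub>m k' k) (diag_block_mat Ws)"
    unfolding F_def diag_block_mat.simps Let_def sq k_def[symmetric] k'_def[symmetric] ..
  have Fc: "F \<in> carrier_mat (k + k') (k + k')" unfolding F_eq by (rule four_block_carrier_mat[OF W D])
  note dF = carrier_matD[OF Fc]
  have M: "M \<in> carrier_mat (k + k') n" and MX: "ampliate M * X = F * ampliate M" and M0: "M \<noteq> 0\<^sub>m (k + k') n"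
    using Cons.prems(2-4) unfolding F_def[symmetric] dF by blast+
  define J J' where "J = (summand_inclusion (k + k') k 0 :: complex mat)"
    and "J' = (summand_inclusion (k + k') k' k :: complex mat)"
  have J: "mat_adjoint J \<in> carrier_mat k (k + k')" and J': "mat_adjoint J' \<in> carrier_mat k' (k + k')"
    by (simp_all add: J_def J'_def)
  have dJ: "dim_row J = k + k'" "dim_col J = k" "dim_row J' = k + k'" "dim_col J' = k'" by (simp_all add: J_def J'_def)
  note dd = carrier_matD[OF M] carrier_matD[OF X] carrier_matD[OF W] carrier_matD[OF D] dF dJ
  have FJ: "ampliate (mat_adjoint J) * F = W * ampliate (mat_adjoint J)"
    "ampliate (mat_adjoint J') * F = diag_block_mat Ws * ampliate (mat_adjoint J')"
    unfolding F_eq J_def J'_def by (rule block_inclusions_adjoint(1)[OF W D], rule block_inclusions_adjoint(2)[OF W D])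
  define S S' where "S = mat_adjoint J * M" and "S' = mat_adjoint J' * M"
  have S: "S \<in> carrier_mat k n" and S': "S' \<in> carrier_mat k' n"
    unfolding S_def S'_def by (rule mult_carrier_mat[OF J M], rule mult_carrier_mat[OF J' M])
  have "ampliate S * X = ampliate (mat_adjoint J) * (ampliate M * X)"
    unfolding S_def ampliate_mult[OF J M] by (simp add: dd mat_mult_assoc)
  also have "\<dots> = (ampliate (mat_adjoint J) * F) * ampliate M" unfolding MX by (simp add: dd mat_mult_assoc)
  also have "\<dots> = W * ampliate S" unfolding FJ S_def ampliate_mult[OF J M] by (simp add: dd mat_mult_assoc)
  finally have SX: "ampliate S * X = W * ampliate S" .
  have "ampliate S' * X = ampliate (mat_adjoint J') * (ampliate M * X)"
    unfolding S'_def ampliate_mult[OF J' M] by (simp add: dd mat_mult_assoc)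
  also have "\<dots> = (ampliate (mat_adjoint J') * F) * ampliate M" unfolding MX by (simp add: dd mat_mult_assoc)
  also have "\<dots> = diag_block_mat Ws * ampliate S'" unfolding FJ S'_def ampliate_mult[OF J' M] by (simp add: dd mat_mult_assoc)
  finally have SX': "ampliate S' * X = diag_block_mat Ws * ampliate S'" .
  show ?case
  proof (cases "S = 0\<^sub>m k n")
    case False
    then show ?thesis using S SX unfolding k_def by (meson list.set_intros(1))
  next
    case True
    have "S' \<noteq> 0\<^sub>m k' n"
    proof
      assume S'0: "S' = 0\<^sub>m k' n"
      have "M = (J * mat_adjoint J + J' * mat_adjoint J') * M"
        unfolding J_def J'_def block_inclusions(3) by (simp add: dd mat_mult_one)
      also have "\<dots> = J * S + J' * S'" unfolding S_def S'_def by (simp add: dd mat_mult_assoc mat_mult_add_left)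
      also have "\<dots> = 0\<^sub>m (k + k') n" unfolding True S'0 by (simp add: dd mat_mult_zero mat_add_zero)
      finally show False using M0 by simp
    qed
    then obtain W' where "W' \<in> set Ws"
      "\<exists>S\<in>carrier_mat (dim_row W') n. S \<noteq> 0\<^sub>m (dim_row W') n \<and> ampliate S * X = W' * ampliate S"
      using Cons.IH[OF Cons.prems(1) S'[unfolded k'_def] SX'] unfolding k'_def by (meson list.set_intros(2))
    then show ?thesis by (meson list.set_intros(2))
  qed
qed

text \<open>
  An irreducible summand of the first decomposition embeds into the direct sum of the second one;
  some component of the embedding is nonzero, and Schur's lemma applies to it.
\<close>

lemma decomposition_dims_subset:
  assumes dV: "decomposition \<Delta> \<tau> A Vs" and dW: "decomposition \<Delta> \<tau> A Ws" and A: "A \<in> carrier_mat n n"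
  shows "dim_row ` set Vs \<subseteq> dim_row ` set Ws"
proof
  fix v assume "v \<in> dim_row ` set Vs"
  then obtain V where V: "V \<in> set Vs" "v = dim_row V" by auto
  have u: "unitary_over (dim_row X) X" "0 < dim_row X" "irreducible_rep X" if "X \<in> set Vs \<or> X \<in> set Ws" for X
    using that dV dW by (auto simp: decomposition_def unitary_representation_iff)
  have sq: "dim_col X = dim_row X" if "X \<in> set Vs \<or> X \<in> set Ws" for X
    using u(1)[OF that] unfolding unitary_over_def by (blast dest: carrier_matD(2))
  define D E where "D = diag_block_mat Vs" and "E = diag_block_mat Ws"
  obtain T where T: "T \<in> Mor A D" "invertible_mat T" using dV by (auto simp: decomposition_def equivalent_def D_def)
  obtain S where S: "S \<in> Mor A E" "invertible_mat S" using dW by (auto simp: decomposition_def equivalent_def E_def)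
  have T0: "T \<in> carrier_mat (dim_row D) n" and TA: "ampliate T * A = D * ampliate T"
    and S0: "S \<in> carrier_mat (dim_row E) n" and SA: "ampliate S * A = E * ampliate S"
    using T(1) S(1) carrier_matD(1)[OF A] by (auto simp: Mor_def)
  obtain T' where T': "dim_row D = n" "T' \<in> carrier_mat n n" "T * T' = 1\<^sub>m n" "T' * T = 1\<^sub>m n"
    using invertible_matE[OF T(2) T0] by blast
  obtain S' where S': "dim_row E = n" "S' \<in> carrier_mat n n" "S * S' = 1\<^sub>m n" "S' * S = 1\<^sub>m n"
    using invertible_matE[OF S(2) S0] by blast
  have Tc: "T \<in> carrier_mat n n" and Sc: "S \<in> carrier_mat n n" using T0 S0 T' S' by simp_all
  have "dim_col D = dim_row D" "dim_col E = dim_row E"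
    unfolding D_def E_def by (rule diag_block_mat_square_dim, simp add: sq)+
  then have dims: "dim_row D = n" "dim_col D = n" "dim_row E = n" "dim_col E = n" using T' S' by simp_all
  note d = dims carrier_matD[OF A] carrier_matD[OF Tc] carrier_matD[OF Sc] carrier_matD[OF T'(2)] carrier_matD[OF S'(2)]
  have TD: "ampliate T' * D = A * ampliate T'"
  proof -
    have "ampliate T' * D = ampliate T' * D * ampliate (T * T')" unfolding T'(3) by (simp add: d mat_mult_one)
    also have "\<dots> = ampliate T' * (D * ampliate T) * ampliate T'"
      unfolding ampliate_mult[OF Tc T'(2)] by (simp add: d mat_mult_assoc)
    also have "\<dots> = ampliate (T' * T) * A * ampliate T'"
      unfolding TA[symmetric] ampliate_mult[OF T'(2) Tc] by (simp add: d mat_mult_assoc)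
    also have "\<dots> = A * ampliate T'" unfolding T'(4) by (simp add: d mat_mult_one)
    finally show ?thesis .
  qed
  obtain J where J: "J \<in> carrier_mat n v" "mat_adjoint J * J = 1\<^sub>m v" and JV: "D * ampliate J = ampliate J * V"
    using summand_isometry_exists[OF V(1)] sq unfolding D_def[symmetric] dims V(2) by blast
  have Vc: "V \<in> carrier_mat v v" using sq V by (auto intro: carrier_matI)
  note dJ = d carrier_matD[OF J(1)] carrier_matD[OF Vc]
  have T'J: "T' * J \<in> carrier_mat n v" by (rule mult_carrier_mat[OF T'(2) J(1)])
  define M where "M = S * (T' * J)"
  have M: "M \<in> carrier_mat n v" unfolding M_def by (rule mult_carrier_mat[OF Sc T'J])
  have aM: "ampliate M = ampliate S * (ampliate T' * ampliate J)"
    unfolding M_def ampliate_mult[OF Sc T'J] ampliate_mult[OF T'(2) J(1)] ..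
  have "ampliate M * V = ampliate S * (ampliate T' * (ampliate J * V))" unfolding aM by (simp add: dJ mat_mult_assoc)
  also have "\<dots> = ampliate S * ((ampliate T' * D) * ampliate J)" unfolding JV[symmetric] by (simp add: dJ mat_mult_assoc)
  also have "\<dots> = (ampliate S * A) * (ampliate T' * ampliate J)" unfolding TD by (simp add: dJ mat_mult_assoc)
  also have "\<dots> = E * ampliate M" unfolding SA aM by (simp add: dJ mat_mult_assoc)
  finally have MV: "ampliate M * V = E * ampliate M" .
  have vpos: "0 < v" using u(2) V by simp
  have "M \<noteq> 0\<^sub>m n v"
  proof
    assume 0: "M = 0\<^sub>m n v"
    have "1\<^sub>m v = mat_adjoint J * ((T * ((S' * S) * T')) * J)"
      unfolding S'(4) by (simp add: dJ mat_mult_one T'(3) J(2))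
    also have "\<dots> = mat_adjoint J * (T * (S' * M))" unfolding M_def by (simp add: dJ mat_mult_assoc)
    also have "\<dots> = 0\<^sub>m v v" unfolding 0 by (simp add: dJ mat_mult_zero)
    finally have "(1\<^sub>m v :: complex mat) $$ (0, 0) = 0\<^sub>m v v $$ (0, 0)" by simp
    then show False using vpos by simp
  qed
  then obtain W P where W: "W \<in> set Ws" and P: "P \<in> carrier_mat (dim_row W) v" "P \<noteq> 0\<^sub>m (dim_row W) v" "ampliate P * V = W * ampliate P"
    using nonzero_component_exists[OF Vc, of Ws M] sq M MV unfolding E_def[symmetric] dims by blast
  have "v = dim_row W"
    by (rule schur_dim_eq[of V v W "dim_row W" P]) (use u[of V] u[of W] V W P in auto)
  then show "v \<in> dim_row ` set Ws" using W by auto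
qed

lemma max_irrep_dim_eq:
  assumes "decomposition \<Delta> \<tau> (tensor_power U n) Vs" and "tensor_power U n \<in> carrier_mat m m"
  shows "max_irrep_dim \<Delta> \<tau> U n = Max (dim_row ` set Vs)"
  unfolding max_irrep_dim_def
proof (rule the_equality)
  show "\<exists>Vs'. decomposition \<Delta> \<tau> (tensor_power U n) Vs' \<and> Max (dim_row ` set Vs) = Max (dim_row ` set Vs')"
    using assms by blast
  fix k assume "\<exists>Vs. decomposition \<Delta> \<tau> (tensor_power U n) Vs \<and> k = Max (dim_row ` set Vs)"
  then obtain Ws where "decomposition \<Delta> \<tau> (tensor_power U n) Ws" "k = Max (dim_row ` set Ws)" by blast
  moreover from this have "dim_row ` set Vs = dim_row ` set Ws"
    using decomposition_dims_subset assms by (intro equalityI) blast+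
  ultimately show "k = Max (dim_row ` set Vs)" by simp
qed


section \<open>Tensor powers\<close>

primrec kron_power :: "'r::semiring_1 mat \<Rightarrow> nat \<Rightarrow> 'r mat" where
  "kron_power R 0 = 1\<^sub>m 1"
| "kron_power R (Suc n) = kron (kron_power R n) R"

lemma tensor_power_eq_kron_power: "tensor_power U n = kron_power U n"
  by (induction n) (simp_all add: tensor_rep_eq_kron)

lemma kron_power_carrier: "R \<in> carrier_mat d d \<Longrightarrow> kron_power R n \<in> carrier_mat (d ^ n) (d ^ n)"
proof (induction n)
  case (Suc n)
  then show ?case using kron_carrier(1)[of "kron_power R n" "d ^ n" "d ^ n" R d d] by (simp add: mult.commute)
qed simp

lemma kron_pow:
  fixes A B :: "complex mat"
  assumes "A \<in> carrier_mat n n" "B \<in> carrier_mat p p"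
  shows "kron A B ^\<^sub>m s = kron (A ^\<^sub>m s) (B ^\<^sub>m s)"
proof (induction s)
  case 0
  show ?case using carrier_matD[OF assms(1)] carrier_matD[OF assms(2)] by (simp add: kron_one)
next
  case (Suc s)
  show ?case
    unfolding pow_mat.simps Suc.IH
    by (rule kron_mult_complex[OF pow_carrier_mat[OF assms(1)] assms(1) pow_carrier_mat[OF assms(2)] assms(2)])
qed

lemma trace_kron_power_pow:
  fixes R :: "complex mat"
  assumes R: "R \<in> carrier_mat d d"
  shows "trace_mat (kron_power R n ^\<^sub>m s) = trace_mat (R ^\<^sub>m s) ^ n"
proof (induction n)
  case 0
  have "(1\<^sub>m 1 :: complex mat) ^\<^sub>m s = 1\<^sub>m 1" by (induction s) simp_all
  then show ?case by (simp add: trace_mat_sum)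
next
  case (Suc n)
  have "trace_mat (kron_power R (Suc n) ^\<^sub>m s) = trace_mat (kron (kron_power R n ^\<^sub>m s) (R ^\<^sub>m s))"
    using kron_pow[OF kron_power_carrier[OF R, of n] R, of s] by simp
  also have "\<dots> = trace_mat (kron_power R n ^\<^sub>m s) * trace_mat (R ^\<^sub>m s)"
    by (rule trace_mat_kron[OF pow_carrier_mat[OF kron_power_carrier[OF R]] pow_carrier_mat[OF R]])
  finally show ?case by (simp only: Suc.IH power_Suc mult.commute)
qed

lemma gram_kron: assumes "gram R" "gram S" shows "gram (kron R S)"
proof -
  obtain G H where G: "R = G * mat_adjoint G" and H: "S = H * mat_adjoint H" using assms by (auto simp: gram_def)
  have "kron R S = kron G H * mat_adjoint (kron G H)"
    unfolding G H mat_adjoint_kron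
    by (rule kron_mult_complex[symmetric, of _ "dim_row G" "dim_col G" _ "dim_row G" _ "dim_row H" "dim_col H" _ "dim_row H"])
      (auto intro: carrier_matI)
  then show ?thesis unfolding gram_def by blast
qed

lemma comultiplicative_kron:
  assumes \<Delta>: "\<And>x y. \<Delta> (x * y) = \<Delta> x * \<Delta> y" and \<tau>: "\<And>a b a' b'. \<tau> a b * \<tau> a' b' = \<tau> (a * a') (b * b')"
    and A: "A \<in> carrier_mat n n" "comultiplicative \<Delta> \<tau> A" and B: "B \<in> carrier_mat p p" "comultiplicative \<Delta> \<tau> B"
  shows "comultiplicative \<Delta> \<tau> (kron A B)"
proof -
  have map: "map_mat h (kron A B) = kron (map_mat h A) (map_mat h B)" if h: "\<And>x y. h (x * y) = h x * h y"
    for h :: "'a \<Rightarrow> 'b"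
  proof (rule mat_eq_by_pairs[of _ n p n p])
    have hA: "map_mat h A \<in> carrier_mat n n" "map_mat h B \<in> carrier_mat p p" using A B by simp_all
    fix i k j l assume ij: "i < n" "k < p" "j < n" "l < p"
    have "map_mat h (kron A B) $$ (i * p + k, j * p + l) = h (kron A B $$ (i * p + k, j * p + l))"
      using ij carrier_matD[OF A(1)] carrier_matD[OF B(1)] by (simp add: pair_index_less)
    also have "\<dots> = kron (map_mat h A) (map_mat h B) $$ (i * p + k, j * p + l)"
      using ij A B by (simp add: kron_index[OF A(1) B(1)] kron_index[OF hA] h)
    finally show "map_mat h (kron A B) $$ (i * p + k, j * p + l) = kron (map_mat h A) (map_mat h B) $$ (i * p + k, j * p + l)" .
  qed (use carrier_matD[OF A(1)] carrier_matD[OF B(1)] in \<open>auto intro!: carrier_matI\<close>)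
  let ?f = "\<lambda>a. \<tau> a 1" and ?g = "\<lambda>a. \<tau> 1 a"
  have "map_mat \<Delta> (kron A B) = kron (map_mat ?f A * map_mat ?g A) (map_mat ?f B * map_mat ?g B)"
    unfolding map[OF \<Delta>] using A(2) B(2) by (simp only: comultiplicative_def)
  also have "\<dots> = kron (map_mat ?f A) (map_mat ?f B) * kron (map_mat ?g A) (map_mat ?g B)"
    by (rule kron_mult[symmetric, of _ n n _ n _ p p _ p]) (use A B in \<open>simp_all add: \<tau>\<close>)
  also have "\<dots> = map_mat ?f (kron A B) * map_mat ?g (kron A B)"
    by (simp add: map \<tau>)
  finally show ?thesis unfolding comultiplicative_def .
qed

lemma modular_data_kron_power:
  fixes U :: "'a::cstar_algebra mat"
  assumes U: "unitary_over d U" and m: "modular_pair d U R N" and g: "gram R" "gram N" and t: "traces_agree d U R N"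
  shows "unitary_over (d ^ n) (kron_power U n) \<and> modular_pair (d ^ n) (kron_power U n) (kron_power R n) (kron_power N n) \<and>
    gram (kron_power R n) \<and> gram (kron_power N n) \<and>
    traces_agree (d ^ n) (kron_power U n) (kron_power R n) (kron_power N n)"
proof (induction n)
  case 0
  have s: "star_mat (1\<^sub>m 1 :: 'a mat) = 1\<^sub>m 1" by (rule eq_matI) auto
  have "gram (1\<^sub>m 1)" unfolding gram_def by (rule exI[of _ "1\<^sub>m 1"]) simp
  then show ?case
    by (simp add: s unitary_over_def modular_pair_def inverse_pair_def traces_agree_def del: One_nat_def)
next
  case (Suc n)
  have c: "kron_power U n \<in> carrier_mat (d ^ n) (d ^ n)" "U \<in> carrier_mat d d"
    using Suc.IH U by (simp_all add: unitary_over_def)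
  show ?case
    unfolding kron_power.simps power_Suc2
    using Suc.IH U m g t
    by (intro conjI unitary_over_kron modular_pair_kron[OF c] gram_kron traces_agree_kron) blast+
qed


section \<open>Eigenvalues\<close>

text \<open>
  Over the complex numbers a matrix with nonnegative quadratic form is hermitian: in an eigenbasis
  of the hermitian matrix \<open>\<i> (A - A\<^sup>*)\<close> the diagonal entries of \<open>A\<close> are still nonnegative, hence
  real, so that all eigenvalues of that matrix vanish.
\<close>

lemma positive_mat_gram:
  assumes A: "A \<in> carrier_mat n n" and pos: "positive_mat A"
  shows "gram A"
proof -
  have diag: "0 \<le> (mat_adjoint Q * A * Q) $$ (i, i)" if Q: "Q \<in> carrier_mat n n" and i: "i < n" for Q i
  proof -
    let ?v = "col Q i"
    have v: "?v \<in> carrier_vec n" using Q by (simp add: carrier_vecI)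
    have Q': "mat_adjoint Q \<in> carrier_mat n n" using Q by simp
    have AQ: "A * Q \<in> carrier_mat n n" by (rule mult_carrier_mat[OF A Q])
    have Av: "A *\<^sub>v ?v = col (A * Q) i" by (rule col_mult2[OF A Q i, symmetric])
    have "(A *\<^sub>v ?v) \<bullet>c ?v = (\<Sum>l<n. (A * Q) $$ (l, i) * cnj (Q $$ (l, i)))"
      unfolding Av using carrier_matD[OF AQ] carrier_matD[OF Q] i
      by (simp add: scalar_prod_def atLeast0LessThan del: index_mult_mat(1))
    also have "\<dots> = (\<Sum>l<n. mat_adjoint Q $$ (i, l) * (A * Q) $$ (l, i))"
      using carrier_matD[OF Q] i by (intro sum.cong refl) (simp add: mult.commute del: index_mult_mat(1))
    also have "\<dots> = (mat_adjoint Q * (A * Q)) $$ (i, i)" by (rule mult_mat_index'[OF Q' AQ i i, symmetric])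
    also have "mat_adjoint Q * (A * Q) = mat_adjoint Q * A * Q"
      using carrier_matD[OF Q] carrier_matD[OF A] by (simp add: mat_mult_assoc)
    finally have eq: "(A *\<^sub>v ?v) \<bullet>c ?v = (mat_adjoint Q * A * Q) $$ (i, i)" .
    have "0 \<le> (A *\<^sub>v ?v) \<bullet>c ?v" using pos v carrier_matD[OF A] by (simp add: positive_mat_def)
    then show ?thesis unfolding eq .
  qed
  have diag_real: "cnj ((mat_adjoint Q * A * Q) $$ (i, i)) = (mat_adjoint Q * A * Q) $$ (i, i)"
    if "Q \<in> carrier_mat n n" "i < n" for Q i
    using diag[OF that] by (simp add: less_eq_complex_def complex_eq_iff del: index_mult_mat(1))
  define K where "K = \<i> \<cdot>\<^sub>m (A - mat_adjoint A)"
  have A': "mat_adjoint A \<in> carrier_mat n n" using A by simp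
  have K: "K \<in> carrier_mat n n" unfolding K_def by (rule smult_carrier_mat[OF minus_carrier_mat[OF A']])
  have "mat_adjoint K = K"
    by (rule eq_matI) (use carrier_matD[OF A] in \<open>simp_all add: K_def\<close>, simp add: algebra_simps)
  then obtain Q k where Q: "unitary_mat n Q" and Kd: "K = Q * real_diag n k * mat_adjoint Q"
    using hermitian_diagonalization[OF K] by blast
  have Qc: "Q \<in> carrier_mat n n" and Q': "mat_adjoint Q \<in> carrier_mat n n"
    and QQ: "mat_adjoint Q * Q = 1\<^sub>m n" using Q by (auto simp: unitary_mat_def)
  note d = carrier_matD[OF Qc] carrier_matD[OF A]
  have conj_diag: "mat_adjoint Q * (Q * real_diag n x * mat_adjoint Q) * Q = real_diag n x"
    if "mat_adjoint Q * Q = 1\<^sub>m n" "Q \<in> carrier_mat n n" for x and Q :: "complex mat"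
  proof -
    have "mat_adjoint Q * (Q * real_diag n x * mat_adjoint Q) * Q = (mat_adjoint Q * Q) * real_diag n x * (mat_adjoint Q * Q)"
      using carrier_matD[OF that(2)] by (simp add: mat_mult_assoc)
    then show ?thesis unfolding that(1) by (simp add: mat_mult_one)
  qed
  let ?B = "mat_adjoint Q * A * Q"
  have B: "?B \<in> carrier_mat n n" by (rule mult_carrier_mat[OF mult_carrier_mat[OF Q' A] Qc])
  have aB: "mat_adjoint ?B = mat_adjoint Q * mat_adjoint A * Q"
    by (simp add: mat_adjoint_mult d mat_mult_assoc)
  have "real_diag n k = mat_adjoint Q * K * Q" unfolding Kd conj_diag[OF QQ Qc] ..
  also have "\<dots> = \<i> \<cdot>\<^sub>m (mat_adjoint Q * (A - mat_adjoint A) * Q)"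
    unfolding K_def using A' A minus_carrier_mat[OF A', of A]
    by (simp add: mult_smult_distrib[OF Q'] mult_smult_assoc_mat[OF mult_carrier_mat[OF Q'] Qc])
  also have "mat_adjoint Q * (A - mat_adjoint A) * Q = ?B - mat_adjoint ?B"
    unfolding aB by (simp add: d mat_mult_minus_right mat_mult_minus_left)
  finally have kB: "real_diag n k = \<i> \<cdot>\<^sub>m (?B - mat_adjoint ?B)" .
  have "k i = 0" if i: "i < n" for i
  proof -
    have "real_diag n k $$ (i, i) = \<i> * (?B $$ (i, i) - cnj (?B $$ (i, i)))"
      unfolding kB using i carrier_matD[OF B] by (simp del: index_mult_mat(1))
    then show ?thesis unfolding diag_real[OF Qc i] using i by simp
  qed
  then have "real_diag n k = 0\<^sub>m n n" by (intro eq_matI) auto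
  then have K0: "K = 0\<^sub>m n n" unfolding Kd by (simp add: d mat_mult_zero)
  have "mat_adjoint A = A"
  proof (rule eq_matI)
    fix i j assume "i < dim_row A" "j < dim_col A"
    then have ij: "i < n" "j < n" by (simp_all add: d)
    have "K $$ (i, j) = \<i> * (A $$ (i, j) - mat_adjoint A $$ (i, j))" using ij by (simp add: K_def d)
    then show "mat_adjoint A $$ (i, j) = A $$ (i, j)" unfolding K0 using ij by simp
  qed (simp_all add: d)
  then obtain P a where P: "unitary_mat n P" and Ad: "A = P * real_diag n a * mat_adjoint P"
    using hermitian_diagonalization[OF A] by blast
  have Pc: "P \<in> carrier_mat n n" and PP: "mat_adjoint P * P = 1\<^sub>m n" using P by (auto simp: unitary_mat_def)
  have a0: "0 \<le> a i" if i: "i < n" for i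
    using diag[OF Pc i] unfolding Ad conj_diag[OF PP Pc] using i by (simp add: less_eq_complex_def)
  define G where "G = P * real_diag n (\<lambda>i. sqrt (a i))"
  have aD: "mat_adjoint (real_diag n x) = real_diag n x" for x by (rule eq_matI) auto
  have "real_diag n (\<lambda>i. sqrt (a i) * sqrt (a i)) = real_diag n a"
  proof (rule eq_matI)
    fix i j assume "i < dim_row (real_diag n a)" "j < dim_col (real_diag n a)"
    then show "real_diag n (\<lambda>i. sqrt (a i) * sqrt (a i)) $$ (i, j) = real_diag n a $$ (i, j)"
      using a0[of i] by (cases "i = j") (simp_all flip: of_real_mult)
  qed simp_all
  then have "real_diag n (\<lambda>i. sqrt (a i)) * real_diag n (\<lambda>i. sqrt (a i)) = real_diag n a"
    unfolding real_diag_mult .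
  moreover have "G * mat_adjoint G = P * (real_diag n (\<lambda>i. sqrt (a i)) * real_diag n (\<lambda>i. sqrt (a i))) * mat_adjoint P"
    unfolding G_def using carrier_matD[OF Pc] by (simp add: mat_adjoint_mult aD mat_mult_assoc)
  ultimately have "A = G * mat_adjoint G" unfolding Ad by simp
  then show ?thesis unfolding gram_def by (rule exI)
qed

lemma gram_inverse:
  assumes "inverse_pair n R N" "gram R" shows "gram N"
proof -
  obtain G where G: "R = G * mat_adjoint G" using assms by (auto simp: gram_def)
  have c: "R \<in> carrier_mat n n" "N \<in> carrier_mat n n" and RN: "R * N = 1\<^sub>m n" "N * R = 1\<^sub>m n"
    using assms(1) by (auto simp: inverse_pair_def)
  have aR: "mat_adjoint R = R" unfolding G by (simp add: mat_adjoint_mult)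
  have Nc': "mat_adjoint N \<in> carrier_mat n n" using c by simp
  have "R * mat_adjoint N = mat_adjoint (N * R)" using carrier_matD[OF c(1)] carrier_matD[OF c(2)] by (simp add: mat_adjoint_mult aR)
  then have "R * mat_adjoint N = 1\<^sub>m n" by (simp add: RN)
  then have aN: "N = mat_adjoint N" by (rule mat_right_inverse_unique[OF c(1) Nc' c(2) RN(2)])
  have "dim_row G = n" using carrier_matD(1)[OF c(1)] unfolding G by simp
  then have "(N * G) * mat_adjoint (N * G) = N * (R * mat_adjoint N)"
    unfolding G using carrier_matD[OF c(2)] by (simp add: mat_adjoint_mult mat_mult_assoc)
  also have "\<dots> = N" unfolding aN[symmetric] RN by (rule right_mult_one_mat[OF c(2)])
  finally have "N = (N * G) * mat_adjoint (N * G)" by (rule sym)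
  then show ?thesis unfolding gram_def by (rule exI)
qed

lemma the_inverse_mat_eq:
  assumes A: "A \<in> carrier_mat n n" and B: "B \<in> carrier_mat n n" and AB: "A * B = 1\<^sub>m n" "B * A = 1\<^sub>m n"
  shows "the_inverse_mat A = B"
  unfolding the_inverse_mat_def inverts_mat_def
proof (rule the_equality)
  show "A * B = 1\<^sub>m (dim_row A) \<and> B * A = 1\<^sub>m (dim_row B)"
    using AB carrier_matD[OF A] carrier_matD[OF B] by simp
  fix C assume C: "A * C = 1\<^sub>m (dim_row A) \<and> C * A = 1\<^sub>m (dim_row C)"
  have "dim_col (A * C) = n" using C carrier_matD[OF A] by simp
  moreover have "dim_col (C * A) = dim_row C" using C by simp
  ultimately have Cc: "C \<in> carrier_mat n n" using carrier_matD[OF A] by (intro carrier_matI) simp_all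
  have "C * A = 1\<^sub>m n" using C carrier_matD[OF Cc] by simp
  then show "C = B" by (rule mat_right_inverse_unique[OF A B Cc _ AB(1)])
qed

text \<open>
  Equal power sums mean equal sums of all polynomials, in particular of a polynomial that vanishes
  at all values but one.
\<close>

lemma power_sums_determine_multiset:
  fixes f g :: "nat \<Rightarrow> 'k::field_char_0"
  assumes eq: "\<And>s. (\<Sum>i<n. f i ^ s) = (\<Sum>i<n. g i ^ s)"
  shows "image_mset f (mset_set {..<n}) = image_mset g (mset_set {..<n})"
proof (rule multiset_eqI)
  fix v
  have poly_eq: "(\<Sum>i<n. poly p (f i)) = (\<Sum>i<n. poly p (g i))" for p
  proof -
    have "(\<Sum>i<n. poly p (h i)) = (\<Sum>s\<le>degree p. coeff p s * (\<Sum>i<n. h i ^ s))" for h :: "nat \<Rightarrow> 'k"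
      unfolding poly_altdef sum_distrib_left by (rule sum.swap)
    then show ?thesis by (simp only: eq)
  qed
  define S where "S = f ` {..<n} \<union> g ` {..<n}"
  define p where "p = (\<Prod>u\<in>S - {v}. [:- u, 1:])"
  have fin: "finite S" by (simp add: S_def)
  have pv: "poly p v \<noteq> 0" using fin by (simp add: p_def poly_prod)
  have p0: "poly p x = 0" if "x \<in> S" "x \<noteq> v" for x
    using that fin by (auto simp: p_def poly_prod prod_zero_iff)
  have sum: "(\<Sum>i<n. poly p (h i)) = of_nat (count (image_mset h (mset_set {..<n})) v) * poly p v"
    if h: "\<And>i. i < n \<Longrightarrow> h i \<in> S" for h
  proof -
    have "(\<Sum>i<n. poly p (h i)) = (\<Sum>i\<in>{i\<in>{..<n}. h i = v}. poly p (h i))"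
      by (rule sum.mono_neutral_right) (use p0 h in auto)
    also have "\<dots> = of_nat (card {i\<in>{..<n}. h i = v}) * poly p v" by simp
    also have "card {i\<in>{..<n}. h i = v} = count (image_mset h (mset_set {..<n})) v"
    proof -
      have "h -` {v} \<inter> {..<n} = {i\<in>{..<n}. h i = v}" by auto
      then show ?thesis by (simp add: count_image_mset)
    qed
    finally show ?thesis .
  qed
  have "of_nat (count (image_mset f (mset_set {..<n})) v) * poly p v =
      of_nat (count (image_mset g (mset_set {..<n})) v) * poly p v"
  proof -
    have "(\<Sum>i<n. poly p (f i)) = of_nat (count (image_mset f (mset_set {..<n})) v) * poly p v"
      by (rule sum) (simp add: S_def)
    moreover have "(\<Sum>i<n. poly p (g i)) = of_nat (count (image_mset g (mset_set {..<n})) v) * poly p v"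
      by (rule sum) (simp add: S_def)
    ultimately show ?thesis using poly_eq[of p] by (simp only:)
  qed
  then show "count (image_mset f (mset_set {..<n})) v = count (image_mset g (mset_set {..<n})) v"
    using pv by simp
qed

lemma eigenvalue_list_unitary_conj:
  assumes Q: "unitary_mat n Q"
  shows "eigenvalue_list (Q * real_diag n r * mat_adjoint Q) = rev (sorted_list_of_multiset (image_mset r (mset_set {..<n})))"
proof -
  let ?D = "real_diag n r" and ?A = "Q * real_diag n r * mat_adjoint Q"
  have Qc: "Q \<in> carrier_mat n n" and Q': "mat_adjoint Q \<in> carrier_mat n n"
    and QQ: "mat_adjoint Q * Q = 1\<^sub>m n" "Q * mat_adjoint Q = 1\<^sub>m n" using Q by (auto simp: unitary_mat_def)
  have A: "?A \<in> carrier_mat n n"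
    by (rule mult_carrier_mat[OF mult_carrier_mat[OF Qc real_diag_dim(3)] Q'])
  have "similar_mat_wit ?A ?D Q (mat_adjoint Q)"
    by (rule similar_mat_witI[OF QQ(2,1) refl A real_diag_dim(3) Qc Q'])
  then have "char_poly ?A = char_poly ?D" by (intro char_poly_similar) (auto simp: similar_mat_def)
  also have "\<dots> = (\<Prod>a\<leftarrow>diag_mat ?D. [:- a, 1:])"
    by (rule char_poly_upper_triangular[OF real_diag_dim(3)]) (auto simp: upper_triangular_def)
  finally have cp: "char_poly ?A = (\<Prod>a\<leftarrow>diag_mat ?D. [:- a, 1:])" .
  have "proots (\<Prod>a\<leftarrow>xs. [:- a, 1:]) = mset xs" for xs :: "complex list"
  proof (induction xs)
    case (Cons x xs)
    have "(\<Prod>a\<leftarrow>xs. [:- a, 1:]) \<noteq> 0" by (auto simp: prod_list_zero_iff)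
    then have "proots ([:- x, 1:] * (\<Prod>a\<leftarrow>xs. [:- a, 1:])) = proots [:- x, 1:] + proots (\<Prod>a\<leftarrow>xs. [:- a, 1:])"
      by (intro proots_mult) auto
    then show ?case by (simp add: Cons.IH)
  qed simp
  then have pr: "proots (char_poly ?A) = mset (diag_mat ?D)" unfolding cp .
  have "diag_mat ?D = map (\<lambda>i. complex_of_real (r i)) [0..<n]"
    by (simp add: diag_mat_def)
  then have "image_mset Re (proots (char_poly ?A)) = image_mset r (mset [0..<n])"
    unfolding pr by (simp add: image_mset.compositionality o_def)
  also have "mset [0..<n] = mset_set {..<n}" by (simp add: atLeast0LessThan)
  finally show ?thesis unfolding eigenvalue_list_def by simp
qed

text \<open>
  If \<open>q = a / b\<close> were greater than \<open>1\<close>, then \<open>P\<close> would grow at least as fast as the powers of the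
  \<open>(s + 1)\<close>-st root of \<open>q\<close>.
\<close>

lemma growth_comparison:
  fixes a b :: real and P :: "nat \<Rightarrow> nat"
  assumes a: "0 \<le> a" and b: "0 \<le> b" and le: "\<And>n. a ^ n \<le> real (P n) ^ Suc s * b ^ n"
    and P: "\<forall>c>1. (\<lambda>n. real (P n) / c ^ n) \<longlonglongrightarrow> 0"
  shows "a \<le> b"
proof (rule ccontr)
  assume "\<not> a \<le> b"
  then have ab: "b < a" by simp
  have "b \<noteq> 0" using le[of 1] ab by auto
  then have b0: "b > 0" using b by simp
  define q where "q = a / b"
  have q: "q > 1" using ab b0 by (simp add: q_def)
  define c where "c = root (Suc s) q"
  have c: "c > 1" using q by (simp add: c_def)
  have cs: "c ^ Suc s = q" unfolding c_def by (rule real_root_pow_pos2) (use q in auto)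
  have "1 \<le> real (P n) / c ^ n" for n
  proof -
    have "(c ^ n) ^ Suc s = q ^ n" unfolding cs[symmetric] by (simp only: power_mult[symmetric] mult.commute)
    also have "\<dots> \<le> real (P n) ^ Suc s" using le[of n] b0 by (simp add: q_def power_divide field_simps)
    finally have "c ^ n \<le> real (P n)" by (rule power_le_imp_le_base) simp
    then show ?thesis using c by simp
  qed
  then have "1 \<le> (0::real)"
    using P c by (intro LIMSEQ_le_const[of "\<lambda>n. real (P n) / c ^ n"]) auto
  then show False by simp
qed


section \<open>Symmetry of the eigenvalues\<close>

text \<open>
  Since \<open>U\<close> is unitary, its contragredient is the transpose of \<open>U\<^sup>*\<close>; the second contragredient
  exists only if this transpose is invertible, and then the intertwiner \<open>\<rho>\<close> identifies it with
  \<open>\<rho> U \<rho>\<^sup>-\<^sup>1\<close>.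
\<close>

lemma is_rhoD:
  fixes U :: "'a::cstar_algebra mat"
  assumes U: "unitary_representation \<Delta> \<tau> U" and rho: "is_rho \<Delta> \<tau> U \<rho>"
  defines "d \<equiv> dim_row U" and "N \<equiv> the_inverse_mat \<rho>"
  shows "modular_pair d U \<rho> N" and "gram \<rho>" and "traces_agree d U \<rho> N"
proof -
  have uU: "unitary_over d U" using U by (simp add: unitary_representation_iff d_def)
  then have Uc: "U \<in> carrier_mat d d" and UU: "U * star_mat U = 1\<^sub>m d" "star_mat U * U = 1\<^sub>m d"
    by (auto simp: unitary_over_def)
  have sU: "star_mat U \<in> carrier_mat d d" using Uc by simp
  obtain C D where C: "contragredient \<Delta> \<tau> U C" and D: "contragredient \<Delta> \<tau> C D" and M: "\<rho> \<in> Mor U D"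
    using rho by (auto simp: is_rho_def)
  have C_eq: "C = transpose_mat (star_mat U)"
    using C the_inverse_mat_eq[OF Uc sU UU] by (simp add: contragredient_def)
  have Cc: "C \<in> carrier_mat d d" unfolding C_eq using sU by simp
  have "invertible_mat C" using D by (simp add: contragredient_def representation_def)
  then obtain X where X1: "C * X = 1\<^sub>m d" "X * C = 1\<^sub>m (dim_row X)"
    unfolding invertible_mat_def inverts_mat_def carrier_matD[OF Cc] by blast
  have "dim_col (C * X) = d" "dim_col (X * C) = dim_row X" unfolding X1 by simp_all
  then have X: "X \<in> carrier_mat d d" using carrier_matD[OF Cc] by (intro carrier_matI) simp_all
  have X2: "X * C = 1\<^sub>m d" using X1(2) carrier_matD[OF X] by simp
  have D_eq: "D = transpose_mat X"
    using D the_inverse_mat_eq[OF Cc X X1(1) X2] by (simp add: contragredient_def)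
  have Dc: "D \<in> carrier_mat d d" unfolding D_eq using X by simp
  have rc: "\<rho> \<in> carrier_mat d d" and int: "ampliate \<rho> * U = D * ampliate \<rho>"
    using M carrier_matD[OF Dc] carrier_matD[OF Uc] by (simp_all add: Mor_def)
  obtain N' where N': "N' \<in> carrier_mat d d" "\<rho> * N' = 1\<^sub>m d" "N' * \<rho> = 1\<^sub>m d"
    using rho invertible_matE[OF _ rc] by (auto simp: is_rho_def)
  have N: "N = N'" unfolding N_def by (rule the_inverse_mat_eq[OF rc N'])
  have "ampliate \<rho> * U * ampliate N' = D * (ampliate \<rho> * ampliate N')"
    unfolding int using carrier_matD[OF Dc] carrier_matD[OF rc] carrier_matD[OF N'(1)] by (simp add: mat_mult_assoc)
  also have "\<dots> = D"
    unfolding ampliate_mult[OF rc N'(1), symmetric] N'(2) using carrier_matD[OF Dc] by (simp add: mat_mult_one)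
  finally have "transpose_mat (ampliate \<rho> * U * ampliate N) = X" unfolding N D_eq by simp
  then show "modular_pair d U \<rho> N"
    unfolding modular_pair_def inverse_pair_def using X1(1) X2 rc N' N by (simp only: C_eq)
  show "gram \<rho>" using rho positive_mat_gram[OF rc] by (simp add: is_rho_def)
  show "traces_agree d U \<rho> N"
    using rho carrier_matD[OF Uc] by (simp add: is_rho_def traces_agree_def commutant_def Mor_def N_def)
qed

theorem theorem3p4:
  fixes \<Delta> :: "'a::cstar_algebra \<Rightarrow> 'b::cstar_algebra"
    and \<tau> :: "'a \<Rightarrow> 'a \<Rightarrow> 'b"
    and \<tau>l :: "'b \<Rightarrow> 'a \<Rightarrow> 'c::cstar_algebra"
    and \<tau>r :: "'a \<Rightarrow> 'b \<Rightarrow> 'c"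
    and U :: "'a mat" and \<rho> :: "complex mat"
  assumes "compact_quantum_group \<Delta> \<tau> \<tau>l \<tau>r"
    and "unitary_representation \<Delta> \<tau> U"
    and "is_rho \<Delta> \<tau> U \<rho>"
    and "\<forall>c>1. (\<lambda>n. real (max_irrep_dim \<Delta> \<tau> U n) / c ^ n) \<longlonglongrightarrow> 0"
  shows "eigenvalue_list \<rho> = eigenvalue_list (the_inverse_mat \<rho>)"
proof -
  interpret compact_quantum_group \<Delta> \<tau> \<tau>l \<tau>r by fact
  define d N where "d = dim_row U" and "N = the_inverse_mat \<rho>"
  note U = assms(2)
  have uU: "unitary_over d U" and d0: "0 < d" and cU: "comultiplicative \<Delta> \<tau> U"
    using U by (simp_all add: unitary_representation_iff d_def)
  have Uc: "U \<in> carrier_mat d d" using uU by (simp add: unitary_over_def)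
  have m: "modular_pair d U \<rho> N" and g: "gram \<rho>" and t: "traces_agree d U \<rho> N"
    using is_rhoD[OF U assms(3)] by (simp_all add: d_def N_def)
  have p: "inverse_pair d \<rho> N" using m by (simp add: modular_pair_def)
  have gN: "gram N" by (rule gram_inverse[OF p g])
  have c: "\<rho> \<in> carrier_mat d d" "N \<in> carrier_mat d d" using p by (simp_all add: inverse_pair_def)
  have hom: "\<Delta> (x * y) = \<Delta> x * \<Delta> y" "\<tau> a b * \<tau> a' b' = \<tau> (a * a') (b * b')" "\<Delta> 1 = 1" "\<tau> 1 1 = 1" for x y a b a' b'
    using comult_hom tensor_square by (simp_all add: unital_star_hom_def min_tensor_product_def)
  have lin: "linear_over \<Delta>" "linear_over (\<lambda>a. \<tau> a 1)" "linear_over (\<lambda>a. \<tau> 1 a)"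
    using comult_hom tensor_square by (simp_all add: linear_over_def unital_star_hom_def min_tensor_product_def)
  \<comment> \<open>The estimate of \<open>decomposition_exists\<close> for the tensor power, and again with \<open>\<rho>\<close> and \<open>\<rho>\<^sup>-\<^sup>1\<close> exchanged.\<close>
  have pow_bound: "Re (trace_mat (\<rho> ^\<^sub>m s)) ^ n \<le> real (max_irrep_dim \<Delta> \<tau> U n) ^ Suc s * Re (trace_mat (N ^\<^sub>m s)) ^ n"
    "Re (trace_mat (N ^\<^sub>m s)) ^ n \<le> real (max_irrep_dim \<Delta> \<tau> U n) ^ Suc s * Re (trace_mat (\<rho> ^\<^sub>m s)) ^ n" for s n
  proof -
    let ?A = "kron_power U n" and ?R = "kron_power \<rho> n" and ?N = "kron_power N n"
    have data: "unitary_over (d ^ n) ?A" "modular_pair (d ^ n) ?A ?R ?N" "gram ?R" "gram ?N" "traces_agree (d ^ n) ?A ?R ?N"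
      using modular_data_kron_power[OF uU m g gN t, of n] by blast+
    obtain G where G: "?N = G * mat_adjoint G" using data(4) by (auto simp: gram_def)
    have cr: "completely_reducible (d ^ n) ?A"
      unfolding completely_reducible_def using invariant_projection_commutes[OF data(1,2) G] by blast
    have com: "comultiplicative \<Delta> \<tau> ?A"
    proof (induction n)
      case 0
      have "map_mat h (1\<^sub>m 1) = 1\<^sub>m 1" if "h 1 = 1" for h :: "'a \<Rightarrow> 'b"
        by (rule eq_matI) (use that in auto)
      from this[of \<Delta>] this[of "\<lambda>a. \<tau> a 1"] this[of "\<lambda>a. \<tau> 1 a"]
      have "map_mat \<Delta> (1\<^sub>m 1) = 1\<^sub>m 1" "map_mat (\<lambda>a. \<tau> a 1) (1\<^sub>m 1) = 1\<^sub>m 1" "map_mat (\<lambda>a. \<tau> 1 a) (1\<^sub>m 1) = 1\<^sub>m 1"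
        using hom(3,4) by blast+
      then show ?case unfolding comultiplicative_def kron_power.simps by (simp only:) simp
    next
      case (Suc n)
      then show ?case
        unfolding kron_power.simps
        by (intro comultiplicative_kron[OF hom(1,2) kron_power_carrier[OF Uc] _ Uc cU])
    qed
    have bal: "balanced (d ^ n) ?A ?R ?N"
      unfolding balanced_def
    proof (intro conjI ballI)
      show "inverse_pair (d ^ n) ?R ?N" using data(2) by (simp only: modular_pair_def)
    qed (rule data modular_commutes[OF data]; assumption?)+
    from decomposition_exists[OF lin data(1) zero_less_power[OF d0] com cr]
    obtain Vs where Vs: "decomposition \<Delta> \<tau> ?A Vs"
      and bound: "\<forall>R N s. balanced (d ^ n) ?A R N \<longrightarrow>
        Re (trace_mat (R ^\<^sub>m s)) \<le> real (Max (dim_row ` set Vs)) ^ Suc s * Re (trace_mat (N ^\<^sub>m s))"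
      by (elim exE conjE)
    have max: "max_irrep_dim \<Delta> \<tau> U n = Max (dim_row ` set Vs)"
      using Vs kron_power_carrier[OF Uc, of n]
      by (intro max_irrep_dim_eq[of \<Delta> \<tau> U n Vs "d ^ n"]) (simp_all add: tensor_power_eq_kron_power)
    have real: "trace_mat (\<rho> ^\<^sub>m s) = of_real (Re (trace_mat (\<rho> ^\<^sub>m s)))" "trace_mat (N ^\<^sub>m s) = of_real (Re (trace_mat (N ^\<^sub>m s)))"
      by (rule trace_gram_pow_nonneg(1)[OF p g], rule trace_gram_pow_nonneg(1)[OF inverse_pair_sym[OF p] gN])
    have tr: "Re (trace_mat (?R ^\<^sub>m s)) = Re (trace_mat (\<rho> ^\<^sub>m s)) ^ n" "Re (trace_mat (?N ^\<^sub>m s)) = Re (trace_mat (N ^\<^sub>m s)) ^ n"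
      unfolding trace_kron_power_pow[OF c(1)] trace_kron_power_pow[OF c(2)]
      by (subst real(1), simp only: Re_complex_of_real flip: of_real_power)
        (subst real(2), simp only: Re_complex_of_real flip: of_real_power)
    show "Re (trace_mat (\<rho> ^\<^sub>m s)) ^ n \<le> real (max_irrep_dim \<Delta> \<tau> U n) ^ Suc s * Re (trace_mat (N ^\<^sub>m s)) ^ n"
      using bound[rule_format, OF bal, of s] unfolding tr max .
    show "Re (trace_mat (N ^\<^sub>m s)) ^ n \<le> real (max_irrep_dim \<Delta> \<tau> U n) ^ Suc s * Re (trace_mat (\<rho> ^\<^sub>m s)) ^ n"
      using bound[rule_format, OF balanced_sym[OF bal], of s] unfolding tr max .
  qed
  have nn: "0 \<le> Re (trace_mat (\<rho> ^\<^sub>m s))" "0 \<le> Re (trace_mat (N ^\<^sub>m s))" for s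
    by (rule trace_gram_pow_nonneg(2)[OF p g], rule trace_gram_pow_nonneg(2)[OF inverse_pair_sym[OF p] gN])
  have traces: "Re (trace_mat (\<rho> ^\<^sub>m s)) = Re (trace_mat (N ^\<^sub>m s))" for s
    by (rule antisym[OF growth_comparison[OF nn(1,2) pow_bound(1) assms(4)]
          growth_comparison[OF nn(2,1) pow_bound(2) assms(4)]])
  obtain Q r where Q: "unitary_mat d Q" and rd: "\<rho> = Q * real_diag d r * mat_adjoint Q"
    and Nd: "N = Q * real_diag d (\<lambda>i. 1 / r i) * mat_adjoint Q"
    using gram_diagonalization[OF p g] by blast
  have "(\<Sum>i<d. r i ^ s) = (\<Sum>i<d. (1 / r i) ^ s)" for s
    using traces[of s] unfolding rd Nd unitary_conj_pow[OF Q] trace_unitary_conj[OF Q] Re_complex_of_real .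
  then have "image_mset r (mset_set {..<d}) = image_mset (\<lambda>i. 1 / r i) (mset_set {..<d})"
    by (rule power_sums_determine_multiset)
  then show ?thesis
    unfolding N_def[symmetric] unfolding rd Nd eigenvalue_list_unitary_conj[OF Q] by (simp only:)
qed

end
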